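(* Let $\alpha$ be an irrational number with continued fraction expansion $\alpha=[0;a_1,a_2,\ldots]$ satisfying $\limsup_{i\to\infty} a_i\leqslant 3$. Then $$\liminf_{N\to\infty} P_N(\alpha)>0 \quad\text{and}\quad \limsup_{N\to\infty}\frac{P_N(\alpha)}{N}<\infty.$$
   Context: For $\alpha\in\mathbb{R}$ and $N\in\mathbb{N}$, the Sudler product is $P_N(\alpha)=\prod_{r=1}^{N}2\lvert\sin(\pi r\alpha)\rvert$. *)

theory Defs
  imports Complex_Main "HOL-Library.Extended_Real"
begin

definition sudler :: "real \<Rightarrow> nat \<Rightarrow> real" where
  "sudler \<alpha> N = (\<Prod>r=1..N. 2 * \<bar>sin (pi * real r * \<alpha>)\<bar>)"

text \<open>The value of a finite continued fraction; the value on the empty list is arbitrary.\<close>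

fun cfrac_value :: "real list \<Rightarrow> real" where
  "cfrac_value [] = 0"
| "cfrac_value [x] = x"
| "cfrac_value (x # y # ys) = x + 1 / cfrac_value (y # ys)"

text \<open>The infinite simple continued fraction expansion \<open>\<alpha> = [c; a 1, a 2, \<dots>]\<close>.
  The partial quotients are indexed from 1, so \<open>a 0\<close> plays no role.\<close>

definition has_cfrac_expansion :: "real \<Rightarrow> int \<Rightarrow> (nat \<Rightarrow> nat) \<Rightarrow> bool" where
  "has_cfrac_expansion \<alpha> c a \<longleftrightarrow>
     (\<forall>i\<ge>1. 1 \<le> a i) \<and>
     (\<lambda>n. cfrac_value (real_of_int c # map (\<lambda>i. real (a i)) [1..<Suc n])) \<longlonglongrightarrow> \<alpha>"

end

theory Submission
  imports Defs "HOL-Analysis.Analysis"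
begin

text \<open>
  Write \<open>N\<close> in its Ostrowski expansion and split the product into blocks of \<open>q k\<close> consecutive factors,
  starting with the largest \<open>k\<close>. The logarithm of a block is a jointly concave function of the
  distance of \<open>\<alpha>\<close> to the convergent and of the shift, and it is even in the shift measured from the
  centre of the block. At the mediants of neighbouring convergents the product of all blocks is known
  exactly, since a full period of the sine product is elementary; concavity interpolates between such
  points. The derivative at the convergent obeys a contracting recursion in the partial quotients, which
  for partial quotients at most 3 gives uniform numerical bounds. These show that every digit multiplies
  the product by a factor that pays for the shift it creates, so that an invariant relating the shift
  and the product accumulated so far survives from the top digit down to a fixed level. This
  gives the lower bound. For the upper bound, reflect \<open>r \<mapsto> q (k + 1) - r\<close>: the missing factors up to
  \<open>q (k + 1) - 1\<close> form a shifted product of the same type, which is bounded below by the same argument,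
  while the product over all \<open>r < q (k + 1)\<close> is of order \<open>q (k + 1)\<close>.
\<close>

text \<open>The danger is a negative shift \<open>t\<close>: the last sine in the first block of a
  digit is roughly proportional to \<open>1 + t\<close>, so that block can be very small and the
  blocks split off earlier must compensate. A digit \<open>b\<close> at level \<open>k\<close> turns
  the shift into \<open>- \<xi> k * (b + t)\<close>; a large digit thus creates a dangerous shift,
  but it also contributes several blocks, and with the bound 3 on the partial quotients their
  product exceeds 1 at shift 0. The numerical work shows that this gain wins for every digit
  pattern. Lower bounds at \<alpha> use no asymptotics: the parameter point of a block is put on a
  segment between two rational points. The identity at a mediant couples the blocks at
  \<open>p/q\<close> with one at the neighbour \<open>p'/q'\<close>, so a lower bound for the former
  needs an upper bound for the latter; the slope supplies it. All this is done only at levels beyond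
  which the digits are at most 3 and the slope error has died out; the finitely many lower levels
  cost a constant factor.\<close>

section \<open>Sine products over a full period of a rational rotation\<close>

lemma abs_sin_pi_cong:
  fixes x y :: real
  assumes "x - y \<in> \<int>"
  shows "\<bar>sin (pi * x)\<bar> = \<bar>sin (pi * y)\<bar>"
proof -
  from assms obtain n where n: "x = y + of_int n"
    by (metis Ints_cases add.commute diff_eq_eq)
  have "sin (pi * x) = sin (pi * y) * cos (pi * of_int n) + cos (pi * y) * sin (pi * of_int n)"
    by (simp add: n ring_distribs sin_add)
  moreover have "sin (pi * of_int n) = 0"
    using sin_npi_int[of n] by simp
  moreover from this have "\<bar>cos (pi * of_int n)\<bar> = 1"
    by (rule sin_zero_abs_cos_one)
  ultimately show ?thesis by (simp add: abs_mult)
qed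

lemma prod_roots_unity_linear:
  fixes z :: complex
  assumes "n > 0"
  shows "(\<Prod>w | w ^ n = 1. z - w) = z ^ n - 1"
    and "(\<Prod>w \<in> {w. w ^ n = 1} - {1}. z - w) = (\<Sum>i<n. z ^ i)"
proof -
  let ?A = "{w::complex. w ^ n = 1}"
  have fin: "finite ?A" using assms by (intro finite_roots_unity) auto
  have card: "card ?A = n" using assms by (intro card_roots_unity_eq)
  define P where "P = (\<Prod>w\<in>?A. [:-w, 1:])"
  define B where "B = ([:0,1:] :: complex poly) ^ n - 1"
  have degP: "degree P = n"
    unfolding P_def by (subst degree_prod_eq_sum_degree) (auto simp: card)
  have Bm: "B = monom 1 n - 1" by (simp add: B_def monom_altdef)
  have degB: "degree B \<le> n" unfolding Bm by (rule degree_diff_le) (auto simp: degree_monom_le)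
  have lcP: "coeff P n = 1"
    using lead_coeff_prod[of "\<lambda>w. [:-w, 1:]" ?A] degP by (simp add: P_def)
  have lcB: "coeff B n = 1" using assms by (simp add: Bm)
  have eq: "P = B"
  proof (rule poly_eqI_degree_lead_coeff[where A = ?A and n = n])
    fix w assume w: "w \<in> ?A"
    then have "poly P w = 0" using fin by (auto simp: P_def poly_prod prod_zero_iff)
    moreover have "poly B w = 0" using w by (simp add: B_def)
    ultimately show "poly P w = poly B w" by simp
  qed (use card degP degB lcP lcB in auto)
  have "poly P z = (\<Prod>w\<in>?A. z - w)" by (simp add: P_def poly_prod)
  moreover have "poly B z = z ^ n - 1" by (simp add: B_def)
  ultimately show "(\<Prod>w | w ^ n = 1. z - w) = z ^ n - 1" using eq by simp
  define P' where "P' = (\<Prod>w\<in>?A - {1}. [:-w, 1:])"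
  have "P = [:-1, 1:] * P'"
    unfolding P_def P'_def using fin by (subst prod.remove[of _ 1]) auto
  moreover have "B = [:-1, 1:] * (\<Sum>i<n. [:0,1:] ^ i)"
    unfolding B_def by (subst power_diff_1_eq) (simp add: one_pCons)
  ultimately have "P' = (\<Sum>i<n. [:0,1:] ^ i)"
    using eq by (metis mult_left_cancel pCons_eq_0_iff one_neq_zero)
  then have "poly P' z = (\<Sum>i<n. z ^ i)" by (simp add: poly_sum)
  then show "(\<Prod>w \<in> ?A - {1}. z - w) = (\<Sum>i<n. z ^ i)"
    by (simp add: P'_def poly_prod)
qed

lemma dist_cis_1: "norm (cis t - 1) = 2 * \<bar>sin (t / 2)\<bar>"
  using dist_exp_i_1[of t] by (simp add: cis_conv_exp)

lemma norm_cis_minus_root: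
  fixes s :: real and k n :: nat
  shows "norm (cis (-(2 * pi * s)) - cis (2 * pi * k / n)) = 2 * \<bar>sin (pi * (k / n + s))\<bar>"
proof -
  have "cis (-(2 * pi * s)) - cis (2 * pi * k / n)
     = cis (-(2 * pi * s)) * (1 - cis (2 * pi * (k / n + s)))"
    by (simp add: right_diff_distrib cis_mult) (simp add: algebra_simps)
  then have "norm (cis (-(2 * pi * s)) - cis (2 * pi * k / n)) = norm (cis (2 * pi * (k / n + s)) - 1)"
    by (simp add: norm_mult norm_minus_commute)
  then show ?thesis by (simp add: dist_cis_1 mult.assoc)
qed

text \<open>The factorisation of \<open>z ^ n - 1\<close> is evaluated on the unit circle, where the
  distance to a root of unity is a chord and hence twice a sine. The second part takes
  \<open>z = 1\<close> with the root 1 removed.\<close>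

lemma prod_sin_arith:
  fixes s :: real
  assumes "n > 0"
  shows "(\<Prod>k<n. 2 * \<bar>sin (pi * (real k / n + s))\<bar>) = 2 * \<bar>sin (pi * (n * s))\<bar>"
    and "(\<Prod>k = 1..<n. 2 * \<bar>sin (pi * (real k / n))\<bar>) = n"
proof -
  let ?A = "{w::complex. w ^ n = 1}"
  have bij: "bij_betw (\<lambda>k. cis (2 * pi * real k / real n)) {..<n} ?A"
    using Complex.bij_betw_roots_unity[OF assms] .
  let ?z = "cis (-(2 * pi * s))"
  have "(\<Prod>k<n. 2 * \<bar>sin (pi * (real k / n + s))\<bar>)
      = (\<Prod>k<n. norm (?z - cis (2 * pi * k / n)))"
    by (intro prod.cong) (auto simp: norm_cis_minus_root)
  also have "\<dots> = norm (\<Prod>k<n. ?z - cis (2 * pi * k / n))"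
    by (simp add: prod_norm)
  also have "(\<Prod>k<n. ?z - cis (2 * pi * k / n)) = (\<Prod>w\<in>?A. ?z - w)"
    by (rule prod.reindex_bij_betw[OF bij])
  also have "\<dots> = ?z ^ n - 1" by (rule prod_roots_unity_linear(1)[OF assms])
  also have "?z ^ n = cis (-(2 * pi * (n * s)))"
    by (simp add: Complex.DeMoivre mult_ac)
  also have "norm (\<dots> - 1) = 2 * \<bar>sin (pi * (n * s))\<bar>"
    by (subst dist_cis_1) simp
  finally show "(\<Prod>k<n. 2 * \<bar>sin (pi * (real k / n + s))\<bar>) = 2 * \<bar>sin (pi * (n * s))\<bar>" .
  have bij': "bij_betw (\<lambda>k. cis (2 * pi * real k / real n)) {1..<n} (?A - {1})"
  proof -
    have "{1..<n} = {..<n} - {0}" by auto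
    moreover have "(\<lambda>k. cis (2 * pi * real k / real n)) 0 = 1" by simp
    ultimately show ?thesis
      using bij_betw_DiffI[OF bij, of "{0}" "{1}"] assms by (auto simp: bij_betw_def)
  qed
  have "(\<Prod>k=1..<n. 2 * \<bar>sin (pi * (real k / n))\<bar>)
      = (\<Prod>k=1..<n. norm (1 - cis (2 * pi * k / n)))"
    using norm_cis_minus_root[of 0] by (intro prod.cong) auto
  also have "\<dots> = norm (\<Prod>k=1..<n. 1 - cis (2 * pi * k / n))"
    by (simp add: prod_norm)
  also have "(\<Prod>k=1..<n. 1 - cis (2 * pi * k / n)) = (\<Prod>w\<in>?A - {1}. 1 - w)"
    by (rule prod.reindex_bij_betw[OF bij'])
  also have "\<dots> = (\<Sum>i<n. 1 ^ i)" by (rule prod_roots_unity_linear(2)[OF assms])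
  finally show "(\<Prod>k = 1..<n. 2 * \<bar>sin (pi * (real k / n))\<bar>) = n" by simp
qed

lemma bij_betw_mult_mod:
  fixes P :: int and Q :: nat
  assumes "coprime P (int Q)" "Q > 0"
  shows "bij_betw (\<lambda>r. nat ((int r * P) mod int Q)) {1..<Q} {1..<Q}"
proof -
  have inj: "inj_on (\<lambda>r. nat ((int r * P) mod int Q)) {1..<Q}"
  proof (rule inj_onI)
    fix x y assume x: "x \<in> {1..<Q}" and y: "y \<in> {1..<Q}"
      and e: "nat ((int x * P) mod int Q) = nat ((int y * P) mod int Q)"
    then have "(int x * P) mod int Q = (int y * P) mod int Q"
      using assms(2) by (simp add: nat_eq_iff)
    then have "int Q dvd (int x - int y) * P"
      by (simp add: mod_eq_dvd_iff left_diff_distrib)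
    then have "int Q dvd int x - int y" using assms(1)
      by (simp add: coprime_commute coprime_dvd_mult_left_iff)
    then have "int x - int y = 0"
      using x y dvd_imp_le_int[of "int x - int y" "int Q"] by fastforce
    then show "x = y" by simp
  qed
  moreover have "(\<lambda>r. nat ((int r * P) mod int Q)) ` {1..<Q} \<subseteq> {1..<Q}"
  proof safe
    fix r assume r: "r \<in> {1..<Q}"
    have "\<not> int Q dvd int r * P"
    proof
      assume "int Q dvd int r * P"
      then have "int Q dvd int r" using assms(1)
        by (simp add: coprime_commute coprime_dvd_mult_left_iff)
      then show False using r by (auto dest: zdvd_imp_le)
    qed
    then have "(int r * P) mod int Q \<noteq> 0" by (simp only: dvd_eq_mod_eq_0 not_False_eq_True)
    moreover have "(int r * P) mod int Q \<ge> 0" using assms(2) by (intro pos_mod_sign) simp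
    moreover have "(int r * P) mod int Q < int Q" using assms(2) by simp
    ultimately have "1 \<le> (int r * P) mod int Q" "(int r * P) mod int Q < int Q" by linarith+
    then show "nat ((int r * P) mod int Q) \<in> {1..<Q}"
      by (simp add: nat_less_iff le_nat_iff)
  qed
  ultimately show ?thesis
    by (simp add: bij_betw_def endo_inj_surj)
qed

text \<open>Multiplication by \<open>P\<close> permutes the nonzero residues modulo
  \<open>Q\<close>, which reduces the product to equally spaced points; the factor of residue 0 is
  divided out.\<close>

lemma prod_sin_rational:
  fixes P :: int and Q :: nat and s :: real
  assumes "coprime P (int Q)" "Q > 0"
  shows "(\<Prod>r=1..<Q. 2 * \<bar>sin (pi * (r * (P / Q)))\<bar>) = Q"
    and "sin (pi * s) \<noteq> 0 \<Longrightarrow>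
      (\<Prod>r=1..<Q. 2 * \<bar>sin (pi * (r * (P / Q) + s))\<bar>) = \<bar>sin (pi * (Q * s))\<bar> / \<bar>sin (pi * s)\<bar>"
proof -
  have *: "(\<Prod>r=1..<Q. 2 * \<bar>sin (pi * (r * (P / Q) + s))\<bar>)
    = (\<Prod>k=1..<Q. 2 * \<bar>sin (pi * (real k / Q + s))\<bar>)" for s :: real
  proof -
    have "(\<Prod>r=1..<Q. 2 * \<bar>sin (pi * (r * (P / Q) + s))\<bar>)
      = (\<Prod>r=1..<Q. 2 * \<bar>sin (pi * (real (nat ((int r * P) mod int Q)) / Q + s))\<bar>)"
    proof (intro prod.cong refl arg_cong2[where f = times] abs_sin_pi_cong)
      fix r
      have "real_of_int (int r * P) = real_of_int ((int r * P) div int Q) * Q + real_of_int ((int r * P) mod int Q)"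
        by (metis div_mult_mod_eq of_int_add of_int_mult of_int_of_nat_eq)
      then have "real r * (P / Q) + s - (real (nat ((int r * P) mod int Q)) / Q + s)
         = real_of_int ((int r * P) div int Q)"
        using assms(2) by (simp add: field_simps)
      then show "real r * (P / Q) + s - (real (nat ((int r * P) mod int Q)) / Q + s) \<in> \<int>"
        by simp
    qed
    also have "\<dots> = (\<Prod>k=1..<Q. 2 * \<bar>sin (pi * (real k / Q + s))\<bar>)"
      by (rule prod.reindex_bij_betw[OF bij_betw_mult_mod[OF assms]])
    finally show ?thesis .
  qed
  show "(\<Prod>r=1..<Q. 2 * \<bar>sin (pi * (r * (P / Q)))\<bar>) = Q"
    using *[of 0] prod_sin_arith(2)[OF assms(2)] by simp
  assume s: "sin (pi * s) \<noteq> 0"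
  have "{..<Q} = insert 0 {1..<Q}" using assms(2) by auto
  then have "2 * \<bar>sin (pi * s)\<bar> * (\<Prod>k=1..<Q. 2 * \<bar>sin (pi * (real k / Q + s))\<bar>)
     = 2 * \<bar>sin (pi * (Q * s))\<bar>"
    using prod_sin_arith(1)[OF assms(2), of s] by simp
  then show "(\<Prod>r=1..<Q. 2 * \<bar>sin (pi * (r * (P / Q) + s))\<bar>) = \<bar>sin (pi * (Q * s))\<bar> / \<bar>sin (pi * s)\<bar>"
    unfolding * using s by (simp add: nonzero_eq_divide_eq mult.commute)
qed

section \<open>Concavity of block products\<close>

lemma sin_pi_mult_pos: "0 < x \<Longrightarrow> x < 1 \<Longrightarrow> sin (pi * x) > 0"
  using mult_strict_left_mono[of x 1 pi] by (intro sin_gt_zero) auto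

lemma concave_ln_sin: "concave_on {0<..<1} (\<lambda>x. ln (2 * sin (pi * x)))"
proof (rule f''_le0_imp_concave)
  have pos: "sin (pi * x) > 0" if "x \<in> {0<..<1}" for x
    using that by (intro sin_gt_zero) auto
  fix x :: real assume x: "x \<in> {0<..<1}"
  show "((\<lambda>x. ln (2 * sin (pi * x))) has_real_derivative (pi * cos (pi * x) / sin (pi * x))) (at x)"
    using pos[OF x] by (auto intro!: derivative_eq_intros simp: field_simps)
  show "((\<lambda>x. pi * cos (pi * x) / sin (pi * x)) has_real_derivative (- (pi / sin (pi * x))\<^sup>2)) (at x)"
  proof -
    have "((\<lambda>x. pi * cos (pi * x) / sin (pi * x)) has_real_derivative
       ((pi * - (sin (pi * x) * pi)) * sin (pi * x) - pi * cos (pi * x) * (cos (pi * x) * pi)) / (sin (pi * x) * sin (pi * x))) (at x)"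
      using pos[OF x] by (auto intro!: derivative_eq_intros)
    moreover have "((pi * - (sin (pi * x) * pi)) * sin (pi * x) - pi * cos (pi * x) * (cos (pi * x) * pi))
       = - (pi * pi) * ((sin (pi * x))\<^sup>2 + (cos (pi * x))\<^sup>2)"
      unfolding power2_eq_square by algebra
    ultimately show ?thesis
      by (simp only: sin_cos_squared_add power_divide) (simp add: power2_eq_square)
  qed
  show "- (pi / sin (pi * x))\<^sup>2 \<le> 0" by simp
qed auto

lemma concave_ln_sin_ineq:
  assumes "0 < x" "x < 1" "0 < y" "y < 1" "0 \<le> l" "l \<le> 1"
  shows "ln (2 * sin (pi * (l * x + (1 - l) * y))) \<ge> l * ln (2 * sin (pi * x)) + (1 - l) * ln (2 * sin (pi * y))"
  using concave_onD[OF concave_ln_sin, of "1 - l" x y] assms by (simp add: algebra_simps)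

text \<open>With \<open>\<alpha> = p/q + C/q\<^sup>2\<close> and \<open>\<sigma> = (y - C/2)/q\<close> this is the logarithm of the product of
  \<open>2 \<bar>sin \<pi>(r\<alpha> + \<sigma>)\<bar>\<close> over \<open>0 < r < q\<close>, written so that no absolute values are needed; \<open>y\<close> is
  the shift measured from the centre of symmetry.\<close>

definition block_log :: "nat \<Rightarrow> int \<Rightarrow> real \<Rightarrow> real \<Rightarrow> real" where
  "block_log q p C y =
     (\<Sum>r=1..<q. ln (2 * sin (pi * ((of_int ((int r * p) mod int q) + (r / q - 1/2) * C + y) / q))))"

text \<open>Since \<open>r / q - 1/2\<close> lies in [-1/2, 1/2], this keeps every perturbation
  below one grid step, so all arguments in \<open>block_log\<close> stay inside (0, 1), where the
  logarithm of the sine is concave.\<close>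

abbreviation admissible :: "real \<Rightarrow> real \<Rightarrow> bool" where
  "admissible C y \<equiv> \<bar>C\<bar> / 2 + \<bar>y\<bar> < 1"

lemma mult_mod_bounds:
  fixes p :: int
  assumes "coprime p (int q)" "r \<in> {1..<q}"
  shows "1 \<le> (int r * p) mod int q" "(int r * p) mod int q \<le> int q - 1"
proof -
  have "nat ((int r * p) mod int q) \<in> {1..<q}"
    using bij_betw_mult_mod[of p q] assms by (auto simp: bij_betw_def)
  then show "1 \<le> (int r * p) mod int q" "(int r * p) mod int q \<le> int q - 1"
    by auto
qed

lemma centred_shift_bound:
  assumes "r \<in> {1..<q}" "admissible C y"
  shows "\<bar>(real r / q - 1/2) * C + y\<bar> < 1"
proof -
  have "0 \<le> real r / q" "real r / q \<le> 1" using assms(1) by (auto simp: field_simps)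
  then have "\<bar>real r / q - 1/2\<bar> \<le> 1/2" by linarith
  then have "\<bar>(real r / q - 1/2) * C\<bar> \<le> 1/2 * \<bar>C\<bar>"
    unfolding abs_mult by (intro mult_right_mono) auto
  then show ?thesis using assms(2) by linarith
qed

lemma block_arg_bounds:
  fixes p :: int
  assumes "coprime p (int q)" "r \<in> {1..<q}" "admissible C y"
  defines "x \<equiv> (of_int ((int r * p) mod int q) + (r / q - 1/2) * C + y) / q"
  shows "0 < x" "x < 1"
proof -
  note n = mult_mod_bounds[OF assms(1,2)]
  then have "1 \<le> real_of_int ((int r * p) mod int q)" "real_of_int ((int r * p) mod int q) \<le> real q - 1"
    by linarith+
  moreover note centred_shift_bound[OF assms(2,3)]
  ultimately have "0 < of_int ((int r * p) mod int q) + (r / q - 1/2) * C + y"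
    "of_int ((int r * p) mod int q) + (r / q - 1/2) * C + y < q" by linarith+
  moreover have "q > 0" using assms(2) by auto
  ultimately show "0 < x" "x < 1" unfolding x_def by (simp_all add: field_simps)
qed

lemma exp_block_log:
  fixes p :: int and \<alpha> \<sigma> :: real
  assumes "coprime p (int q)" "q > 0" "admissible C y"
    and \<alpha>: "\<alpha> = p / q + C / q\<^sup>2" and \<sigma>: "\<sigma> - (y - C/2) / q \<in> \<int>"
  shows "(\<Prod>r=1..<q. 2 * \<bar>sin (pi * (real r * \<alpha> + \<sigma>))\<bar>) = exp (block_log q p C y)"
proof -
  have "(\<Prod>r=1..<q. 2 * \<bar>sin (pi * (real r * \<alpha> + \<sigma>))\<bar>)
    = (\<Prod>r=1..<q. exp (ln (2 * sin (pi * ((of_int ((int r * p) mod int q) + (r / q - 1/2) * C + y) / q)))))"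
  proof (rule prod.cong[OF refl])
    fix r assume r: "r \<in> {1..<q}"
    let ?x = "(of_int ((int r * p) mod int q) + (r / q - 1/2) * C + y) / q"
    obtain k where k: "\<sigma> = (y - C/2) / q + of_int k"
      using \<sigma> by (metis Ints_cases add.commute diff_eq_eq)
    have "real_of_int (int r * p) = real_of_int ((int r * p) div int q) * q + real_of_int ((int r * p) mod int q)"
      by (metis div_mult_mod_eq of_int_add of_int_mult of_int_of_nat_eq)
    then have "real r * real_of_int p / q = of_int ((int r * p) div int q) + of_int ((int r * p) mod int q) / q"
      using assms(2) by (simp add: field_simps)
    moreover have "r * \<alpha> + \<sigma> - ?x = real r * real_of_int p / q - of_int ((int r * p) mod int q) / q + of_int k"
      using assms(2) unfolding \<alpha> k
      by (simp add: add_divide_distrib diff_divide_distrib ring_distribs power2_eq_square)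
    ultimately have "r * \<alpha> + \<sigma> - ?x = of_int ((int r * p) div int q) + of_int k" by simp
    then have "r * \<alpha> + \<sigma> - ?x \<in> \<int>" by simp
    then have "\<bar>sin (pi * (real r * \<alpha> + \<sigma>))\<bar> = \<bar>sin (pi * ?x)\<bar>" by (rule abs_sin_pi_cong)
    moreover have "sin (pi * ?x) > 0"
      using block_arg_bounds[OF assms(1) r assms(3)] by (rule sin_pi_mult_pos)
    ultimately show "2 * \<bar>sin (pi * (real r * \<alpha> + \<sigma>))\<bar> = exp (ln (2 * sin (pi * ?x)))" by simp
  qed
  then show ?thesis by (simp add: block_log_def exp_sum)
qed

lemma mult_mod_reflect:
  fixes p :: int
  assumes "coprime p (int q)" "r \<in> {1..<q}"
  shows "(int (q - r) * p) mod int q = int q - (int r * p) mod int q"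
    and "(int r * (-p)) mod int q = int q - (int r * p) mod int q"
proof -
  have *: "(- (int r * p)) mod int q = int q - (int r * p) mod int q"
    using mult_mod_bounds(1)[OF assms] by (simp add: zmod_zminus1_eq_if)
  show "(int r * (-p)) mod int q = int q - (int r * p) mod int q" using * by simp
  have "int (q - r) * p = - (int r * p) + int q * p"
    using assms(2) by (simp add: of_nat_diff algebra_simps)
  then show "(int (q - r) * p) mod int q = int q - (int r * p) mod int q"
    using * by (metis mod_mult_self2)
qed

text \<open>Replacing \<open>r\<close> by \<open>q - r\<close> reflects the residue and changes the
  sign of \<open>r / q - 1/2\<close>, so each argument \<open>x\<close> becomes
  \<open>1 - x\<close>.\<close>

lemma block_log_even:
  assumes "coprime p (int q)" "q > 0"
  shows "block_log q p C (- y) = block_log q p C y"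
proof -
  have "block_log q p C (- y) = (\<Sum>r=1..<q. ln (2 * sin (pi * ((of_int ((int (q - r) * p) mod int q) + (real (q - r) / q - 1/2) * C + - y) / q))))"
    unfolding block_log_def
    by (rule sum.reindex_bij_witness[of _ "\<lambda>r. q - r" "\<lambda>r. q - r"]) auto
  also have "\<dots> = block_log q p C y"
    unfolding block_log_def
  proof (rule sum.cong[OF refl])
    fix r assume r: "r \<in> {1..<q}"
    have "real (q - r) = real q - real r" using r by (simp add: of_nat_diff)
    then have "pi * ((of_int ((int (q - r) * p) mod int q) + (real (q - r) / q - 1/2) * C + - y) / q)
      = pi - pi * ((of_int ((int r * p) mod int q) + (real r / q - 1/2) * C + y) / q)"
      using assms(2) unfolding mult_mod_reflect(1)[OF assms(1) r] by (simp add: field_simps)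
    then show "ln (2 * sin (pi * ((of_int ((int (q - r) * p) mod int q) + (real (q - r) / q - 1/2) * C + - y) / q)))
      = ln (2 * sin (pi * ((of_int ((int r * p) mod int q) + (real r / q - 1/2) * C + y) / q)))"
      by (metis sin_pi_minus)
  qed
  finally show ?thesis .
qed

lemma block_log_reflect:
  assumes "coprime p (int q)" "q > 0"
  shows "block_log q (- p) C y = block_log q p (- C) y"
proof -
  have "block_log q (- p) C y = block_log q p (- C) (- y)"
    unfolding block_log_def
  proof (rule sum.cong[OF refl])
    fix r assume r: "r \<in> {1..<q}"
    have "pi * ((of_int ((int r * (- p)) mod int q) + (real r / q - 1/2) * C + y) / q)
      = pi - pi * ((of_int ((int r * p) mod int q) + (real r / q - 1/2) * (- C) + (- y)) / q)"
      using assms(2) unfolding mult_mod_reflect(2)[OF assms(1) r] by (simp add: field_simps)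
    then show "ln (2 * sin (pi * ((of_int ((int r * (- p)) mod int q) + (real r / q - 1/2) * C + y) / q)))
      = ln (2 * sin (pi * ((of_int ((int r * p) mod int q) + (real r / q - 1/2) * (- C) + (- y)) / q)))"
      by (metis sin_pi_minus)
  qed
  then show ?thesis using block_log_even[OF assms] by simp
qed

lemma block_log_concave:
  assumes "coprime p (int q)" "q > 0" "admissible C y" "admissible C' y'" "0 \<le> l" "l \<le> 1"
  shows "block_log q p (l * C + (1 - l) * C') (l * y + (1 - l) * y')
    \<ge> l * block_log q p C y + (1 - l) * block_log q p C' y'"
  unfolding block_log_def sum_distrib_left sum.distrib[symmetric]
proof (rule sum_mono)
  fix r assume r: "r \<in> {1..<q}"
  let ?x = "\<lambda>C y. (of_int ((int r * p) mod int q) + (real r / q - 1/2) * C + y) / q"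
  have "?x (l * C + (1 - l) * C') (l * y + (1 - l) * y') = l * ?x C y + (1 - l) * ?x C' y'"
    using assms(2) by (simp add: field_simps)
  then show "l * ln (2 * sin (pi * ?x C y)) + (1 - l) * ln (2 * sin (pi * ?x C' y'))
    \<le> ln (2 * sin (pi * ?x (l * C + (1 - l) * C') (l * y + (1 - l) * y')))"
    using concave_ln_sin_ineq[of "?x C y" "?x C' y'" l] block_arg_bounds[OF assms(1) r] assms(3-6)
    by simp
qed

lemma block_log_antimono_abs:
  assumes "coprime p (int q)" "q > 0" "admissible C y'" "\<bar>y\<bar> \<le> \<bar>y'\<bar>"
  shows "block_log q p C y' \<le> block_log q p C y"
proof (cases "y' = 0")
  case False
  \<comment> \<open>The weight that writes \<open>y\<close> as a convex combination of
    \<open>y'\<close> and \<open>- y'\<close>; an even concave function decreases away from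
    0.\<close>
  define l where "l = (1 + y / y') / 2"
  have "\<bar>y / y'\<bar> \<le> 1" using False assms(4) by (simp add: field_simps)
  then have "- 1 \<le> y / y'" "y / y' \<le> 1" unfolding abs_le_iff by linarith+
  then have l: "0 \<le> l" "l \<le> 1" by (auto simp: l_def)
  have "l * block_log q p C y' + (1 - l) * block_log q p C (- y')
    \<le> block_log q p (l * C + (1 - l) * C) (l * y' + (1 - l) * (- y'))"
    using l assms by (intro block_log_concave) auto
  moreover have "l * C + (1 - l) * C = C" "l * y' + (1 - l) * (- y') = y"
    using False by (auto simp: l_def field_simps)
  ultimately show ?thesis using block_log_even[OF assms(1,2)] by (simp add: algebra_simps)
qed (use assms in auto)

lemma block_log_0:
  assumes "coprime p (int q)" "q > 0"
  shows "block_log q p 0 0 = ln q"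
proof -
  have "exp (block_log q p 0 0) = (\<Prod>r=1..<q. 2 * \<bar>sin (pi * (real r * (p / q) + 0))\<bar>)"
    using exp_block_log[OF assms, of 0 0 "p / q" 0] by simp
  also have "\<dots> = q" using prod_sin_rational(1)[OF assms] by simp
  finally show ?thesis by (metis ln_exp)
qed

text \<open>At \<open>C = 0\<close> the block is exactly the quotient of the sines of
  \<open>pi * y\<close> and \<open>pi * y / q\<close>; bounding the small sine by its argument makes
  the estimate uniform in \<open>q\<close>.\<close>

lemma block_log_0_ge:
  assumes "coprime p (int q)" "q > 0" "\<bar>y\<bar> < 1" "y \<noteq> 0"
  shows "block_log q p 0 y \<ge> ln q + ln (sin (pi * \<bar>y\<bar>) / (pi * \<bar>y\<bar>))"
proof -
  define z where "z = \<bar>y\<bar>"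
  have z: "0 < z" "z < 1" using assms by (auto simp: z_def)
  have zq: "0 < z / q" "z / q < 1" using z assms(2) by (auto simp: field_simps)
  have s1: "sin (pi * (z / q)) > 0"
    using zq by (rule sin_pi_mult_pos)
  have s2: "sin (pi * z) > 0" using z by (intro sin_gt_zero) auto
  have "block_log q p 0 y = block_log q p 0 z"
    using block_log_even[OF assms(1,2)] by (cases "y \<ge> 0") (auto simp: z_def)
  have "exp (block_log q p 0 z) = (\<Prod>r=1..<q. 2 * \<bar>sin (pi * (real r * (p / q) + z / q))\<bar>)"
    using exp_block_log[OF assms(1,2), of 0 z "p / q" "z / q"] z by simp
  also have "\<dots> = \<bar>sin (pi * (q * (z / q)))\<bar> / \<bar>sin (pi * (z / q))\<bar>"
    using s1 by (intro prod_sin_rational(2) assms) auto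
  also have "\<dots> = sin (pi * z) / sin (pi * (z / q))" using s1 s2 assms(2) by simp
  also have "\<dots> \<ge> sin (pi * z) / (pi * (z / q))"
    using s1 s2 zq z assms(2) by (intro divide_left_mono sin_x_le_x mult_pos_pos) auto
  finally have "exp (block_log q p 0 z) \<ge> q * (sin (pi * z) / (pi * z))"
    using assms(2) by (simp add: field_simps)
  moreover have "q * (sin (pi * z) / (pi * z)) > 0" using s2 z assms(2) by simp
  ultimately have "block_log q p 0 z \<ge> ln (q * (sin (pi * z) / (pi * z)))"
    by (metis ln_exp ln_le_cancel_iff exp_gt_zero)
  also have "ln (q * (sin (pi * z) / (pi * z))) = ln q + ln (sin (pi * z) / (pi * z))"
    using s2 z assms(2) by (subst ln_mult) auto
  finally show ?thesis using \<open>block_log q p 0 y = block_log q p 0 z\<close> by (simp add: z_def)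
qed

section \<open>Exact identities at mediants and slopes at convergents\<close>

lemma bezout_coprime: "x * a + y * b = 1 \<Longrightarrow> coprime a (b :: int)"
proof (rule coprimeI)
  fix c assume "x * a + y * b = 1" "c dvd a" "c dvd b"
  then show "is_unit c" by (metis dvd_add dvd_mult)
qed

lemma prod_split_blocks:
  fixes f :: "nat \<Rightarrow> 'a :: comm_monoid_mult"
  assumes "q > 0" "q' > 0"
  shows "(\<Prod>r=1..<j*q+q'. f r)
    = (\<Prod>b<j. \<Prod>r=1..<q. f (b*q+r)) * (\<Prod>b=1..j. f (b*q)) * (\<Prod>r=1..<q'. f (j*q+r))"
  using assms(2)
proof (induction j arbitrary: q')
  case (Suc j)
  have "{1..<Suc j*q+q'} = {1..<j*q+q} \<union> {Suc j*q..<Suc j*q+q'}" using assms(1) by auto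
  then have "(\<Prod>r=1..<Suc j*q+q'. f r) = (\<Prod>r=1..<j*q+q. f r) * (\<Prod>r=Suc j*q..<Suc j*q+q'. f r)"
    by (simp add: prod.union_disjoint ivl_disj_int)
  also have "(\<Prod>r=Suc j*q..<Suc j*q+q'. f r) = (\<Prod>r=0..<q'. f (Suc j*q+r))"
    using prod.shift_bounds_nat_ivl[of f 0 "Suc j*q" q'] by (simp add: add.commute)
  also have "\<dots> = f (Suc j*q) * (\<Prod>r=1..<q'. f (Suc j*q+r))"
    using Suc.prems by (simp add: prod.atLeast_Suc_lessThan)
  finally show ?case
    unfolding Suc.IH[OF assms(1)] by (simp add: mult_ac)
qed simp

lemma admissible_scaled:
  fixes c u v D :: real
  assumes "0 \<le> c" "c * (\<bar>u\<bar> + v) < 1" "0 \<le> v" "\<bar>D\<bar> = 2 * c * v"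
  shows "admissible D (c * u)"
  using assms by (simp add: abs_mult ring_distribs)

text \<open>At the rational \<open>P/Q\<close> one has \<open>q * P = 1\<close> modulo
  \<open>Q\<close>, so block \<open>b\<close> starts with shift \<open>(b + t) / Q\<close> up to
  integers. The values of \<open>C\<close> are read off from \<open>P/Q - p/q = 1/(q Q)\<close> and
  \<open>P/Q - p'/q' = -j/(q' Q)\<close>; the last argument of each \<open>block_log\<close> is the
  shift measured from the centre of that block.\<close>

lemma block_identity:
  fixes p p' :: int and q q' j :: nat and t :: real
  assumes det: "p' * int q - p * int q' = 1" and q: "q > 0" "0 < q'" "q' \<le> q" and j: "j > 0"
    and t: "-1 < t" "t \<le> 0"
  defines "Q \<equiv> j * q + q'" and "P \<equiv> int j * p + p'"
  shows "(\<Prod>b<j. exp (block_log q p (q/Q) ((q/Q) * (t + b + 1/2))))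
      * (\<Prod>b=1..j. 2 * \<bar>sin (pi * ((b + t) / Q))\<bar>)
      * exp (block_log q' p' (-(j*q'/Q)) ((q'/Q) * (t + j/2)))
    = (\<Prod>r=1..<Q. 2 * \<bar>sin (pi * (real r * (P/Q) + t/Q))\<bar>)"
proof -
  have Q: "Q > 0" "real Q = real j * q + q'" using q by (auto simp: Q_def)
  have det1: "P * int q = 1 + p * int Q" using det by (simp add: P_def Q_def algebra_simps)
  have det2: "P * int q' - p' * int Q = - int j"
  proof -
    have "P * int q' - p' * int Q = int j * (p * int q' - p' * int q)"
      by (simp add: P_def Q_def algebra_simps)
    also have "p * int q' - p' * int q = - 1" using det by simp
    finally show ?thesis by simp
  qed
  have cop: "coprime p (int q)" "coprime p' (int q')"
    using bezout_coprime[of "- int q'" p p' "int q"] bezout_coprime[of "int q" p' "- p" "int q'"] det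
    by (simp_all add: algebra_simps)
  have rdet1: "real_of_int P * real q = 1 + real_of_int p * real Q"
    using arg_cong[OF det1, of real_of_int] by simp
  have rdet2: "real_of_int P * real q' = real_of_int p' * real Q - real j"
    using arg_cong[OF det2, of real_of_int] by simp
  have bP: "real b * real q * real_of_int P = real b * (1 + real_of_int p * real Q)" for b :: nat
  proof -
    have "real b * real q * real_of_int P = real b * (real_of_int P * real q)" by (simp only: mult_ac)
    then show ?thesis by (simp only: rdet1)
  qed
  define f where "f r = 2 * \<bar>sin (pi * (real r * (P/Q) + t/Q))\<bar>" for r :: nat
  have "(\<Prod>r=1..<Q. f r)
    = (\<Prod>b<j. \<Prod>r=1..<q. f (b*q+r)) * (\<Prod>b=1..j. f (b*q)) * (\<Prod>r=1..<q'. f (j*q+r))"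
    unfolding Q_def using q by (intro prod_split_blocks)
  moreover have "(\<Prod>r=1..<q. f (b*q+r)) = exp (block_log q p (q/Q) ((q/Q) * (t + b + 1/2)))"
    if b: "b < j" for b
  proof -
    have "(\<Prod>r=1..<q. f (b*q+r)) = (\<Prod>r=1..<q. 2 * \<bar>sin (pi * (real r * (P/Q) + ((b + t)/Q + b * p)))\<bar>)"
    proof (rule prod.cong[OF refl])
      fix r
      have "real (b*q+r) * (P/Q) + t/Q = real r * (P/Q) + ((b + t)/Q + b * p)"
        using Q(1) bP[of b] by (simp add: field_simps)
      then show "f (b*q+r) = 2 * \<bar>sin (pi * (real r * (P/Q) + ((b + t)/Q + b * p)))\<bar>"
        by (simp add: f_def)
    qed
    also have "\<dots> = exp (block_log q p (q/Q) ((q/Q) * (t + b + 1/2)))"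
    proof (rule exp_block_log[OF cop(1) q(1)])
      show "real_of_int P / Q = p / q + (q/Q) / (real q)\<^sup>2"
        using rdet1 q Q(1) by (simp add: field_simps power2_eq_square)
      have "(b + t)/Q + b * p - ((q/Q) * (t + b + 1/2) - q/Q/2) / q = of_int (b * p)"
        using q Q(1) by (simp add: field_simps)
      then show "(b + t)/Q + b * p - ((q/Q) * (t + b + 1/2) - q/Q/2) / q \<in> \<int>" by (metis Ints_of_int)
      have "\<bar>t + b + 1/2\<bar> + 1/2 \<le> real j"
        using t b by (auto simp: abs_if)
      then have "(q/Q) * (\<bar>t + b + 1/2\<bar> + 1/2) \<le> (q/Q) * real j"
        by (intro mult_left_mono) auto
      also have "\<dots> < 1" using Q q by (simp add: field_simps)
      finally show "\<bar>real q/Q\<bar> / 2 + \<bar>(q/Q) * (t + b + 1/2)\<bar> < 1"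
        by (intro admissible_scaled[where v = "1/2"]) auto
    qed
    finally show ?thesis .
  qed
  moreover have "f (b*q) = 2 * \<bar>sin (pi * ((b + t) / Q))\<bar>" for b
  proof -
    have "real (b*q) * (P/Q) + t/Q - (b + t)/Q = of_int (b * p)"
      using Q(1) bP[of b] by (simp add: field_simps)
    then have "real (b*q) * (P/Q) + t/Q - (b + t)/Q \<in> \<int>" by (metis Ints_of_int)
    then show ?thesis unfolding f_def by (simp only: abs_sin_pi_cong)
  qed
  moreover have "(\<Prod>r=1..<q'. f (j*q+r)) = exp (block_log q' p' (-(j*q'/Q)) ((q'/Q) * (t + j/2)))"
  proof -
    have "(\<Prod>r=1..<q'. f (j*q+r)) = (\<Prod>r=1..<q'. 2 * \<bar>sin (pi * (real r * (P/Q) + ((j + t)/Q + j * p)))\<bar>)"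
    proof (rule prod.cong[OF refl])
      fix r
      have "real (j*q+r) * (P/Q) + t/Q = real r * (P/Q) + ((j + t)/Q + j * p)"
        using Q(1) bP[of j] by (simp add: field_simps)
      then show "f (j*q+r) = 2 * \<bar>sin (pi * (real r * (P/Q) + ((j + t)/Q + j * p)))\<bar>"
        by (simp add: f_def)
    qed
    also have "\<dots> = exp (block_log q' p' (-(j*q'/Q)) ((q'/Q) * (t + j/2)))"
    proof (rule exp_block_log[OF cop(2) q(2)])
      show "real_of_int P / Q = p' / q' + (-(j*q'/Q)) / (real q')\<^sup>2"
        using rdet2 q Q(1) by (simp add: field_simps power2_eq_square)
      have "(j + t)/Q + j * p - ((q'/Q) * (t + j/2) - (-(j*q'/Q))/2) / q' = of_int (j * p)"
        using q Q(1) by (simp add: field_simps)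
      then show "(j + t)/Q + j * p - ((q'/Q) * (t + j/2) - (-(j*q'/Q))/2) / q' \<in> \<int>" by (metis Ints_of_int)
      have "\<bar>t + j/2\<bar> + j/2 \<le> real j"
        using t j by (auto simp: abs_if)
      then have "(q'/Q) * (\<bar>t + j/2\<bar> + j/2) \<le> (q'/Q) * real j"
        by (intro mult_left_mono) auto
      also have "\<dots> < 1"
      proof -
        have "real q' * j \<le> real j * q" using q by (simp add: mult.commute mult_left_mono)
        then show ?thesis using Q q by (simp add: field_simps)
      qed
      finally show "\<bar>-(real (j*q')/Q)\<bar> / 2 + \<bar>(q'/Q) * (t + j/2)\<bar> < 1"
        by (intro admissible_scaled[where v = "j/2"]) auto
    qed
    finally show ?thesis .
  qed
  ultimately show ?thesis unfolding f_def by (simp add: mult_ac)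
qed

text \<open>\<open>U\<close> bounds the derivative of \<open>block_log q p\<close> at \<open>(0,0)\<close> in direction \<open>C\<close>.\<close>

definition slope_le :: "nat \<Rightarrow> int \<Rightarrow> real \<Rightarrow> bool" where
  "slope_le q p U \<longleftrightarrow> (\<forall>C\<in>{0..1}. block_log q p C 0 \<le> ln q + U * C)"

text \<open>Only finiteness matters: the contracting recursion for the slopes forgets its starting
  value.\<close>

lemma slope_le_exists:
  assumes "coprime p (int q)" "q > 0"
  shows "\<exists>U. slope_le q p U"
proof
  show "slope_le q p (ln q - block_log q p (-1) 0)"
    unfolding slope_le_def
  proof
    fix C :: real assume C: "C \<in> {0..1}"
    \<comment> \<open>Places 0 between \<open>C\<close> and -1, so that the value at -1 limits the
      growth to the right of 0.\<close>
    define l where "l = 1 / (1 + C)"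
    have l: "0 \<le> l" "l \<le> 1" using C by (auto simp: l_def)
    have "l * block_log q p C 0 + (1 - l) * block_log q p (-1) 0
      \<le> block_log q p (l * C + (1 - l) * (-1)) (l * 0 + (1 - l) * 0)"
      using C l by (intro block_log_concave assms) auto
    also have "l * C + (1 - l) * (-1) = 0" using C by (simp add: l_def field_simps)
    finally have "l * block_log q p C 0 \<le> ln q - (1 - l) * block_log q p (-1) 0"
      by (simp add: block_log_0[OF assms])
    then have "(1 + C) * (l * block_log q p C 0) \<le> (1 + C) * (ln q - (1 - l) * block_log q p (-1) 0)"
      using C by (intro mult_left_mono) auto
    moreover have "(1 + C) * (l * block_log q p C 0) = block_log q p C 0" 
      "(1 + C) * (ln q - (1 - l) * block_log q p (-1) 0) = (1 + C) * ln q - C * block_log q p (-1) 0"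
      using C by (auto simp: l_def field_simps)
    ultimately show "block_log q p C 0 \<le> ln q + (ln q - block_log q p (-1) 0) * C"
      by (simp add: algebra_simps)
  qed
qed

text \<open>The mediant of \<open>p/q\<close> and its left neighbour \<open>p'/q'\<close> is where the two block products multiply
  to something explicit; concavity transports this to the other side of \<open>p/q\<close>.\<close>

lemma slope_le_step:
  fixes p p' :: int and q q' :: nat
  assumes det: "p * int q' - p' * int q = 1" and q: "0 < q'" "q' \<le> q" and U: "slope_le q' p' U"
  shows "slope_le q p ((q + q') / q * ln (pi\<^sup>2 * q * q' / (2 * (q + q')\<^sup>2)) + q' / q * U)"
proof -
  define Q where "Q = real q + real q'"
  have qpos: "q > 0" using q by simp
  have cop: "coprime p (int q)" "coprime p' (int q')"
    using bezout_coprime[of "int q'" p "- p'" "int q"] bezout_coprime[of "- int q" p' p "int q'"] det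
    by (simp_all add: algebra_simps)
  have Q: "Q > 0" "Q \<ge> 1" using q by (auto simp: Q_def)
  \<comment> \<open>Negating the numerators moves the left neighbour to the right side, as
    \<open>block_identity\<close> requires.\<close>
  have det': "(- p') * int q - (- p) * int q' = 1" using det by simp
  define s where "s = sin (pi * (1 / (2 * Q)))"
  have s: "s > 0" unfolding s_def using Q by (intro sin_pi_mult_pos) (auto simp: field_simps)
  have sle: "s \<le> pi / (2 * Q)" unfolding s_def using Q sin_x_le_x[of "pi * (1 / (2 * Q))"] by simp
  have cop'': "coprime (- p + - p') (int (q + q'))"
  proof -
    have "int q * (- p + - p') + p * int (q + q') = 1" using det by (simp add: algebra_simps)
    then show ?thesis by (rule bezout_coprime)
  qed
  \<comment> \<open>The choice \<open>j = 1\<close>, \<open>t = -1/2\<close> centres both blocks at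
    once. The separating factor is \<open>2 * s\<close> and the full period with this shift equals
    \<open>1 / s\<close>.\<close>
  have "exp (block_log q (- p) (q/Q) 0) * (2 * s) * exp (block_log q' (- p') (- (q'/Q)) 0)
      = (\<Prod>r=1..<q + q'. 2 * \<bar>sin (pi * (real r * (of_int (- p + - p') / real (q + q')) + (- (1/2)) / real (q + q')))\<bar>)"
    using block_identity[OF det' qpos q(1,2), of 1 "- (1/2)"] Q s
    by (simp add: Q_def s_def divide_simps)
  also have "\<dots> = \<bar>sin (pi * (real (q + q') * ((- (1/2)) / real (q + q'))))\<bar> / \<bar>sin (pi * ((- (1/2)) / real (q + q')))\<bar>"
    using s q by (intro prod_sin_rational(2)[OF cop'']) (auto simp: s_def Q_def divide_simps)
  also have "\<dots> = 1 / s"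
  proof -
    have "real (q + q') * ((- (1/2)) / real (q + q')) = - (1/2)" using qpos by simp
    moreover have "pi * ((- (1/2)) / real (q + q')) = - (pi * (1 / (2 * Q)))" by (simp add: Q_def)
    ultimately show ?thesis using s by (simp only: sin_minus s_def[symmetric]) simp
  qed
  finally have e: "exp (block_log q (- p) (q/Q) 0) * exp (block_log q' (- p') (- (q'/Q)) 0) * (2 * s\<^sup>2) = 1"
    using s by (simp add: field_simps power2_eq_square)
  have "block_log q (- p) (q/Q) 0 + block_log q' (- p') (- (q'/Q)) 0 + ln (2 * s\<^sup>2) = 0"
  proof -
    have "ln (exp (block_log q (- p) (q/Q) 0) * exp (block_log q' (- p') (- (q'/Q)) 0) * (2 * s\<^sup>2)) = 0"
      unfolding e by simp
    moreover have "ln (exp x * exp y * c) = x + y + ln c" if "c > 0" for x y c :: real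
      using that by (simp add: exp_add[symmetric] ln_mult)
    ultimately show ?thesis using s by simp
  qed
  moreover have "ln (2 * s\<^sup>2) \<le> ln (pi\<^sup>2 / (2 * Q\<^sup>2))"
  proof (subst ln_le_cancel_iff)
    have "s\<^sup>2 \<le> (pi / (2 * Q))\<^sup>2" using s sle by (intro power_mono) auto
    then show "2 * s\<^sup>2 \<le> pi\<^sup>2 / (2 * Q\<^sup>2)" by (simp add: power2_eq_square field_simps)
  qed (use s Q in auto)
  moreover have "block_log q (- p) (q/Q) 0 = block_log q p (- (q/Q)) 0"
    "block_log q' (- p') (- (q'/Q)) 0 = block_log q' p' (q'/Q) 0"
    using block_log_reflect[OF cop(1) qpos, of "q/Q" 0] block_log_reflect[OF cop(2) q(1), of "- (q'/Q)" 0] by simp_all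
  moreover have "block_log q' p' (q'/Q) 0 \<le> ln q' + U * (q'/Q)"
  proof -
    have "real q'/Q \<in> {0..1}" using q by (auto simp: Q_def field_simps)
    then show ?thesis using U unfolding slope_le_def by blast
  qed
  ultimately have low: "block_log q p (- (q/Q)) 0 \<ge> - ln (pi\<^sup>2 / (2 * Q\<^sup>2)) - ln q' - U * (q'/Q)"
    by linarith
  show ?thesis
    unfolding slope_le_def
  proof
    fix C :: real assume C: "C \<in> {0..1}"
    define D where "D = q / Q"
    have D: "0 < D" "D \<le> 1" using qpos Q by (auto simp: D_def Q_def field_simps)
    \<comment> \<open>Places 0 between \<open>C\<close> and \<open>- D\<close>: by concavity the
      lower bound at \<open>- D\<close> becomes an upper bound at \<open>C\<close>.\<close>
    define l where "l = D / (D + C)"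
    have l: "0 \<le> l" "l \<le> 1" using C D by (auto simp: l_def field_simps)
    have "l * block_log q p C 0 + (1 - l) * block_log q p (- D) 0
      \<le> block_log q p (l * C + (1 - l) * (- D)) (l * 0 + (1 - l) * 0)"
      using C D l by (intro block_log_concave cop qpos) auto
    also have "l * C + (1 - l) * (- D) = 0" using C D by (simp add: l_def field_simps)
    finally have "l * block_log q p C 0 + (1 - l) * block_log q p (- D) 0 \<le> ln q"
      by (simp add: block_log_0[OF cop(1) qpos])
    then have "(D + C) * (l * block_log q p C 0 + (1 - l) * block_log q p (- D) 0) \<le> (D + C) * ln q"
      using C D by (intro mult_left_mono) auto
    moreover have "(D + C) * (l * block_log q p C 0 + (1 - l) * block_log q p (- D) 0)
      = D * block_log q p C 0 + C * block_log q p (- D) 0"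
    proof -
      have "(D + C) * l = D" using C D by (simp add: l_def)
      moreover from this have "(D + C) * (1 - l) = C" by (simp add: algebra_simps)
      ultimately show ?thesis by (simp add: distrib_left mult.assoc[symmetric])
    qed
    ultimately have "D * block_log q p C 0 \<le> D * ln q + C * (ln q - block_log q p (- D) 0)"
      by (simp add: algebra_simps)
    also have "\<dots> \<le> D * ln q + C * (ln q + ln (pi\<^sup>2 / (2 * Q\<^sup>2)) + ln q' + U * (q'/Q))"
      using low C by (intro add_left_mono mult_left_mono) (auto simp: D_def)
    also have "ln q + ln (pi\<^sup>2 / (2 * Q\<^sup>2)) + ln q' = ln (pi\<^sup>2 * q * q' / (2 * Q\<^sup>2))"
      using q qpos Q by (simp add: ln_mult ln_div)
    finally have "block_log q p C 0 \<le> ln q + C / D * (ln (pi\<^sup>2 * q * q' / (2 * Q\<^sup>2)) + U * (q'/Q))"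
      using D by (simp add: field_simps)
    also have "C / D * (ln (pi\<^sup>2 * q * q' / (2 * Q\<^sup>2)) + U * (q'/Q))
       = (Q / q * ln (pi\<^sup>2 * q * q' / (2 * Q\<^sup>2)) + q' / q * U) * C"
      using Q qpos by (simp add: D_def field_simps)
    finally show "block_log q p C 0 \<le> ln q + ((q + q') / q * ln (pi\<^sup>2 * q * q' / (2 * (q + q')\<^sup>2)) + q' / q * U) * C"
      by (simp add: Q_def)
  qed
qed

text \<open>The product over a full period at shift 0 is symmetric under
  \<open>m \<mapsto> Q - m\<close>. Reflecting its last \<open>q\<close> factors makes the first
  block and the factor at \<open>q\<close> occur twice, and the block of length \<open>q'\<close>
  left in the middle is centred.\<close>

lemma block_identity_centred:
  fixes p p' :: int and q q' :: nat
  assumes det: "p' * int q - p * int q' = 1" and q: "0 < q'" "q' \<le> q"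
  defines "Q \<equiv> 2 * q + q'"
  shows "exp (2 * block_log q p (q/Q) (q/Q/2)) * (2 * \<bar>sin (pi * (1/Q))\<bar>)\<^sup>2
      * exp (block_log q' p' (-(2*q'/Q)) 0) = Q"
proof -
  define P where "P = 2 * p + p'"
  define h where "h m = 2 * \<bar>sin (pi * (real m * (P/Q)))\<bar>" for m :: nat
  have qpos: "q > 0" using q by simp
  have Q: "Q > 0" "real Q = 2 * real q + q'" using q by (auto simp: Q_def)
  have cop: "coprime p (int q)" "coprime p' (int q')"
    using bezout_coprime[of "- int q'" p p' "int q"] bezout_coprime[of "int q" p' "- p" "int q'"] det
    by (simp_all add: algebra_simps)
  have det1: "P * int q = 1 + p * int Q" using det by (simp add: P_def Q_def algebra_simps)
  have det2: "P * int q' = p' * int Q - 2" using det by (simp add: P_def Q_def algebra_simps)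
  have rdet1: "real_of_int P * real q = 1 + real_of_int p * real Q"
    using arg_cong[OF det1, of real_of_int] by simp
  have rdet2: "real_of_int P * real q' = real_of_int p' * real Q - 2"
    using arg_cong[OF det2, of real_of_int] by simp
  have copP: "coprime P (int Q)"
    using bezout_coprime[of "int q" P "- p" "int Q"] det1 by (simp add: algebra_simps)
  have hq: "h q = 2 * \<bar>sin (pi * (1/Q))\<bar>"
  proof -
    have "real q * (P/Q) - 1/Q = real_of_int p"
      using rdet1 Q(1) by (simp add: field_simps)
    then have "real q * (P/Q) - 1/Q \<in> \<int>" by (metis Ints_of_int)
    then show ?thesis unfolding h_def by (simp only: abs_sin_pi_cong)
  qed
  have hrefl: "h (Q - m) = h m" if "m \<le> Q" for m
  proof -
    have "real (Q - m) * (P/Q) - (- (real m * (P/Q))) = real_of_int P"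
      using that Q(1) by (simp add: of_nat_diff field_simps)
    then have "real (Q - m) * (P/Q) - (- (real m * (P/Q))) \<in> \<int>" by (metis Ints_of_int)
    then have "\<bar>sin (pi * (real (Q - m) * (P/Q)))\<bar> = \<bar>sin (pi * (- (real m * (P/Q))))\<bar>"
      by (rule abs_sin_pi_cong)
    then show ?thesis unfolding h_def by simp
  qed
  have "real Q = (\<Prod>m=1..<Q. h m)" unfolding h_def by (rule prod_sin_rational(1)[OF copP Q(1), symmetric])
  also have "{1..<Q} = {1..<q+q'} \<union> {q+q'..<Q}" using q by (auto simp: Q_def)
  also have "(\<Prod>m\<in>{1..<q+q'} \<union> {q+q'..<Q}. h m) = (\<Prod>m=1..<q+q'. h m) * (\<Prod>m=q+q'..<Q. h m)"
    by (intro prod.union_disjoint) auto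
  also have "(\<Prod>m=q+q'..<Q. h m) = (\<Prod>m=1..q. h m)"
  proof (rule prod.reindex_bij_witness[of _ "\<lambda>m. Q - m" "\<lambda>m. Q - m"])
    fix m assume "m \<in> {q+q'..<Q}"
    then show "h (Q - m) = h m" by (intro hrefl) auto
  qed (auto simp: Q_def)
  also have "{1..q} = insert q {1..<q}" using qpos by auto
  also have "(\<Prod>m\<in>insert q {1..<q}. h m) = h q * (\<Prod>m=1..<q. h m)" by simp
  also have "(\<Prod>m=1..<q+q'. h m) = (\<Prod>m=1..<q. h m) * h q * (\<Prod>m=1..<q'. h (q+m))"
    using prod_split_blocks[OF qpos q(1), of h 1] by simp
  also have "(\<Prod>m=1..<q. h m) = exp (block_log q p (q/Q) (q/Q/2))"
  proof -
    have "(\<Prod>m=1..<q. h m) = (\<Prod>m=1..<q. 2 * \<bar>sin (pi * (real m * (P/Q) + 0))\<bar>)"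
      by (simp add: h_def)
    also have "\<dots> = exp (block_log q p (q/Q) (q/Q/2))"
    proof (rule exp_block_log[OF cop(1) qpos])
      show "real_of_int P / Q = p / q + (q/Q) / (real q)\<^sup>2"
        using rdet1 q Q(1) by (simp add: field_simps power2_eq_square)
      have "real q / Q < 1" using Q qpos by (simp add: field_simps)
      then show "\<bar>real q / Q\<bar> / 2 + \<bar>real q / Q / 2\<bar> < 1" by simp
    qed simp
    finally show ?thesis .
  qed
  also have "(\<Prod>m=1..<q'. h (q+m)) = exp (block_log q' p' (-(2*q'/Q)) 0)"
  proof -
    have "(\<Prod>m=1..<q'. h (q+m)) = (\<Prod>m=1..<q'. 2 * \<bar>sin (pi * (real m * (P/Q) + (1/Q + p)))\<bar>)"
    proof (rule prod.cong[OF refl])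
      fix m
      have "real (q + m) * (P/Q) = real m * (P/Q) + (1/Q + p)"
        using rdet1 Q(1) by (simp add: field_simps)
      then show "h (q+m) = 2 * \<bar>sin (pi * (real m * (P/Q) + (1/Q + p)))\<bar>"
        by (simp add: h_def)
    qed
    also have "\<dots> = exp (block_log q' p' (-(2*q'/Q)) 0)"
    proof (rule exp_block_log[OF cop(2) q(1)])
      show "real_of_int P / Q = p' / q' + (-(2*q'/Q)) / (real q')\<^sup>2"
        using rdet2 q Q(1) by (simp add: field_simps power2_eq_square)
      have "1/Q + p - (0 - (-(2*q'/Q))/2) / q' = of_int p"
        using q Q(1) by (simp add: field_simps)
      then show "1/Q + p - (0 - (-(2*q'/Q))/2) / q' \<in> \<int>" by (metis Ints_of_int)
      show "\<bar>-(2*q'/Q)\<bar> / 2 + \<bar>0\<bar> < (1::real)"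
        using Q q by (simp add: field_simps)
    qed
    finally show ?thesis .
  qed
  finally show ?thesis
    unfolding hq exp_double by (simp only: power2_eq_square mult_ac)
qed

lemma ln_exp_mult_exp: "c > 0 \<Longrightarrow> ln (exp x * c * exp y) = x + ln c + (y :: real)"
  by (simp add: ln_mult)

text \<open>Both identities are solved for the blocks at \<open>p/q\<close>: the separating sines
  are bounded by their arguments, the block at \<open>p'/q'\<close> by its slope. The slope is taken
  for \<open>- p'\<close> because that block has negative \<open>C\<close>.\<close>

lemma block_log_sum_lower:
  fixes p p' :: int and q q' j :: nat
  assumes det: "p' * int q - p * int q' = 1" and q: "0 < q'" "q' \<le> q" and j: "j > 0"
    and U: "slope_le q' (- p') U"
  defines "Q \<equiv> real j * q + q'"
  shows "(\<Sum>b<j. block_log q p (q/Q) ((q/Q) * (b + 1/2)))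
     \<ge> (j + 1) * ln Q - (\<Sum>i=1..j. ln (2 * pi * real i)) - ln q' - U * (j * q' / Q)"
    and "2 * block_log q p (q / (2 * q + q')) (q / (2 * q + q') / 2)
     \<ge> 3 * ln (2 * q + q') - 2 * ln (2 * pi) - ln q' - U * (2 * q' / (2 * q + q'))"
proof -
  have qpos: "q > 0" using q by simp
  have cop: "coprime p' (int q')"
    using bezout_coprime[of "int q" p' "- p" "int q'"] det by (simp_all add: algebra_simps)
  have slope: "block_log q' p' (- c) y \<le> ln q' + U * c"
    if "0 \<le> c" "c < 1" "\<bar>y\<bar> \<le> c / 2" for c y
  proof -
    have "block_log q' p' (- c) y \<le> block_log q' p' (- c) 0"
      using that by (intro block_log_antimono_abs[OF cop q(1)]) auto
    also have "\<dots> = block_log q' (- p') c 0" using block_log_reflect[OF cop q(1), of c 0] by simp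
    also have "\<dots> \<le> ln q' + U * c" using U that by (simp add: slope_le_def)
    finally show ?thesis .
  qed
  have Qnat: "real (j * q + q') = Q" by (simp add: Q_def)
  have Qpos: "Q > 0" using q qpos by (simp add: Q_def add_nonneg_pos)
  have jq: "real j * q' < Q"
  proof -
    have "real j * q' \<le> real j * q" using q by (intro mult_left_mono) auto
    then show ?thesis using q by (simp add: Q_def)
  qed
  define S where "S = (\<Sum>b<j. block_log q p (q/Q) ((q/Q) * (b + 1/2)))"
  define B where "B = block_log q' p' (-(j*q'/Q)) ((q'/Q) * (j/2))"
  define R where "R = (\<Prod>b=1..j. 2 * \<bar>sin (pi * (b / Q))\<bar>)"
  have cop2: "coprime (int j * p + p') (int (j * q + q'))"
    using bezout_coprime[of "int q" "int j * p + p'" "- p" "int (j * q + q')"] det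
    by (simp add: algebra_simps)
  have e: "exp S * R * exp B = Q"
    using block_identity[OF det qpos q j, of 0] prod_sin_rational(1)[OF cop2] q
    by (simp add: S_def B_def R_def Q_def exp_sum)
  have Rpos: "R > 0"
  proof -
    have "R \<noteq> 0" using e Qpos by auto
    moreover have "R \<ge> 0" unfolding R_def by (intro prod_nonneg) auto
    ultimately show ?thesis by simp
  qed
  have "R \<le> (\<Prod>b=1..j. 2 * pi * b / Q)"
    unfolding R_def
  proof (rule prod_mono)
    fix b assume b: "b \<in> {1..j}"
    have "\<bar>sin (pi * (b / Q))\<bar> \<le> \<bar>pi * (b / Q)\<bar>" by (rule abs_sin_x_le_abs_x)
    then show "0 \<le> 2 * \<bar>sin (pi * (b / Q))\<bar> \<and> 2 * \<bar>sin (pi * (b / Q))\<bar> \<le> 2 * pi * b / Q"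
      using Qpos by simp
  qed
  then have "ln R \<le> ln (\<Prod>b=1..j. 2 * pi * b / Q)"
    using Rpos by (intro ln_mono) auto
  also have "\<dots> = (\<Sum>i=1..j. ln (2 * pi * real i)) - j * ln Q"
    using Qpos by (subst ln_prod) (auto simp: ln_div sum_subtractf)
  finally have lnR: "ln R \<le> (\<Sum>i=1..j. ln (2 * pi * real i)) - j * ln Q" .
  have "S + ln R + B = ln Q"
    using ln_exp_mult_exp[OF Rpos, of S B] e by simp
  moreover have "B \<le> ln q' + U * (j*q'/Q)"
    unfolding B_def using Qpos jq by (intro slope) (auto simp: field_simps)
  ultimately show "S \<ge> (j + 1) * ln Q - (\<Sum>i=1..j. ln (2 * pi * real i)) - ln q' - U * (j * q' / Q)"
    using lnR by (simp add: algebra_simps)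
  define Q2 where "Q2 = 2 * real q + q'"
  have Q2: "Q2 > 0" "Q2 > 1" using qpos q by (auto simp: Q2_def)
  have Q2nat: "real (2 * q + q') = Q2" by (simp add: Q2_def)
  define s where "s = 2 * \<bar>sin (pi * (1/Q2))\<bar>"
  have "exp (2 * block_log q p (q/Q2) (q/Q2/2)) * s\<^sup>2 * exp (block_log q' p' (-(2*q'/Q2)) 0) = Q2"
    using block_identity_centred[OF det q] by (simp add: Q2_def s_def)
  moreover from this have "s \<noteq> 0" using Q2 by auto
  ultimately have "2 * block_log q p (q/Q2) (q/Q2/2) + ln (s\<^sup>2) + block_log q' p' (-(2*q'/Q2)) 0 = ln Q2"
    using ln_exp_mult_exp[of "s\<^sup>2" "2 * block_log q p (q/Q2) (q/Q2/2)" "block_log q' p' (-(2*q'/Q2)) 0"]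
    by simp
  moreover have "ln (s\<^sup>2) = 2 * ln s"
  proof -
    have "s > 0" using \<open>s \<noteq> 0\<close> by (simp add: s_def)
    then show ?thesis by (simp add: ln_realpow)
  qed
  moreover have "ln s \<le> ln (2 * pi / Q2)"
  proof (rule ln_mono)
    have "\<bar>sin (pi * (1/Q2))\<bar> \<le> \<bar>pi * (1/Q2)\<bar>" by (rule abs_sin_x_le_abs_x)
    then show "s \<le> 2 * pi / Q2" using Q2 by (simp add: s_def)
    show "s > 0" using \<open>s \<noteq> 0\<close> by (simp add: s_def)
  qed
  moreover have "ln (2 * pi / Q2) = ln (2 * pi) - ln Q2" using Q2 by (intro ln_divide_pos) auto
  moreover have "block_log q' p' (-(2*q'/Q2)) 0 \<le> ln q' + U * (2*q'/Q2)"
    using Q2 q by (intro slope) (auto simp: Q2_def field_simps)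
  ultimately show "2 * block_log q p (q / (2 * q + q')) (q / (2 * q + q') / 2)
     \<ge> 3 * ln (2 * q + q') - 2 * ln (2 * pi) - ln q' - U * (2 * q' / (2 * q + q'))"
    unfolding Q2nat Q2_def[symmetric] by (simp add: Q2nat)
qed

section \<open>Convergents\<close>

text \<open>Numerators and denominators of the convergents of \<open>[0; a 1, a 2, \<dots>]\<close>, shifted by one:
  index \<open>Suc n\<close> belongs to the \<open>n\<close>-th convergent.\<close>

fun cnum :: "(nat \<Rightarrow> nat) \<Rightarrow> nat \<Rightarrow> nat" where
  "cnum a 0 = 1"
| "cnum a (Suc 0) = 0"
| "cnum a (Suc (Suc n)) = a (Suc n) * cnum a (Suc n) + cnum a n"

fun cden :: "(nat \<Rightarrow> nat) \<Rightarrow> nat \<Rightarrow> nat" where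
  "cden a 0 = 0"
| "cden a (Suc 0) = 1"
| "cden a (Suc (Suc n)) = a (Suc n) * cden a (Suc n) + cden a n"

lemma cfrac_value_append:
  "zs \<noteq> [] \<Longrightarrow> cfrac_value (ys @ zs) = cfrac_value (ys @ [cfrac_value zs])"
proof (induction ys)
  case (Cons y ys)
  then show ?case by (cases ys; cases zs) auto
qed simp

lemma cfrac_value_pos: "zs \<noteq> [] \<Longrightarrow> (\<And>z. z \<in> set zs \<Longrightarrow> z > 0) \<Longrightarrow> cfrac_value zs > 0"
  by (induction zs rule: cfrac_value.induct) (auto intro!: add_pos_pos)

lemma cden_pos: "(\<And>i. i \<ge> 1 \<Longrightarrow> a i \<ge> 1) \<Longrightarrow> cden a (Suc n) > 0"
proof (induction n)
  case (Suc n)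
  have "a (Suc n) \<ge> 1" using Suc.prems[of "Suc n"] by simp
  moreover have "cden a (Suc n) > 0" using Suc.IH Suc.prems by blast
  ultimately show ?case by simp
qed simp

lemma cfrac_value_convergent:
  assumes "\<And>i. i \<ge> 1 \<Longrightarrow> a i \<ge> 1" "x > 0"
  shows "cfrac_value (0 # map (\<lambda>i. real (a i)) [1..<Suc n] @ [x])
    = (x * cnum a (Suc n) + cnum a n) / (x * cden a (Suc n) + cden a n)"
  using assms(2)
proof (induction n arbitrary: x)
  case (Suc n)
  let ?y = "real (a (Suc n)) + 1 / x"
  have y: "?y > 0" using Suc.prems by (simp add: add_nonneg_pos)
  have "cfrac_value ((0 # map (\<lambda>i. real (a i)) [1..<Suc n]) @ [real (a (Suc n)), x])
    = cfrac_value ((0 # map (\<lambda>i. real (a i)) [1..<Suc n]) @ [?y])"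
    by (subst cfrac_value_append) auto
  also have "\<dots> = (?y * cnum a (Suc n) + cnum a n) / (?y * cden a (Suc n) + cden a n)"
    using Suc.IH[OF y] by simp
  also have "\<dots> = (x * (?y * cnum a (Suc n) + cnum a n)) / (x * (?y * cden a (Suc n) + cden a n))"
    using Suc.prems by simp
  also have "x * (?y * cnum a (Suc n) + cnum a n) = x * cnum a (Suc (Suc n)) + cnum a (Suc n)"
    using Suc.prems by (simp add: field_simps)
  also have "x * (?y * cden a (Suc n) + cden a n) = x * cden a (Suc (Suc n)) + cden a (Suc n)"
    using Suc.prems by (simp add: field_simps)
  finally show ?case by simp
qed simp

lemma convergent_det:
  "int (cnum a (Suc n)) * int (cden a n) - int (cnum a n) * int (cden a (Suc n)) = - ((-1) ^ n)"
  by (induction n) (auto simp: algebra_simps)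

locale sudler_cfrac =
  fixes \<alpha> :: real and a :: "nat \<Rightarrow> nat"
  assumes irrational: "\<alpha> \<notin> \<rat>" and expansion: "has_cfrac_expansion \<alpha> 0 a"
begin

abbreviation p :: "nat \<Rightarrow> nat" where "p k \<equiv> cnum a (Suc k)"
abbreviation q :: "nat \<Rightarrow> nat" where "q k \<equiv> cden a (Suc k)"

text \<open>The distance between \<open>q k * \<alpha>\<close> and \<open>p k\<close>; the sign
  makes it positive at every level.\<close>

definition \<delta> :: "nat \<Rightarrow> real" where "\<delta> k = (-1) ^ k * (q k * \<alpha> - p k)"

text \<open>Numerators for approximating \<open>(-1) ^ k * \<alpha>\<close>, which then lies above
  \<open>sp k / q k\<close> for every \<open>k\<close>; all levels get positive \<open>C k\<close>
  and can be treated alike.\<close>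

definition sp :: "nat \<Rightarrow> int" where "sp k = (-1) ^ k * int (p k)"

lemma a_pos: "i \<ge> 1 \<Longrightarrow> a i \<ge> 1"
  using expansion by (simp add: has_cfrac_expansion_def)

lemma q_pos: "q k > 0" by (rule cden_pos[OF a_pos])

lemma q_rec: "q (Suc (Suc k)) = a (Suc (Suc k)) * q (Suc k) + q k"
  by (rule cden.simps)

lemma p_rec: "p (Suc (Suc k)) = a (Suc (Suc k)) * p (Suc k) + p k"
  by (rule cnum.simps)

lemma det: "int (p (Suc k)) * int (q k) - int (p k) * int (q (Suc k)) = (-1) ^ k"
  using convergent_det[of a "Suc k"] by (simp del: cnum.simps cden.simps)

declare cnum.simps(3) [simp del] cden.simps(3) [simp del]

lemma q_mono_Suc: "q k \<le> q (Suc k)"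
proof (cases k)
  case 0
  have "a 1 \<ge> 1" using a_pos by simp
  then show ?thesis using 0 by (simp add: cden.simps(3))
next
  case (Suc m)
  have "a (Suc k) \<ge> 1" using a_pos by simp
  then have "1 * q k \<le> a (Suc k) * q k" by (rule mult_le_mono1)
  then show ?thesis unfolding Suc q_rec by (simp only: mult_1 trans_le_add1)
qed

text \<open>For a finite continued fraction reaching beyond \<open>k\<close> the signed difference
  equals \<open>1 / (y * q k + cden a k)\<close> by the determinant, \<open>y\<close> being the
  value of the tail. Its sign survives in the limit.\<close>

lemma \<delta>_nonneg: "\<delta> k \<ge> 0"
proof -
  let ?c = "\<lambda>m. cfrac_value (0 # map (\<lambda>i. real (a i)) [1..<Suc m])"
  have lim: "?c \<longlonglongrightarrow> \<alpha>" using expansion by (simp add: has_cfrac_expansion_def)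
  have "(-1) ^ k * (q k * ?c m - p k) \<ge> 0" if "m > k" for m
  proof -
    let ?zs = "map (\<lambda>i. real (a i)) [Suc k..<Suc m]"
    let ?y = "cfrac_value ?zs"
    have ne: "?zs \<noteq> []" using that by simp
    have y: "?y > 0"
    proof (rule cfrac_value_pos[OF ne])
      fix z assume "z \<in> set ?zs"
      then obtain i where "i \<ge> Suc k" "z = real (a i)" by auto
      then show "z > 0" using a_pos[of i] by simp
    qed
    have "[1..<Suc m] = [1..<Suc k] @ [Suc k..<Suc m]"
      using upt_add_eq_append[of 1 "Suc k" "m - k"] that by simp
    then have "?c m = cfrac_value ((0 # map (\<lambda>i. real (a i)) [1..<Suc k]) @ ?zs)" by simp
    also have "\<dots> = cfrac_value ((0 # map (\<lambda>i. real (a i)) [1..<Suc k]) @ [?y])"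
      by (rule cfrac_value_append[OF ne])
    also have "\<dots> = (?y * p k + cnum a k) / (?y * q k + cden a k)"
      using cfrac_value_convergent[of a ?y k, OF a_pos y] by simp
    finally have c: "?c m = (?y * p k + cnum a k) / (?y * q k + cden a k)" .
    have pos: "?y * q k + cden a k > 0" using y q_pos[of k] by (intro add_pos_nonneg) auto
    have dr: "real (p k) * cden a k - real (cnum a k) * q k = - ((-1) ^ k)"
      using arg_cong[OF convergent_det[of a k], of real_of_int] by simp
    have "q k * ?c m - p k = (real (q k) * cnum a k - real (p k) * cden a k) / (?y * q k + cden a k)"
      unfolding c using pos by (simp add: field_simps)
    also have "real (q k) * cnum a k - real (p k) * cden a k = (-1) ^ k"
      using dr by (simp add: algebra_simps)
    finally have "(-1) ^ k * (q k * ?c m - p k) = 1 / (?y * q k + cden a k)"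
      by (simp add: power_mult_distrib[symmetric])
    then show ?thesis using pos by simp
  qed
  then have ev: "eventually (\<lambda>m. (-1) ^ k * (q k * ?c m - p k) \<ge> 0) sequentially"
    unfolding eventually_sequentially by (meson Suc_le_eq)
  have "(\<lambda>m. (-1) ^ k * (q k * ?c m - p k)) \<longlonglongrightarrow> (-1) ^ k * (q k * \<alpha> - p k)"
    using lim by (intro tendsto_intros)
  then show ?thesis unfolding \<delta>_def using ev by (rule tendsto_lowerbound) simp
qed

lemma \<delta>_pos: "\<delta> k > 0"
proof -
  have "\<delta> k \<noteq> 0"
  proof
    assume "\<delta> k = 0"
    then have "\<alpha> = real (p k) / real (q k)" using q_pos[of k] by (simp add: \<delta>_def field_simps)
    then show False using irrational by simp
  qed
  then show ?thesis using \<delta>_nonneg[of k] by simp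
qed

lemma \<delta>_rec: "\<delta> k = a (Suc (Suc k)) * \<delta> (Suc k) + \<delta> (Suc (Suc k))"
  by (simp add: \<delta>_def q_rec p_rec algebra_simps)

lemma q_\<delta>: "q (Suc k) * \<delta> k + q k * \<delta> (Suc k) = 1"
proof -
  have "q (Suc k) * \<delta> k + q k * \<delta> (Suc k)
    = (-1) ^ k * (real (p (Suc k)) * q k - real (p k) * q (Suc k))"
    by (simp add: \<delta>_def algebra_simps)
  also have "real (p (Suc k)) * q k - real (p k) * q (Suc k) = (-1) ^ k"
    using arg_cong[OF det[of k], of real_of_int] by simp
  finally show ?thesis by (simp add: power_mult_distrib[symmetric])
qed

lemma \<delta>_less: "\<delta> (Suc k) < \<delta> k"
proof -
  have "real (a (Suc (Suc k))) \<ge> 1" using a_pos[of "Suc (Suc k)"] by simp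
  then have "a (Suc (Suc k)) * \<delta> (Suc k) \<ge> 1 * \<delta> (Suc k)"
    using \<delta>_pos[of "Suc k"] by (intro mult_right_mono) auto
  then show ?thesis using \<delta>_rec[of k] \<delta>_pos[of "Suc (Suc k)"] by simp
qed

text \<open>For \<open>k \<ge> 1\<close>, \<open>\<theta> k = [0; a k, ..., a 1]\<close> records the
  past of the expansion and \<open>\<xi> k = [0; a (k + 1), a (k + 2), ...]\<close> its future. At
  \<open>k = 0\<close> truncated subtraction makes both equal to 1.\<close>

definition \<theta> :: "nat \<Rightarrow> real" where "\<theta> k = q (k - 1) / q k"
definition \<xi> :: "nat \<Rightarrow> real" where "\<xi> k = \<delta> k / \<delta> (k - 1)"
definition C :: "nat \<Rightarrow> real" where "C k = q k * \<delta> k"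

lemma \<theta>_pos: "\<theta> k > 0" and \<theta>_le_1: "\<theta> k \<le> 1"
  using q_pos[of k] q_pos[of "k - 1"] q_mono_Suc[of "k - 1"]
  by (cases k; simp add: \<theta>_def)+

lemma \<xi>_pos: "\<xi> k > 0"
  using \<delta>_pos by (simp add: \<xi>_def)

lemma \<xi>_less_1: "k \<ge> 1 \<Longrightarrow> \<xi> k < 1"
  using \<delta>_pos[of "k - 1"] \<delta>_less[of "k - 1"] by (simp add: \<xi>_def)

lemma \<theta>_eq: "\<theta> (Suc (Suc k)) = 1 / (a (Suc (Suc k)) + \<theta> (Suc k))"
  using q_pos[of "Suc k"] q_pos[of "Suc (Suc k)"] by (simp add: \<theta>_def q_rec field_simps)

lemma \<xi>_eq: "\<xi> (Suc k) = 1 / (a (Suc (Suc k)) + \<xi> (Suc (Suc k)))"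
  using \<delta>_pos[of k] \<delta>_pos[of "Suc k"] \<delta>_rec[of k] by (simp add: \<xi>_def field_simps)

lemma C_eq: "C (Suc k) = 1 / (a (Suc (Suc k)) + \<theta> (Suc k) + \<xi> (Suc (Suc k)))"
proof -
  have "q (Suc (Suc k)) * \<delta> (Suc k) + q (Suc k) * \<delta> (Suc (Suc k)) = 1" by (rule q_\<delta>)
  moreover have "real (q (Suc k)) > 0" "\<delta> (Suc k) > 0" using q_pos \<delta>_pos by auto
  ultimately show ?thesis
    by (simp add: C_def \<theta>_def \<xi>_def q_rec field_simps)
qed

lemma C_pos: "C k > 0" using q_pos[of k] \<delta>_pos[of k] by (simp add: C_def)

lemma det_sp: "sp k * int (q (Suc k)) + sp (Suc k) * int (q k) = - 1"
proof -
  have "sp k * int (q (Suc k)) + sp (Suc k) * int (q k)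
    = - ((-1) ^ k * (int (p (Suc k)) * int (q k) - int (p k) * int (q (Suc k))))"
    by (simp add: sp_def algebra_simps)
  then show ?thesis unfolding det by (simp add: power_mult_distrib[symmetric])
qed

lemma coprime_sp: "coprime (sp k) (int (q k))"
  using bezout_coprime[of "- int (q (Suc k))" "sp k" "- sp (Suc k)" "int (q k)"] det_sp[of k]
  by (simp add: algebra_simps)

lemma signed_\<alpha>: "(-1) ^ k * \<alpha> = sp k / q k + C k / (real (q k))\<^sup>2"
proof -
  have "(-1) ^ k * (q k * \<alpha>) = sp k + \<delta> k" by (simp add: \<delta>_def sp_def algebra_simps)
  then show ?thesis using q_pos[of k] by (simp add: C_def field_simps power2_eq_square)
qed

end

section \<open>Blocks along the convergents\<close>

lemma concave_sin: "concave_on {0..pi} sin"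
proof (rule f''_le0_imp_concave)
  fix x :: real assume "x \<in> {0..pi}"
  show "(sin has_real_derivative cos x) (at x)" by (rule DERIV_sin)
  show "(cos has_real_derivative - sin x) (at x)" by (rule DERIV_cos)
  show "- sin x \<le> 0" using \<open>x \<in> {0..pi}\<close> sin_ge_zero[of x] by auto
qed auto

lemma sin_scale_ge:
  assumes "0 \<le> s" "s \<le> 1" "0 \<le> x" "x \<le> pi"
  shows "sin (s * x) \<ge> s * sin x"
  using concave_onD[OF concave_sin, of s 0 x] assms by simp

definition lsinc :: "real \<Rightarrow> real" where
  "lsinc y = (if y = 0 then 0 else ln (sin (pi * \<bar>y\<bar>) / (pi * \<bar>y\<bar>)))"

text \<open>The exponent that the block identity contributes for a group of \<open>j\<close> blocks.\<close>

definition block_rate :: "nat \<Rightarrow> real \<Rightarrow> real \<Rightarrow> real" where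
  "block_rate j x U = (j + x) * ((j + 1) * ln (j + x) - ln x - (\<Sum>i=1..j. ln (2 * pi * real i))) - j * x * U"

context sudler_cfrac begin

lemma C_less: "k \<ge> 1 \<Longrightarrow> (a (Suc k) + \<xi> (Suc k)) * C k < 1"
proof -
  assume "k \<ge> 1"
  then have "(a (Suc k) + \<theta> k + \<xi> (Suc k)) * C k = 1"
    using C_eq[of "k - 1"] C_pos[of k] by (simp add: field_simps)
  then show ?thesis using mult_pos_pos[OF \<theta>_pos[of k] C_pos[of k]] by (simp add: algebra_simps)
qed

lemma C_less_1: "k \<ge> 1 \<Longrightarrow> C k < 1"
proof -
  assume k: "k \<ge> 1"
  have "1 \<le> real (a (Suc k)) + \<xi> (Suc k)"
    using a_pos[of "Suc k"] \<xi>_pos[of "Suc k"] by (simp add: add_increasing2)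
  then have "1 * C k \<le> (a (Suc k) + \<xi> (Suc k)) * C k"
    using C_pos[of k] by (intro mult_right_mono) auto
  then show ?thesis using C_less[OF k] by simp
qed

lemma level_admissible:
  assumes "k \<ge> 1" "0 \<le> s" "s * C k < 1"
  shows "admissible (C k) (C k * (s - 1/2))"
proof -
  have "C k * (\<bar>s - 1/2\<bar> + 1/2) < 1"
    using assms C_less_1[of k] mult_nonneg_nonneg[OF assms(2) less_imp_le[OF C_pos[of k]]]
    by (cases "s \<ge> 1/2") (auto simp: mult.commute abs_if algebra_simps)
  then show ?thesis using C_pos[of k] by (intro admissible_scaled[where v = "1/2"]) auto
qed

text \<open>The product over a block of \<open>q k\<close> consecutive indices; \<open>s - 1\<close> is the shift in units of
  \<open>\<delta> k\<close>.\<close>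

definition block :: "nat \<Rightarrow> real \<Rightarrow> real" where
  "block k s = 2 * sin (pi * (s * \<delta> k)) * exp (block_log (q k) (sp k) (C k) (C k * (s - 1/2)))"

lemma s\<delta>_less: "s * C k < 1 \<Longrightarrow> 0 \<le> s \<Longrightarrow> s * \<delta> k < 1"
proof -
  assume "s * C k < 1" "0 \<le> s"
  moreover have "s * \<delta> k * 1 \<le> s * \<delta> k * q k"
    using \<open>0 \<le> s\<close> \<delta>_pos[of k] q_pos[of k] by (intro mult_left_mono) auto
  ultimately show ?thesis by (simp add: C_def mult_ac)
qed

lemma block_pos:
  assumes "0 < s" "s * C k < 1"
  shows "block k s > 0"
  unfolding block_def using assms \<delta>_pos[of k] s\<delta>_less[of s k]
  by (intro mult_pos_pos sin_pi_mult_pos) auto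

lemma abs_sin_signed:
  "\<bar>sin (pi * (r * \<alpha> + \<sigma>))\<bar> = \<bar>sin (pi * (r * ((-1) ^ k * \<alpha>) + (-1) ^ k * \<sigma>))\<bar>"
proof (cases "even k")
  case False
  then have "pi * (r * ((-1) ^ k * \<alpha>) + (-1) ^ k * \<sigma>) = - (pi * (r * \<alpha> + \<sigma>))"
    by (simp add: algebra_simps)
  then show ?thesis by (simp only: sin_minus abs_minus_cancel)
qed simp

lemma prod_block_lower:
  assumes k: "k \<ge> 1" and s: "0 \<le> s" "s * C k < 1"
    and \<sigma>: "(-1) ^ k * \<sigma> - \<delta> k * (s - 1) \<in> \<int>"
  shows "(\<Prod>r=1..<q k. 2 * \<bar>sin (pi * (real r * \<alpha> + \<sigma>))\<bar>)
    = exp (block_log (q k) (sp k) (C k) (C k * (s - 1/2)))"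
proof -
  have "(\<Prod>r=1..<q k. 2 * \<bar>sin (pi * (real r * \<alpha> + \<sigma>))\<bar>)
    = (\<Prod>r=1..<q k. 2 * \<bar>sin (pi * (real r * ((-1) ^ k * \<alpha>) + (-1) ^ k * \<sigma>))\<bar>)"
    by (simp only: abs_sin_signed[of _ \<sigma> k])
  also have "\<dots> = exp (block_log (q k) (sp k) (C k) (C k * (s - 1/2)))"
  proof (rule exp_block_log[OF coprime_sp q_pos level_admissible[OF k s] signed_\<alpha>])
    have "(C k * (s - 1/2) - C k / 2) / q k = \<delta> k * (s - 1)"
      using q_pos[of k] by (simp add: C_def field_simps)
    then show "(-1) ^ k * \<sigma> - (C k * (s - 1/2) - C k / 2) / q k \<in> \<int>" using \<sigma> by simp
  qed
  finally show ?thesis .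
qed

lemma prod_block:
  assumes k: "k \<ge> 1" and s: "0 < s" "s * C k < 1"
    and \<sigma>: "(-1) ^ k * \<sigma> - \<delta> k * (s - 1) \<in> \<int>"
  shows "(\<Prod>r=1..q k. 2 * \<bar>sin (pi * (real r * \<alpha> + \<sigma>))\<bar>) = block k s"
proof -
  have "{1..q k} = insert (q k) {1..<q k}" using q_pos[of k] by auto
  then have "(\<Prod>r=1..q k. 2 * \<bar>sin (pi * (real r * \<alpha> + \<sigma>))\<bar>)
    = 2 * \<bar>sin (pi * (real (q k) * \<alpha> + \<sigma>))\<bar> * exp (block_log (q k) (sp k) (C k) (C k * (s - 1/2)))"
    using prod_block_lower[OF k _ s(2) \<sigma>] s by simp
  also have "\<bar>sin (pi * (real (q k) * \<alpha> + \<sigma>))\<bar> = \<bar>sin (pi * (s * \<delta> k))\<bar>"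
  proof -
    obtain n where n: "(-1) ^ k * \<sigma> = \<delta> k * (s - 1) + of_int n"
      using \<sigma> by (metis Ints_cases add.commute diff_eq_eq)
    have "q k * ((-1) ^ k * \<alpha>) = \<delta> k + sp k" by (simp add: \<delta>_def sp_def algebra_simps)
    then have "q k * ((-1) ^ k * \<alpha>) + (-1) ^ k * \<sigma> - s * \<delta> k = of_int (sp k + n)"
      unfolding n by (simp add: algebra_simps)
    then have "q k * ((-1) ^ k * \<alpha>) + (-1) ^ k * \<sigma> - s * \<delta> k \<in> \<int>" by (metis Ints_of_int)
    then show ?thesis unfolding abs_sin_signed[of _ \<sigma> k] by (rule abs_sin_pi_cong)
  qed
  also have "\<bar>sin (pi * (s * \<delta> k))\<bar> = sin (pi * (s * \<delta> k))"
    using s \<delta>_pos[of k] s\<delta>_less[of s k] by (intro abs_of_pos sin_pi_mult_pos) auto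
  finally show ?thesis by (simp add: block_def)
qed

lemma ln_block:
  assumes "0 < s" "s * C k < 1"
  shows "ln (block k s) = ln (2 * sin (pi * (s * \<delta> k))) + block_log (q k) (sp k) (C k) (C k * (s - 1/2))"
proof -
  have "sin (pi * (s * \<delta> k)) > 0"
    using assms \<delta>_pos[of k] s\<delta>_less[of s k] by (intro sin_pi_mult_pos) auto
  then show ?thesis by (simp add: block_def ln_mult)
qed

lemma ln_block_concave:
  assumes k: "k \<ge> 1" and s: "0 < s" "s * C k < 1" and s': "0 < s'" "s' * C k < 1"
    and l: "0 \<le> l" "l \<le> 1"
  shows "ln (block k (l * s + (1 - l) * s')) \<ge> l * ln (block k s) + (1 - l) * ln (block k s')"
proof -
  let ?m = "l * s + (1 - l) * s'"
  have m: "0 < ?m"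
    using s s' l by (cases "l = 0") (auto intro!: add_pos_nonneg mult_nonneg_nonneg)
  have mC: "?m * C k < 1"
  proof -
    have "?m * C k \<le> max (s * C k) (s' * C k)"
    proof -
      have "?m * C k = l * (s * C k) + (1 - l) * (s' * C k)" by (simp add: algebra_simps)
      also have "\<dots> \<le> l * max (s * C k) (s' * C k) + (1 - l) * max (s * C k) (s' * C k)"
        using l by (intro add_mono mult_left_mono) auto
      finally show ?thesis by (simp add: algebra_simps)
    qed
    then show ?thesis using s s' by simp
  qed
  have 1: "ln (2 * sin (pi * (?m * \<delta> k)))
    \<ge> l * ln (2 * sin (pi * (s * \<delta> k))) + (1 - l) * ln (2 * sin (pi * (s' * \<delta> k)))"
  proof -
    have "?m * \<delta> k = l * (s * \<delta> k) + (1 - l) * (s' * \<delta> k)" by (simp add: algebra_simps)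
    then show ?thesis
      using s s' \<delta>_pos[of k] s\<delta>_less[of s k] s\<delta>_less[of s' k] l
      by (simp only:) (intro concave_ln_sin_ineq; auto)
  qed
  have 2: "block_log (q k) (sp k) (C k) (C k * (?m - 1/2))
    \<ge> l * block_log (q k) (sp k) (C k) (C k * (s - 1/2)) + (1 - l) * block_log (q k) (sp k) (C k) (C k * (s' - 1/2))"
  proof -
    have "l * C k + (1 - l) * C k = C k" by (simp add: algebra_simps)
    moreover have "l * (C k * (s - 1/2)) + (1 - l) * (C k * (s' - 1/2)) = C k * (?m - 1/2)"
      by (simp add: field_simps)
    moreover have "block_log (q k) (sp k) (l * C k + (1 - l) * C k) (l * (C k * (s - 1/2)) + (1 - l) * (C k * (s' - 1/2)))
      \<ge> l * block_log (q k) (sp k) (C k) (C k * (s - 1/2)) + (1 - l) * block_log (q k) (sp k) (C k) (C k * (s' - 1/2))"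
      using k s s' l by (intro block_log_concave coprime_sp q_pos level_admissible) auto
    ultimately show ?thesis by simp
  qed
  show ?thesis
    unfolding ln_block[OF s] ln_block[OF s'] ln_block[OF m mC] distrib_left using 1 2 by linarith
qed

text \<open>The hypothesis \<open>1 \<le> s + s'\<close> says that \<open>s - 1/2\<close> is no farther from the centre of symmetry
  than \<open>s' - 1/2\<close>.\<close>

lemma block_scale:
  assumes k: "k \<ge> 1" and s: "0 < s" "s \<le> s'" "1 \<le> s + s'" "s' * C k < 1"
  shows "block k s \<ge> s / s' * block k s'"
proof -
  have sC: "s * C k < 1"
  proof -
    have "s * C k \<le> s' * C k" using s C_pos[of k] by (intro mult_right_mono) auto
    then show ?thesis using s by linarith
  qed
  have "sin (pi * (s * \<delta> k)) \<ge> s / s' * sin (pi * (s' * \<delta> k))"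
  proof -
    have "sin (s / s' * (pi * (s' * \<delta> k))) \<ge> s / s' * sin (pi * (s' * \<delta> k))"
      using s \<delta>_pos[of k] s\<delta>_less[of s' k] by (intro sin_scale_ge) auto
    moreover have "s / s' * (pi * (s' * \<delta> k)) = pi * (s * \<delta> k)" using s by simp
    ultimately show ?thesis by simp
  qed
  moreover have "block_log (q k) (sp k) (C k) (C k * (s' - 1/2)) \<le> block_log (q k) (sp k) (C k) (C k * (s - 1/2))"
  proof (rule block_log_antimono_abs[OF coprime_sp q_pos])
    show "admissible (C k) (C k * (s' - 1/2))" using k s by (intro level_admissible) auto
    have "\<bar>s - 1/2\<bar> \<le> \<bar>s' - 1/2\<bar>" using s by (auto simp: abs_if)
    then show "\<bar>C k * (s - 1/2)\<bar> \<le> \<bar>C k * (s' - 1/2)\<bar>"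
      using C_pos[of k] by (simp add: abs_mult)
  qed
  moreover have "sin (pi * (s' * \<delta> k)) \<ge> 0" "sin (pi * (s * \<delta> k)) \<ge> 0"
    using s sC \<delta>_pos[of k] s\<delta>_less[of s' k] s\<delta>_less[of s k]
    by (intro less_imp_le[OF sin_pi_mult_pos]; auto)+
  ultimately have "2 * (s / s' * sin (pi * (s' * \<delta> k))) * exp (block_log (q k) (sp k) (C k) (C k * (s' - 1/2)))
     \<le> 2 * sin (pi * (s * \<delta> k)) * exp (block_log (q k) (sp k) (C k) (C k * (s - 1/2)))"
    using s by (intro mult_mono) auto
  then show ?thesis by (simp add: block_def mult_ac)
qed

lemma level_det:
  assumes "k \<ge> 1"
  shows "(- sp (k - 1)) * int (q k) - sp k * int (q (k - 1)) = 1"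
  using det_sp[of "k - 1"] assms by (simp add: algebra_simps)

text \<open>With \<open>A = a (Suc k) - j + \<xi> (Suc k)\<close> one has
  \<open>C k = 1 / (j + \<theta> k + A)\<close>. Hence the point
  \<open>(C k, C k * (i + t - 1/2))\<close> lies on the segment from
  \<open>(D, D * (i - 1/2))\<close>, a block in the identity for the mediant of denominator
  \<open>j * q k + q (k - 1)\<close>, to \<open>(0, t / A)\<close>, where the block is a quotient of
  two sines. The whole shift is charged to the second end.\<close>

lemma group_lower:
  fixes j k :: nat and t U :: real
  assumes k: "k \<ge> 1" and j: "1 \<le> j" "j \<le> a (Suc k)" and U: "slope_le (q (k - 1)) (sp (k - 1)) U"
    and t: "0 \<le> t" "t < real (a (Suc k)) - real j + \<xi> (Suc k)"
  shows "(\<Sum>i=1..j. ln (block k (i + t)))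
    \<ge> (\<Sum>i=1..j. ln (2 * q k * sin (pi * ((i + t) * \<delta> k)))) + C k * block_rate j (\<theta> k) U
       + j * (C k * (real (a (Suc k)) - real j + \<xi> (Suc k))) * lsinc (t / (real (a (Suc k)) - real j + \<xi> (Suc k)))"
proof -
  let ?q = "real (q k)" and ?q' = "real (q (k - 1))" and ?A = "real (a (Suc k)) - j + \<xi> (Suc k)"
  define Q where "Q = real j * ?q + ?q'"
  define D where "D = ?q / Q"
  have qq: "?q > 0" "?q' > 0" "q (k - 1) \<le> q k"
    using q_pos[of k] q_pos[of "k - 1"] q_mono_Suc[of "k - 1"] k by auto
  have Q: "Q > 0" using qq by (simp add: Q_def add_nonneg_pos)
  have th: "?q' = ?q * \<theta> k" using qq k by (simp add: \<theta>_def)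
  have Qth: "Q = ?q * (j + \<theta> k)" unfolding Q_def th by (simp add: algebra_simps)
  have jth: "j + \<theta> k > 0" using \<theta>_pos[of k] by (simp add: add_nonneg_pos)
  have D: "D = 1 / (j + \<theta> k)" unfolding D_def Qth using qq by simp
  have A: "?A > 0" using j \<xi>_pos[of "Suc k"] by (simp add: add_nonneg_pos)
  have Ceq: "C k = 1 / (j + \<theta> k + ?A)"
    using C_eq[of "k - 1"] k by (simp add: algebra_simps)
  define l where "l = C k * (j + \<theta> k)"
  have l: "0 \<le> l" "l \<le> 1" "l * D = C k" "1 - l = C k * ?A"
    using jth A C_pos[of k] by (auto simp: l_def D Ceq field_simps)
  define y where "y = t / ?A"
  have y: "0 \<le> y" "y < 1" using t A by (auto simp: y_def)
  have y0: "block_log (q k) (sp k) 0 y \<ge> ln ?q + lsinc y"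
    using block_log_0_ge[OF coprime_sp q_pos, of y k] block_log_0[OF coprime_sp q_pos, of k] y
    by (cases "y = 0") (auto simp: lsinc_def)
  have iC: "(i + t) * C k < 1" if "i \<in> {1..j}" for i
  proof -
    have "real i + t < j + \<theta> k + ?A" using that t \<theta>_pos[of k] by auto
    then show ?thesis unfolding Ceq using jth A by (simp add: field_simps)
  qed
  have single: "ln (block k (i + t)) \<ge> ln (2 * ?q * sin (pi * ((i + t) * \<delta> k))) - ln ?q
      + l * block_log (q k) (sp k) D (D * (real (i - 1) + 1/2)) + (1 - l) * (ln ?q + lsinc y)"
    if i: "i \<in> {1..j}" for i
  proof -
    have s: "0 < i + t" "(i + t) * C k < 1" using i t iC by auto
    have sn: "sin (pi * ((i + t) * \<delta> k)) > 0"
      using s \<delta>_pos[of k] s\<delta>_less[of "i + t" k] by (intro sin_pi_mult_pos) auto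
    have adm: "admissible D (D * (real (i - 1) + 1/2))"
    proof -
      have "D * (\<bar>real (i - 1) + 1/2\<bar> + 1/2) \<le> D * j"
        using i jth by (intro mult_left_mono) (auto simp: D of_nat_diff)
      also have "\<dots> < 1" using jth \<theta>_pos[of k] by (simp add: D)
      finally have "D * (\<bar>real (i - 1) + 1/2\<bar> + 1/2) < 1" .
      moreover have "D > 0" using jth by (simp add: D)
      ultimately show ?thesis by (intro admissible_scaled[where v = "1/2"]) auto
    qed
    have "block_log (q k) (sp k) (l * D + (1 - l) * 0) (l * (D * (real (i - 1) + 1/2)) + (1 - l) * y)
      \<ge> l * block_log (q k) (sp k) D (D * (real (i - 1) + 1/2)) + (1 - l) * block_log (q k) (sp k) 0 y"
      using adm y l by (intro block_log_concave coprime_sp q_pos) auto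
    also have "l * (D * (real (i - 1) + 1/2)) + (1 - l) * y = C k * ((i + t) - 1/2)"
    proof -
      have "(1 - l) * y = C k * t" using l(4) A by (simp add: y_def)
      moreover have "l * (D * (real (i - 1) + 1/2)) = C k * (real (i - 1) + 1/2)"
        using l(3) by (simp add: mult.assoc[symmetric])
      ultimately show ?thesis using i by (simp add: of_nat_diff algebra_simps)
    qed
    finally have "block_log (q k) (sp k) (C k) (C k * ((i + t) - 1/2))
      \<ge> l * block_log (q k) (sp k) D (D * (real (i - 1) + 1/2)) + (1 - l) * block_log (q k) (sp k) 0 y"
      using l(3) by simp
    moreover have "(1 - l) * block_log (q k) (sp k) 0 y \<ge> (1 - l) * (ln ?q + lsinc y)"
      using l y0 by (intro mult_left_mono) auto
    moreover have "ln (2 * ?q * sin (pi * ((i + t) * \<delta> k))) = ln ?q + ln (2 * sin (pi * ((i + t) * \<delta> k)))"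
      using qq sn by (simp add: ln_mult)
    ultimately show ?thesis unfolding ln_block[OF s] by linarith
  qed
  have "(\<Sum>i=1..j. ln (block k (i + t))) \<ge> (\<Sum>i=1..j. ln (2 * ?q * sin (pi * ((i + t) * \<delta> k))) - ln ?q
      + l * block_log (q k) (sp k) D (D * (real (i - 1) + 1/2)) + (1 - l) * (ln ?q + lsinc y))"
    by (intro sum_mono single)
  also have "(\<Sum>i=1..j. ln (2 * ?q * sin (pi * ((i + t) * \<delta> k))) - ln ?q
      + l * block_log (q k) (sp k) D (D * (real (i - 1) + 1/2)) + (1 - l) * (ln ?q + lsinc y))
    = (\<Sum>i=1..j. ln (2 * ?q * sin (pi * ((i + t) * \<delta> k))))
      + l * ((\<Sum>i=1..j. block_log (q k) (sp k) D (D * (real (i - 1) + 1/2))) - j * ln ?q) + j * (1 - l) * lsinc y"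
    by (simp add: sum.distrib sum_subtractf sum_distrib_left[symmetric] algebra_simps)
  also have "(\<Sum>i=1..j. block_log (q k) (sp k) D (D * (real (i - 1) + 1/2)))
    = (\<Sum>b<j. block_log (q k) (sp k) D (D * (real b + 1/2)))"
    by (rule sum.reindex_bij_witness[of _ Suc "\<lambda>i. i - 1"]) auto
  finally have main: "(\<Sum>i=1..j. ln (block k (i + t))) \<ge> (\<Sum>i=1..j. ln (2 * ?q * sin (pi * ((i + t) * \<delta> k))))
      + l * ((\<Sum>b<j. block_log (q k) (sp k) D (D * (real b + 1/2))) - j * ln ?q) + j * (1 - l) * lsinc y" .
  have "(\<Sum>b<j. block_log (q k) (sp k) D (D * (real b + 1/2)))
    \<ge> (j + 1) * ln Q - (\<Sum>i=1..j. ln (2 * pi * real i)) - ln ?q' - U * (j * ?q' / Q)"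
    unfolding D_def Q_def using block_log_sum_lower(1)[OF level_det[OF k], of j U] qq j U by simp
  then have "l * ((\<Sum>b<j. block_log (q k) (sp k) D (D * (real b + 1/2))) - j * ln ?q)
    \<ge> l * ((j + 1) * ln Q - (\<Sum>i=1..j. ln (2 * pi * real i)) - ln ?q' - U * (j * ?q' / Q) - j * ln ?q)"
    using l by (intro mult_left_mono) auto
  also have "(j + 1) * ln Q - (\<Sum>i=1..j. ln (2 * pi * real i)) - ln ?q' - U * (j * ?q' / Q) - j * ln ?q
     = (j + 1) * ln (j + \<theta> k) - ln (\<theta> k) - (\<Sum>i=1..j. ln (2 * pi * real i)) - U * j * \<theta> k / (j + \<theta> k)"
  proof -
    have "ln Q = ln ?q + ln (j + \<theta> k)" unfolding Qth using qq jth by (intro ln_mult_pos) auto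
    moreover have "ln ?q' = ln ?q + ln (\<theta> k)" unfolding th using qq \<theta>_pos[of k] by (intro ln_mult_pos) auto
    moreover have "?q' / Q = \<theta> k / (j + \<theta> k)" unfolding Qth th using qq by simp
    then have "U * (j * ?q' / Q) = U * j * \<theta> k / (j + \<theta> k)" by (metis times_divide_eq_right mult.assoc)
    ultimately show ?thesis by (simp add: algebra_simps)
  qed
  also have "l * ((j + 1) * ln (j + \<theta> k) - ln (\<theta> k) - (\<Sum>i=1..j. ln (2 * pi * real i)) - U * j * \<theta> k / (j + \<theta> k))
     = C k * block_rate j (\<theta> k) U"
    using jth by (simp add: l_def block_rate_def field_simps)
  finally show ?thesis
    using main unfolding l(4) y_def by simp
qed

text \<open>For the first block alone the centred identity is sharper than an average over two
  blocks; \<open>(C k, C k / 2)\<close> lies on the segment from the origin to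
  \<open>(D, D / 2)\<close>.\<close>

lemma block_1_lower:
  fixes k :: nat and U :: real
  assumes k: "k \<ge> 1" and a2: "2 \<le> a (Suc k)" and U: "slope_le (q (k - 1)) (sp (k - 1)) U"
  shows "ln (block k 1) \<ge> ln (2 * q k * sin (pi * \<delta> k))
    + C k / 2 * ((2 + \<theta> k) * (3 * ln (2 + \<theta> k) - ln (\<theta> k) - 2 * ln (2 * pi)) - 2 * \<theta> k * U)"
proof -
  let ?q = "real (q k)" and ?q' = "real (q (k - 1))"
  define Q where "Q = 2 * ?q + ?q'"
  define D where "D = ?q / Q"
  have qq: "?q > 0" "?q' > 0" "q (k - 1) \<le> q k"
    using q_pos[of k] q_pos[of "k - 1"] q_mono_Suc[of "k - 1"] k by auto
  have th: "?q' = ?q * \<theta> k" using qq k by (simp add: \<theta>_def)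
  have Qth: "Q = ?q * (2 + \<theta> k)" unfolding Q_def th by (simp add: algebra_simps)
  have t2: "2 + \<theta> k > 0" using \<theta>_pos[of k] by simp
  have D: "D = 1 / (2 + \<theta> k)" unfolding D_def Qth using qq by simp
  define l where "l = C k * (2 + \<theta> k)"
  have l: "0 \<le> l" "l \<le> 1" "l * D = C k"
  proof -
    show "0 \<le> l" "l * D = C k" using t2 C_pos[of k] by (auto simp: l_def D)
    have "2 + \<theta> k \<le> a (Suc k) + \<theta> k + \<xi> (Suc k)" using a2 \<xi>_pos[of "Suc k"] by simp
    moreover have "C k = 1 / (a (Suc k) + \<theta> k + \<xi> (Suc k))" using C_eq[of "k - 1"] k by simp
    ultimately show "l \<le> 1" using t2 by (simp add: l_def)
  qed
  have C1: "1 * C k < 1" using C_less_1[OF k] by simp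
  have sn: "sin (pi * (1 * \<delta> k)) > 0"
    using \<delta>_pos[of k] s\<delta>_less[OF C1] by (intro sin_pi_mult_pos) auto
  have "D < 1" unfolding D using t2 \<theta>_pos[of k] by simp
  then have adm: "admissible D (D / 2)" using t2 by (simp add: D)
  have "block_log (q k) (sp k) (l * D + (1 - l) * 0) (l * (D / 2) + (1 - l) * 0)
    \<ge> l * block_log (q k) (sp k) D (D / 2) + (1 - l) * block_log (q k) (sp k) 0 0"
    using adm l by (intro block_log_concave coprime_sp q_pos) auto
  then have 1: "block_log (q k) (sp k) (C k) (C k * (1 - 1/2)) \<ge> l * block_log (q k) (sp k) D (D / 2) + (1 - l) * ln ?q"
    using l(3) block_log_0[OF coprime_sp q_pos] by simp
  have "2 * block_log (q k) (sp k) D (D / 2) \<ge> 3 * ln Q - 2 * ln (2 * pi) - ln ?q' - U * (2 * ?q' / Q)"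
    unfolding D_def Q_def using block_log_sum_lower(2)[OF level_det[OF k], of 1 U] qq U by simp
  moreover have "ln Q = ln ?q + ln (2 + \<theta> k)" unfolding Qth using qq t2 by (intro ln_mult_pos) auto
  moreover have "ln ?q' = ln ?q + ln (\<theta> k)" unfolding th using qq \<theta>_pos[of k] by (intro ln_mult_pos) auto
  ultimately have "block_log (q k) (sp k) D (D / 2) - ln ?q
    \<ge> (3 * ln (2 + \<theta> k) - ln (\<theta> k) - 2 * ln (2 * pi) - U * (2 * ?q' / Q)) / 2" by simp
  moreover have "U * (2 * ?q' / Q) = 2 * \<theta> k * U / (2 + \<theta> k)" unfolding Qth th using qq by simp
  ultimately have "block_log (q k) (sp k) D (D / 2) - ln ?q
    \<ge> (3 * ln (2 + \<theta> k) - ln (\<theta> k) - 2 * ln (2 * pi) - 2 * \<theta> k * U / (2 + \<theta> k)) / 2" by simp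
  then have "l * (block_log (q k) (sp k) D (D / 2) - ln ?q)
    \<ge> l * ((3 * ln (2 + \<theta> k) - ln (\<theta> k) - 2 * ln (2 * pi) - 2 * \<theta> k * U / (2 + \<theta> k)) / 2)"
    using l by (intro mult_left_mono) auto
  also have "l * ((3 * ln (2 + \<theta> k) - ln (\<theta> k) - 2 * ln (2 * pi) - 2 * \<theta> k * U / (2 + \<theta> k)) / 2)
    = C k / 2 * ((2 + \<theta> k) * (3 * ln (2 + \<theta> k) - ln (\<theta> k) - 2 * ln (2 * pi)) - 2 * \<theta> k * U)"
    using t2 by (simp add: l_def field_simps)
  finally have 2: "l * (block_log (q k) (sp k) D (D / 2) - ln ?q) \<ge> \<dots>" .
  have "ln (2 * ?q * sin (pi * \<delta> k)) = ln ?q + ln (2 * sin (pi * (1 * \<delta> k)))"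
    using qq sn by (simp add: ln_mult)
  then show ?thesis
    using 1 2 ln_block[OF _ C1] by (simp add: algebra_simps)
qed

end

section \<open>Numerical slope bounds for partial quotients at most 3\<close>

lemma pi_bounds: "3.1415 < pi" "pi < 3.1416"
proof -
  have s: "\<bar>sin x - (x - x^3/6 + x^5/120 - x^7/5040)\<bar> \<le> \<bar>x\<bar>^9 / 362880" for x :: real
  proof -
    have "(\<Sum>m<9. sin_coeff m * x ^ m) = x - x^3/6 + x^5/120 - x^7/5040"
    proof -
      have "{..<9} = {0,1,2,3,4,5,6,7,8::nat}" by auto
      then show ?thesis by (simp add: sin_coeff_def fact_numeral)
    qed
    moreover have "inverse (fact 9) = (1 / 362880 :: real)" by (simp add: fact_numeral)
    ultimately show ?thesis using Maclaurin_sin_bound[of x 9] by (simp add: fact_numeral)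
  qed
  have s1: "sin x \<le> x - x^3/6 + x^5/120 - x^7/5040 + \<bar>x\<bar>^9 / 362880"
    and s2: "sin x \<ge> x - x^3/6 + x^5/120 - x^7/5040 - \<bar>x\<bar>^9 / 362880" for x :: real
    using s[of x] by linarith+
  \<comment> \<open>A smaller value of \<open>pi\<close> would force the sine of
    \<open>3.1415 / 6\<close> up to at least 1/2, against the Taylor bound.\<close>
  show "3.1415 < pi"
  proof (rule ccontr)
    assume "\<not> 3.1415 < pi"
    then have "sin (pi/6) \<le> sin (3.1415/6)"
      using pi_ge_two by (intro sin_monotone_2pi_le) auto
    moreover have "sin (3.1415/6 :: real) < 1/2"
      using s1[of "3.1415/6"] by (simp add: power_divide)
    ultimately show False by (simp add: sin_30)
  qed
  show "pi < 3.1416"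
  proof (rule ccontr)
    assume "\<not> pi < 3.1416"
    then have "sin (3.1416/6) \<le> sin (pi/6)"
      by (intro sin_monotone_2pi_le) auto
    moreover have "sin (3.1416/6 :: real) > 1/2"
      using s2[of "3.1416/6"] by (simp add: power_divide)
    ultimately show False by (simp add: sin_30)
  qed
qed

lemma pi_sq_less: "pi\<^sup>2 < 9.8697"
proof -
  have "pi * pi < 3.1416 * 3.1416" using pi_bounds by (intro mult_strict_mono) auto
  then show ?thesis by (simp add: power2_eq_square)
qed

text \<open>Bounds on the slopes for the partial quotients 1, 2, 3; they are stable under one round of
  the recursion in \<open>slope_le_step\<close>.\<close>

definition slope_bound :: "nat \<Rightarrow> real" where
  "slope_bound n = (if n = 1 then 0.386 else if n = 2 then 0.516 else 0.706)"

text \<open>The part of the bound in \<open>slope_le_step\<close> that does not involve the old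
  slope, written with \<open>q' / q = 1 - x\<close>.\<close>

definition slope_incr :: "real \<Rightarrow> real" where
  "slope_incr x = (2 - x) * ln (pi\<^sup>2 * (1 - x) / (2 * (2 - x)\<^sup>2))"

text \<open>The quotient \<open>(1 - x) / (2 - x)\<^sup>2\<close> decreases on [0, 1), so the left
  end \<open>l\<close> is the worst case. The last hypothesis certifies that the logarithm is at
  most \<open>c\<close>, through the quadratic lower bound for \<open>exp c\<close>.\<close>

lemma slope_incr_le:
  assumes x: "0 \<le> l" "l \<le> x" "x < 1" and c: "0 \<le> c" "9.8697 * (1 - l) \<le> 2 * (2 - l)\<^sup>2 * (1 + c + c\<^sup>2/2)"
  shows "slope_incr x \<le> (2 - l) * c"
proof -
  have "pi\<^sup>2 * (1 - x) / (2 * (2 - x)\<^sup>2) \<le> pi\<^sup>2 * (1 - l) / (2 * (2 - l)\<^sup>2)"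
  proof -
    have "(1 - x) * (2 - l)\<^sup>2 \<le> (1 - l) * (2 - x)\<^sup>2"
    proof -
      have "(1 - l) * (2 - x)\<^sup>2 - (1 - x) * (2 - l)\<^sup>2 = (x - l) * (x * (1 - l) + l)"
        by (simp add: power2_eq_square algebra_simps)
      moreover have "(x - l) * (x * (1 - l) + l) \<ge> 0" using x by (intro mult_nonneg_nonneg add_nonneg_nonneg) auto
      ultimately show ?thesis by linarith
    qed
    then have "pi\<^sup>2 * ((1 - x) * (2 - l)\<^sup>2) \<le> pi\<^sup>2 * ((1 - l) * (2 - x)\<^sup>2)" by (intro mult_left_mono) auto
    moreover have "(2 - x)\<^sup>2 > 0" "(2 - l)\<^sup>2 > 0" using x by auto
    ultimately show ?thesis by (simp add: divide_simps mult_ac)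
  qed
  also have "\<dots> \<le> 1 + c + c\<^sup>2/2"
  proof -
    have "pi\<^sup>2 * (1 - l) \<le> 9.8697 * (1 - l)" using x pi_sq_less by (intro mult_right_mono) auto
    moreover have "(2 - l)\<^sup>2 > 0" using x by auto
    ultimately show ?thesis using c by (simp add: field_simps)
  qed
  also have "\<dots> \<le> exp c" using exp_lower_Taylor_quadratic[OF c(1)] by simp
  finally have "pi\<^sup>2 * (1 - x) / (2 * (2 - x)\<^sup>2) \<le> exp c" .
  moreover have "pi\<^sup>2 * (1 - x) / (2 * (2 - x)\<^sup>2) > 0" using x by (intro divide_pos_pos mult_pos_pos) auto
  ultimately have "ln (pi\<^sup>2 * (1 - x) / (2 * (2 - x)\<^sup>2)) \<le> c"
    using ln_mono by fastforce
  then have "slope_incr x \<le> (2 - x) * c" unfolding slope_incr_def using x by (intro mult_left_mono) auto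
  also have "\<dots> \<le> (2 - l) * c" using x c by (intro mult_right_mono) auto
  finally show ?thesis .
qed

text \<open>\<open>M\<close> is the stable part of the slope and \<open>e\<close> the transient
  excess, which shrinks by the factor \<open>1 - l\<close>.\<close>

lemma slope_round:
  assumes x: "l \<le> x" "x < 1" "slope_incr x \<le> d" "0 \<le> M" "0 \<le> e" "d + (1 - l) * M \<le> M'"
    and U: "U \<le> M + e"
  shows "slope_incr x + (1 - x) * U \<le> M' + (1 - l) * e"
proof -
  have "(1 - x) * U \<le> (1 - x) * (M + e)" using x U by (intro mult_left_mono) auto
  also have "\<dots> \<le> (1 - l) * (M + e)" using x by (intro mult_right_mono) auto
  finally show ?thesis using x by (simp add: distrib_left)
qed

context sudler_cfrac begin

text \<open>Consecutive intermediate fractions, of denominators \<open>q k + i * q (Suc k)\<close>,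
  are Farey neighbours, so \<open>slope_le_step\<close> applies \<open>a (Suc (Suc k))\<close>
  times. One, two or three steps from a slope at most 0.706 give 0.386, 0.516, 0.706, which closes
  the cycle; the first step alone more than halves the excess.\<close>

lemma slope_le_level:
  assumes U: "slope_le (q k) (sp k) U" and \<theta>: "5/19 \<le> \<theta> (Suc k)" "\<theta> (Suc k) \<le> 19/24"
    and a3: "a (Suc (Suc k)) \<le> 3" and e: "0 \<le> e" "U \<le> 0.706 + e"
  shows "slope_le (q (Suc (Suc k))) (sp (Suc (Suc k))) (slope_bound (a (Suc (Suc k))) + e / 2)"
proof -
  define Q where "Q i = q k + i * q (Suc k)" for i :: nat
  define P where "P i = sp k - int i * sp (Suc k)" for i :: nat
  define x where "x i = 1 / (real i + \<theta> (Suc k))" for i :: nat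
  have qq: "q k > 0" "q (Suc k) > 0" using q_pos by auto
  have th: "real (q k) = \<theta> (Suc k) * q (Suc k)" using qq by (simp add: \<theta>_def)
  have Qr: "real (Q i) = (i + \<theta> (Suc k)) * q (Suc k)" for i unfolding Q_def using th by (simp add: algebra_simps)
  have step: "slope_le (Q (Suc i)) (P (Suc i)) (slope_incr (x (Suc i)) + (1 - x (Suc i)) * V)"
    if V: "slope_le (Q i) (P i) V" for i V
  proof -
    have det: "P (Suc i) * int (Q i) - P i * int (Q (Suc i)) = 1"
    proof -
      have "P (Suc i) * int (Q i) - P i * int (Q (Suc i)) = - (sp k * int (q (Suc k)) + sp (Suc k) * int (q k))"
        by (simp add: P_def Q_def algebra_simps)
      then show ?thesis using det_sp[of k] by simp
    qed
    have Q: "0 < Q i" "Q i \<le> Q (Suc i)" using qq by (auto simp: Q_def)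
    have pos: "i + \<theta> (Suc k) > 0" "real i + 1 + \<theta> (Suc k) > 0" using \<theta> by auto
    have r1: "real (Q i) / Q (Suc i) = 1 - x (Suc i)"
    proof -
      have "real (Q i) / Q (Suc i) = (i + \<theta> (Suc k)) / (real (Suc i) + \<theta> (Suc k))"
        unfolding Qr using qq by simp
      also have "\<dots> = 1 - x (Suc i)" using pos by (simp add: x_def field_simps)
      finally show ?thesis .
    qed
    have Qs: "real (Q (Suc i)) > 0" using Q by simp
    have r2: "(real (Q (Suc i)) + Q i) / Q (Suc i) = 2 - x (Suc i)"
      using r1 Qs by (simp add: add_divide_distrib)
    have "pi\<^sup>2 * Q (Suc i) * Q i / (2 * (real (Q (Suc i)) + Q i)\<^sup>2)
      = pi\<^sup>2 * (real (Q i) / Q (Suc i)) / (2 * ((real (Q (Suc i)) + Q i) / Q (Suc i))\<^sup>2)"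
      using Qs by (simp add: power_divide power2_eq_square)
    then have r3: "pi\<^sup>2 * Q (Suc i) * Q i / (2 * (real (Q (Suc i)) + Q i)\<^sup>2)
      = pi\<^sup>2 * (1 - x (Suc i)) / (2 * (2 - x (Suc i))\<^sup>2)" unfolding r1 r2 .
    show ?thesis
      using slope_le_step[OF det Q V] unfolding slope_incr_def
      by (simp only: of_nat_add of_nat_mult of_nat_power of_nat_numeral r1 r2 r3)
  qed
  \<comment> \<open>The left ends are \<open>1 / (i + 19/24)\<close>. The constants 0.048, 0.1633,
    0.18775 used next bound the logarithm in \<open>slope_incr\<close> there.\<close>
  have x1: "24/43 \<le> x 1" "x 1 < 1" and x2: "24/67 \<le> x 2" "x 2 < 1" and x3: "24/91 \<le> x 3" "x 3 < 1"
    using \<theta> by (auto simp: x_def field_simps)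
  have i1: "slope_incr (x 1) \<le> (2 - 24/43) * 0.048" using x1 by (intro slope_incr_le) (auto simp: power2_eq_square)
  have i2: "slope_incr (x 2) \<le> (2 - 24/67) * 0.1633" using x2 by (intro slope_incr_le) (auto simp: power2_eq_square)
  have i3: "slope_incr (x 3) \<le> (2 - 24/91) * 0.18775" using x3 by (intro slope_incr_le) (auto simp: power2_eq_square)
  define V1 where "V1 = slope_incr (x 1) + (1 - x 1) * U"
  define V2 where "V2 = slope_incr (x 2) + (1 - x 2) * V1"
  define V3 where "V3 = slope_incr (x 3) + (1 - x 3) * V2"
  have S0: "slope_le (Q 0) (P 0) U" using U by (simp add: Q_def P_def)
  have S1: "slope_le (Q 1) (P 1) V1" unfolding V1_def using step[OF S0] by simp
  have S2: "slope_le (Q 2) (P 2) V2" unfolding V2_def using step[OF S1] by (simp add: numeral_2_eq_2)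
  have S3: "slope_le (Q 3) (P 3) V3" unfolding V3_def using step[OF S2] by (simp add: numeral_3_eq_3)
  have V1: "V1 \<le> 0.386 + (1 - 24/43) * e"
    unfolding V1_def by (rule slope_round[OF x1 i1 _ e(1) _ e(2)]) auto
  then have V1': "V1 \<le> 0.386 + e / 2" using e by simp
  have V2: "V2 \<le> 0.516 + (1 - 24/67) * (e / 2)"
    unfolding V2_def by (rule slope_round[OF x2 i2 _ _ _ V1']) (use e in auto)
  then have V2': "V2 \<le> 0.516 + e / 2" using e by simp
  have V3: "V3 \<le> 0.706 + (1 - 24/91) * (e / 2)"
    unfolding V3_def by (rule slope_round[OF x3 i3 _ _ _ V2']) (use e in auto)
  then have V3': "V3 \<le> 0.706 + e / 2" using e by simp
  have mono: "slope_le n m V'" if "slope_le n m V" "V \<le> V'" for n m V V'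
    using that unfolding slope_le_def by (fastforce intro: order_trans mult_right_mono)
  have Qa: "q (Suc (Suc k)) = Q (a (Suc (Suc k)))" by (simp add: Q_def q_rec)
  have Pa: "sp (Suc (Suc k)) = P (a (Suc (Suc k)))"
    by (simp add: P_def sp_def p_rec algebra_simps)
  have "a (Suc (Suc k)) = 1 \<or> a (Suc (Suc k)) = 2 \<or> a (Suc (Suc k)) = 3"
    using a3 a_pos[of "Suc (Suc k)"] by linarith
  then show ?thesis
    unfolding Qa Pa using S1 S2 S3 V1' V2' V3' mono by (auto simp: slope_bound_def)
qed

end

locale sudler_small = sudler_cfrac +
  fixes K :: nat
  assumes a_le_3: "i \<ge> K \<Longrightarrow> a i \<le> 3"
begin

text \<open>The recursion is fed with its own bounds: from (0, 1) come
  \<open>1/4 = 1/(3 + 1)\<close>, \<open>4/5 = 1/(1 + 1/4)\<close>,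
  \<open>5/19 = 1/(3 + 4/5)\<close> and \<open>19/24 = 1/(1 + 5/19)\<close>.\<close>

lemma \<xi>_range:
  assumes "k \<ge> K" "k \<ge> 1"
  shows "5/19 \<le> \<xi> k" "\<xi> k \<le> 19/24"
proof -
  have eq: "\<xi> j = 1 / (a (Suc j) + \<xi> (Suc j))" if "j \<ge> 1" for j
    using \<xi>_eq[of "j - 1"] that by simp
  have A: "1 \<le> real (a (Suc j))" "real (a (Suc j)) \<le> 3" if "j \<ge> k" for j
    using a_pos[of "Suc j"] a_le_3[of "Suc j"] that assms by auto
  have 1: "1/4 \<le> \<xi> j" if "j \<ge> k" for j
    using A[OF that] \<xi>_pos[of "Suc j"] \<xi>_less_1[of "Suc j"] that assms by (subst eq) (auto simp: field_simps)
  have 2: "\<xi> j \<le> 4/5" if "j \<ge> k" for j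
    using A[OF that] 1[of "Suc j"] that assms by (subst eq) (auto simp: field_simps)
  have 3: "5/19 \<le> \<xi> j" if "j \<ge> k" for j
    using A[OF that] 1[of "Suc j"] 2[of "Suc j"] that assms by (subst eq) (auto simp: field_simps)
  show "5/19 \<le> \<xi> k" using 3 by simp
  show "\<xi> k \<le> 19/24" using A[of k] 3[of "Suc k"] assms by (subst eq) (auto simp: field_simps)
qed

text \<open>The same rounds of the recursion, run along the past; digits before \<open>K\<close> are
  not controlled, so a few levels above \<open>K\<close> are given up.\<close>

lemma \<theta>_range:
  assumes "k \<ge> K + 6"
  shows "5/19 \<le> \<theta> k" "\<theta> k \<le> 19/24"
proof -
  have eq: "\<theta> j = 1 / (a j + \<theta> (j - 1))" if "j \<ge> 2" for j
    using \<theta>_eq[of "j - 2"] that by (simp add: numeral_2_eq_2 Suc_diff_Suc)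
  have A: "1 \<le> real (a j)" "real (a j) \<le> 3" if "j \<ge> K + 2" for j
    using a_pos[of j] a_le_3[of j] that by auto
  have 1: "1/4 \<le> \<theta> j" if "j \<ge> K + 2" for j
    using A[OF that] \<theta>_pos[of "j - 1"] \<theta>_le_1[of "j - 1"] that by (subst eq) (auto simp: field_simps)
  have 2: "\<theta> j \<le> 4/5" if "j \<ge> K + 3" for j
  proof -
    have "1/4 \<le> \<theta> (j - 1)" using 1[of "j - 1"] that by linarith
    then show ?thesis using A[of j] that by (subst eq) (auto simp: field_simps)
  qed
  have 3: "5/19 \<le> \<theta> j" if "j \<ge> K + 4" for j
  proof -
    have "1/4 \<le> \<theta> (j - 1)" "\<theta> (j - 1) \<le> 4/5" using 1[of "j - 1"] 2[of "j - 1"] that by linarith+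
    then show ?thesis using A[of j] that by (subst eq) (auto simp: field_simps)
  qed
  show "5/19 \<le> \<theta> k" using 3[of k] assms by simp
  have "5/19 \<le> \<theta> (k - 1)" using 3[of "k - 1"] assms by linarith
  then show "\<theta> k \<le> 19/24" using A[of k] assms by (subst eq) (auto simp: field_simps)
qed

text \<open>The recursion advances by two levels, so the levels from \<open>k0\<close> on form two
  chains, one for each parity. The initial excess \<open>E\<close> is not explicit but halves at
  every move.\<close>

lemma slope_le_eventually:
  "\<exists>N. \<forall>k\<ge>N. slope_le (q k) (sp k) (slope_bound (a k) + 1/1000)"
proof -
  define k0 where "k0 = K + 8"
  obtain U0 U1 where U0: "slope_le (q k0) (sp k0) U0" and U1: "slope_le (q (Suc k0)) (sp (Suc k0)) U1"
    using slope_le_exists[OF coprime_sp q_pos] by blast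
  define E where "E = max (max U0 U1) 0"
  have E: "E \<ge> 0" "U0 \<le> 0.706 + E" "U1 \<le> 0.706 + E" by (auto simp: E_def)
  have main: "slope_le (q (k + 2 * Suc n)) (sp (k + 2 * Suc n)) (slope_bound (a (k + 2 * Suc n)) + E / 2 ^ Suc n)"
    if k: "k \<ge> k0" and U: "slope_le (q k) (sp k) U" "U \<le> 0.706 + E" for k n U
  proof (induction n)
    case 0
    then show ?case
      using slope_le_level[OF U(1), of E] \<theta>_range[of "Suc k"] a_le_3[of "Suc (Suc k)"] k E U
      by (simp add: k0_def)
  next
    case (Suc n)
    define j where "j = k + 2 * Suc n"
    have "slope_bound m \<le> 0.706" for m by (simp add: slope_bound_def)
    then have "slope_le (q (Suc (Suc j))) (sp (Suc (Suc j))) (slope_bound (a (Suc (Suc j))) + E / 2 ^ Suc n / 2)"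
      using slope_le_level[OF Suc[folded j_def], of "E / 2 ^ Suc n"] \<theta>_range[of "Suc j"] a_le_3[of "Suc (Suc j)"] k E
      by (simp add: k0_def j_def)
    then show ?case by (simp add: j_def)
  qed
  obtain n where n: "E / 2 ^ n < 1/1000"
  proof -
    have "(\<lambda>n. E * (1/2) ^ n) \<longlonglongrightarrow> E * 0" by (intro tendsto_intros LIMSEQ_realpow_zero) auto
    then have "eventually (\<lambda>n. E * (1/2) ^ n < 1/1000) sequentially"
      by (intro order_tendstoD) auto
    then show ?thesis using that by (auto simp: eventually_sequentially power_divide)
  qed
  have mono: "slope_le n m V'" if "slope_le n m V" "V \<le> V'" for n m V V'
    using that unfolding slope_le_def by (fastforce intro: order_trans mult_right_mono)
  show ?thesis
  proof (intro exI allI impI)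
    fix k assume k: "k \<ge> k0 + 2 * n + 3"
    define m where "m = (k - k0) div 2 - 1"
    have m: "m \<ge> n" "k = k0 + 2 * Suc m \<or> k = Suc k0 + 2 * Suc m" using k by (auto simp: m_def)
    have "E / 2 ^ Suc m \<le> E / 2 ^ n" using m(1) E by (intro divide_left_mono power_increasing) auto
    then have le: "slope_bound (a k) + E / 2 ^ Suc m \<le> slope_bound (a k) + 1/1000" using n by linarith
    from m(2) show "slope_le (q k) (sp k) (slope_bound (a k) + 1/1000)"
    proof
      assume e: "k = k0 + 2 * Suc m"
      show ?thesis using mono[OF _ le] main[OF order_refl U0 E(2), of m] unfolding e by blast
    next
      assume e: "k = Suc k0 + 2 * Suc m"
      show ?thesis using mono[OF _ le] main[of "Suc k0", OF _ U1 E(3), of m] unfolding e by force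
    qed
  qed
qed

lemma \<delta>_bound: "\<delta> k \<le> 1 / q (Suc k)"
proof -
  have "q (Suc k) * \<delta> k \<le> 1" using q_\<delta>[of k] mult_nonneg_nonneg[of "real (q k)" "\<delta> (Suc k)"] \<delta>_pos[of "Suc k"] by linarith
  then show ?thesis using q_pos[of "Suc k"] by (simp add: field_simps)
qed

lemma q_ge: "q (2 * n) \<ge> Suc n"
proof (induction n)
  case (Suc n)
  have "q (Suc (2 * n)) \<le> a (Suc (Suc (2 * n))) * q (Suc (2 * n))" using a_pos[of "Suc (Suc (2 * n))"] by simp
  then have "q (Suc (Suc (2 * n))) \<ge> q (Suc (2 * n)) + q (2 * n)" unfolding q_rec by simp
  then show ?case using q_pos[of "Suc (2 * n)"] Suc by simp
qed simp

lemma \<delta>_tendsto_0: "\<delta> \<longlonglongrightarrow> 0"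
proof (rule tendstoI)
  fix e :: real assume e: "e > 0"
  obtain n :: nat where n: "1 / real (Suc n) < e" using e nat_approx_posE by blast
  have "\<delta> k < e" if "k \<ge> 2 * n" for k
  proof -
    have "\<delta> k \<le> \<delta> (2 * n)" using that
      by (induction k rule: dec_induct) (auto intro: order_trans less_imp_le[OF \<delta>_less])
    also have "\<dots> \<le> 1 / q (Suc (2 * n))" by (rule \<delta>_bound)
    also have "\<dots> \<le> 1 / real (Suc n)"
      using q_ge[of n] q_mono_Suc[of "2 * n"] by (intro divide_left_mono mult_pos_pos) (auto simp: q_pos)
    finally show ?thesis using n by simp
  qed
  then show "eventually (\<lambda>k. dist (\<delta> k) 0 < e) sequentially"
    using \<delta>_pos by (auto simp: eventually_sequentially abs_of_pos intro!: exI[of _ "2 * n"])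
qed

end

section \<open>Numerical bounds\<close>

definition e3 :: "real \<Rightarrow> real" where "e3 x = 1 + x + x\<^sup>2/2 + x^3/6"

text \<open>The Taylor remainder is a positive multiple of \<open>x ^ 4\<close>, so the bound holds
  for negative \<open>x\<close> too, where it is used for the decaying factors.\<close>

lemma exp_ge_e3: "e3 x \<le> exp x"
proof -
  obtain t where t: "exp x = (\<Sum>m<4. x ^ m / fact m) + exp t / fact 4 * x ^ 4"
    using Maclaurin_exp_le[of x 4] by blast
  have "{..<4} = {0,1,2,3::nat}" by auto
  then have "(\<Sum>m<4. x ^ m / fact m) = e3 x" by (simp add: e3_def fact_numeral)
  then show ?thesis using t by (simp add: zero_le_even_power)
qed

lemma exp_ge_e3_power:
  assumes "n > 0" "e3 (x / n) \<ge> 0"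
  shows "e3 (x / n) ^ n \<le> exp x"
proof -
  have "e3 (x / n) ^ n \<le> exp (x / n) ^ n" using assms exp_ge_e3 by (intro power_mono) auto
  also have "\<dots> = exp x" using assms by (simp add: exp_of_nat_mult[symmetric])
  finally show ?thesis .
qed

text \<open>The function \<open>(j + x) ^ (j + 1) / x\<close> decreases on (0, 1], its critical
  point being 1, so the largest \<open>\<theta> k\<close> is the worst. For each \<open>j\<close>
  the difference of the two sides contains the factor \<open>x0 - x\<close>.\<close>

lemma rate_mono:
  fixes x x0 :: real
  assumes "0 < x" "x \<le> x0" "x0 \<le> 1" "j \<in> {1,2,3::nat}"
  shows "x * (j + x0) ^ (j + 1) \<le> x0 * (j + x) ^ (j + 1)"
proof -
  have xx: "0 \<le> x * x0" "x * x0 \<le> 1" using assms by (auto intro: mult_le_one)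
  have d: "x0 - x \<ge> 0" using assms by simp
  consider "j = 1" | "j = 2" | "j = 3" using assms(4) by auto
  then show ?thesis
  proof cases
    case 1
    have "x0 * (1 + x)\<^sup>2 - x * (1 + x0)\<^sup>2 = (x0 - x) * (1 - x * x0)"
      by (simp add: power2_eq_square algebra_simps)
    also have "\<dots> \<ge> 0" using d xx by (intro mult_nonneg_nonneg) auto
    finally show ?thesis using 1 by (simp add: power2_eq_square)
  next
    case 2
    have "x0 * (2 + x)^3 - x * (2 + x0)^3 = (x0 - x) * (8 - 6 * (x * x0) - (x * x0) * (x + x0))"
      by (simp add: power3_eq_cube algebra_simps)
    also have "\<dots> \<ge> 0"
    proof (intro mult_nonneg_nonneg d)
      have "(x * x0) * (x + x0) \<le> 1 * 2" using assms xx by (intro mult_mono) auto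
      then show "8 - 6 * (x * x0) - (x * x0) * (x + x0) \<ge> 0" using xx by linarith
    qed
    finally show ?thesis using 2 by (simp add: eval_nat_numeral)
  next
    case 3
    have "x0 * (3 + x)^4 - x * (3 + x0)^4
      = (x0 - x) * (81 - 54 * (x * x0) - 12 * ((x * x0) * (x + x0)) - (x * x0) * (x\<^sup>2 + x * x0 + x0\<^sup>2))"
      by (simp add: power2_eq_square eval_nat_numeral algebra_simps)
    also have "\<dots> \<ge> 0"
    proof (intro mult_nonneg_nonneg d)
      have "(x * x0) * (x + x0) \<le> 1 * 2" using assms xx by (intro mult_mono) auto
      moreover have "(x * x0) * (x\<^sup>2 + x * x0 + x0\<^sup>2) \<le> 1 * 3"
      proof (rule mult_mono)
        have "x\<^sup>2 \<le> 1" "x0\<^sup>2 \<le> 1" using assms by (auto simp: power_le_one)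
        then show "x\<^sup>2 + x * x0 + x0\<^sup>2 \<le> 3" using xx by linarith
      qed (use xx in auto)
      ultimately show "81 - 54 * (x * x0) - 12 * ((x * x0) * (x + x0)) - (x * x0) * (x\<^sup>2 + x * x0 + x0\<^sup>2) \<ge> 0"
        using xx by linarith
    qed
    finally show ?thesis using 3 by (simp add: eval_nat_numeral)
  qed
qed

text \<open>The last hypothesis is a polynomial certificate that the logarithmic bracket is at least
  \<open>- k\<close> at \<open>x0\<close>; \<open>rate_mono\<close> carries this to all smaller
  \<open>x\<close>.\<close>

lemma rate_lower:
  fixes x x0 U U0 c k :: real
  assumes x: "0 < x" "x \<le> x0" "x0 \<le> 1" and j: "j \<in> {1,2,3::nat}" and U: "U \<le> U0" "0 \<le> U0"
    and c: "c > 0" and k: "0 \<le> k" and le: "x0 * c \<le> (j + x0) ^ (j + 1) * e3 (k / 4) ^ 4"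
  shows "(j + x) * ((real j + 1) * ln (j + x) - ln x - ln c) - j * x * U \<ge> - ((j + x0) * k + j * x0 * U0)"
proof -
  have jx: "j + x > 0" "j + x0 > 0" using x by auto
  have "e3 (k / 4) \<ge> 0" using k by (simp add: e3_def)
  then have E: "e3 (k / 4) ^ 4 \<le> exp k" using exp_ge_e3_power[of 4 k] by simp
  have "x * c * (j + x0) ^ (j + 1) \<le> x0 * c * (j + x) ^ (j + 1)"
    using mult_left_mono[OF rate_mono[OF x j] less_imp_le[OF c]] by (simp only: mult_ac)
  also have "\<dots> \<le> (j + x0) ^ (j + 1) * exp k * (j + x) ^ (j + 1)"
  proof (rule mult_right_mono)
    have "(j + x0) ^ (j + 1) * e3 (k / 4) ^ 4 \<le> (j + x0) ^ (j + 1) * exp k"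
      using jx by (intro mult_left_mono E) auto
    then show "x0 * c \<le> (j + x0) ^ (j + 1) * exp k" using le by linarith
  qed (use jx in auto)
  finally have "x * c \<le> exp k * (j + x) ^ (j + 1)"
    using jx by (simp add: mult.commute mult.left_commute del: power_Suc)
  then have "ln (x * c) \<le> ln (exp k * (j + x) ^ (j + 1))" using x c by (intro ln_mono) auto
  also have "ln (exp k * (j + x) ^ (j + 1)) = k + (real j + 1) * ln (j + x)"
  proof -
    have "ln ((j + x) ^ (j + 1)) = real (j + 1) * ln (j + x)" using jx by (intro ln_realpow)
    then show ?thesis using jx by (subst ln_mult_pos) auto
  qed
  finally have L: "(real j + 1) * ln (j + x) - ln x - ln c \<ge> - k" using x c by (simp add: ln_mult_pos)
  have "(j + x) * ((real j + 1) * ln (j + x) - ln x - ln c) \<ge> (j + x) * (- k)"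
    using L jx by (intro mult_left_mono) auto
  moreover have "(j + x) * k \<le> (j + x0) * k" using x k by (intro mult_right_mono) auto
  moreover have "j * x * U \<le> j * x0 * U0"
  proof -
    have "x * U \<le> x * U0" using x U by (intro mult_left_mono) auto
    also have "\<dots> \<le> x0 * U0" using x U by (intro mult_right_mono) auto
    finally show ?thesis by (simp add: mult.assoc mult_left_mono)
  qed
  ultimately show ?thesis by linarith
qed

text \<open>The logarithmic derivative of \<open>C ^ j * exp (- (C * k))\<close> is
  \<open>j / C - k\<close>, which is nonnegative while \<open>C * k \<le> j\<close>. This allows
  \<open>C k\<close> to be replaced by its minimum.\<close>

lemma power_exp_mono:
  fixes C C0 k :: real
  assumes "0 < C0" "C0 \<le> C" "0 \<le> k" "C * k \<le> real j"
  shows "C0 ^ j * exp (- (C0 * k)) \<le> C ^ j * exp (- (C * k))"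
proof -
  have C: "C > 0" using assms by simp
  have "1 - C0 / C \<le> ln (C / C0)"
    using ln_le_minus_one[of "C0 / C"] assms C by (simp add: ln_div)
  then have "j * (1 - C0 / C) \<le> j * ln (C / C0)" by (intro mult_left_mono) auto
  moreover have "(C - C0) * k \<le> j * (1 - C0 / C)"
  proof -
    have "(C - C0) * k = (1 - C0 / C) * (C * k)" using C by (simp add: field_simps)
    also have "\<dots> \<le> (1 - C0 / C) * j" using assms C by (intro mult_left_mono) auto
    finally show ?thesis by (simp add: mult.commute)
  qed
  ultimately have "(C - C0) * k \<le> j * ln (C / C0)" by linarith
  then have "exp ((C - C0) * k) \<le> exp (j * ln (C / C0))" by simp
  also have "\<dots> = (C / C0) ^ j" using assms C by (simp add: exp_of_nat_mult)
  finally have "exp ((C - C0) * k) * C0 ^ j \<le> C ^ j"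
    using assms by (simp add: power_divide field_simps)
  then have "exp ((C - C0) * k) * C0 ^ j * exp (- (C * k)) \<le> C ^ j * exp (- (C * k))"
    by (intro mult_right_mono) auto
  moreover have "exp ((C - C0) * k) * C0 ^ j * exp (- (C * k)) = C0 ^ j * exp (- (C0 * k))"
    by (simp add: mult_exp_exp algebra_simps)
  ultimately show ?thesis by simp
qed

text \<open>Five classes of past expansions: \<open>a k = 1\<close> with \<open>a (k - 1) = 1, 2, 3\<close>, then \<open>a k = 2\<close> and
  \<open>a k = 3\<close>. For each class we list the largest \<open>\<theta> k\<close>, a bound for the slope at level
  \<open>k - 1\<close>, and bounds for the rates of a single block and of groups of 1, 2, 3 blocks.\<close>

definition cls :: "nat \<Rightarrow> nat \<Rightarrow> nat" where
  "cls al al2 = (if al = 1 then al2 - 1 else al + 1)"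

text \<open>Stops the simplifier from normalising every entry of a table before one is selected.\<close>

lemma nth_weak_cong [cong]: "m = n \<Longrightarrow> xs ! m = xs ! n" by simp

definition th_max :: "nat \<Rightarrow> real" where "th_max c = [43/67, 67/91, 91/115, 19/43, 19/62] ! c"
definition u_max :: "nat \<Rightarrow> real" where "u_max c = [0.387, 0.517, 0.707, 0.707, 0.707] ! c"
definition rate_max :: "nat \<Rightarrow> nat \<Rightarrow> real" where
  "rate_max j c = [0.6685, 0.8594, 1.065, 0.5332, 0.2167,
     0.9099, 1.1243, 1.3441, 0.7296, 0.3743,
     3.1692, 3.6169, 4.0666, 2.7595, 2.0001,
     6.9213, 7.6098, 8.2935, 6.2632, 5.0837] ! (5 * j + c)"
text \<open>Certificates for \<open>rate_lower\<close>: \<open>- kap j c\<close> is a lower bound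
  for the logarithmic bracket in class \<open>c\<close>. Row 0 belongs to the centred two-block
  identity; its last entry is 0 because that bracket is already nonnegative.\<close>

definition kap :: "nat \<Rightarrow> nat \<Rightarrow> real" where
  "kap j c = [0.318, 0.3499, 0.3622, 0.1808, 0,
     0.4029, 0.4283, 0.438, 0.2893, 0.1206,
     1.0116, 1.0436, 1.056, 0.8742, 0.6793,
     1.6959, 1.7311, 1.7448, 1.5474, 1.3409] ! (5 * j + c)"

text \<open>The Boolean argument tells whether \<open>a (k + 2) = 1\<close>.\<close>

definition xi_max :: "bool \<Rightarrow> real" where "xi_max r = (if r then 19/24 else 19/43)"
definition xi_min :: "bool \<Rightarrow> real" where "xi_min r = (if r then 24/43 else 24/91)"
definition c_min :: "nat \<Rightarrow> nat \<Rightarrow> bool \<Rightarrow> real" where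
  "c_min c n r = 1 / (n + th_max c + xi_max r)"

text \<open>Lower bounds for products of the first blocks at shift 0: \<open>first_low\<close> for one block, using the
  identity centred at that block if \<open>n \<ge> 2\<close>; the others for 1, 2, 3 blocks, using the identity for
  that many blocks, which also controls positive shifts.\<close>

definition first_low :: "nat \<Rightarrow> nat \<Rightarrow> bool \<Rightarrow> real" where
  "first_low c n r = (if r then fst else snd) ([(1.775, 1.947), (1.505, 1.639), (1.218, 1.305),
     (1.591, 1.719), (1.395, 1.507), (1.147, 1.223),
     (1.444, 1.539), (1.301, 1.397), (1.086, 1.153),
     (2.028, 2.262), (1.646, 1.81), (1.307, 1.409),
     (2.504, 2.899), (1.89, 2.111), (1.453, 1.581)] ! (3 * c + n - 1))"
definition one_low :: "nat \<Rightarrow> nat \<Rightarrow> bool \<Rightarrow> real" where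
  "one_low c n r = (if r then fst else snd) ([(1.775, 1.947), (1.403, 1.516), (1.153, 1.23),
     (1.591, 1.719), (1.294, 1.387), (1.081, 1.148),
     (1.444, 1.539), (1.204, 1.281), (1.021, 1.079),
     (2.028, 2.262), (1.549, 1.69), (1.248, 1.34),
     (2.504, 2.899), (1.796, 1.994), (1.398, 1.516)] ! (3 * c + n - 1))"
definition two_low :: "nat \<Rightarrow> nat \<Rightarrow> bool \<Rightarrow> real" where
  "two_low c n r = (if r then fst else snd) ([(2.643, 2.942), (1.959, 2.171),
     (2.253, 2.467), (1.725, 1.893),
     (1.948, 2.098), (1.539, 1.673),
     (3.2, 3.619), (2.29, 2.565),
     (4.303, 5.033), (2.881, 3.29)] ! (2 * c + n - 2))"
definition three_low :: "nat \<Rightarrow> bool \<Rightarrow> real" where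
  "three_low c r = (if r then fst else snd) ([(3.373, 3.671), (2.741, 2.912), (2.241, 2.312), (4.26, 4.72), (6.118, 7.049)] ! c)"

lemmas tables = th_max_def u_max_def rate_max_def kap_def xi_max_def xi_min_def c_min_def
  first_low_def one_low_def two_low_def three_low_def

text \<open>The second and fourth claims validate \<open>kap\<close>, with 6.2832 above
  \<open>2 * pi\<close>; the first and third pass from \<open>kap\<close> to
  \<open>rate_max\<close>. Row 0 carries a factor 2 since the centred identity contains the first
  block twice.\<close>

lemma rate_max_check:
  assumes "c \<in> {0,1,2,3,4}"
  shows "j \<in> {1,2,3} \<Longrightarrow> (j + th_max c) * kap j c + j * th_max c * u_max c \<le> rate_max j c"
    and "j \<in> {1,2,3} \<Longrightarrow> th_max c * (6.2832 ^ j * fact j) \<le> (j + th_max c) ^ (j + 1) * e3 (kap j c / 4) ^ 4"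
    and "(2 + th_max c) * kap 0 c + 2 * th_max c * u_max c \<le> 2 * rate_max 0 c"
    and "th_max c * 6.2832\<^sup>2 \<le> (2 + th_max c) ^ 3 * e3 (kap 0 c / 4) ^ 4"
  using assms by (auto simp: tables e3_def fact_numeral power_divide)

text \<open>The constant 6.28 is slightly below \<open>2 * pi\<close>, and the gap pays for
  replacing sines by arguments. As \<open>\<theta> k + \<xi> (Suc k)\<close> is at least 10/19 >
  0.52, the bounds on \<open>rate_max\<close> give \<open>C k * rate_max j c \<le> j\<close> for
  \<open>j \<ge> 1\<close>, as \<open>power_exp_mono\<close> demands.\<close>

lemma low_check:
  assumes "c \<in> {0,1,2,3,4}"
  shows "n \<in> {1,2,3} \<Longrightarrow> one_low c n r \<le> 6.28 * c_min c n r * (e3 (- (c_min c n r * rate_max 1 c) / 2))\<^sup>2"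
    and "n \<in> {2,3} \<Longrightarrow> first_low c n r \<le> 6.28 * c_min c n r * (e3 (- (c_min c n r * rate_max 0 c) / 2))\<^sup>2"
    and "n \<in> {2,3} \<Longrightarrow> two_low c n r \<le> (6.28 * c_min c n r)\<^sup>2 * 2 * (e3 (- (c_min c n r * rate_max 2 c) / 2))\<^sup>2"
    and "three_low c r \<le> (6.28 * c_min c 3 r) ^ 3 * 6 * (e3 (- (c_min c 3 r * rate_max 3 c) / 2))\<^sup>2"
    and "n \<in> {1,2,3} \<Longrightarrow> j \<in> {0,1,2,3} \<Longrightarrow> j \<le> n \<Longrightarrow> e3 (- (c_min c n r * rate_max j c) / 2) \<ge> 0"
    and "j \<in> {1,2,3} \<Longrightarrow> rate_max j c \<le> j * (j + 0.52)" "rate_max 0 c \<le> 2"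
  using assms by (cases r; auto simp: tables e3_def power_divide)+

lemma prod_blocks:
  fixes f :: "nat \<Rightarrow> 'a :: comm_monoid_mult"
  shows "(\<Prod>r=1..b*q. f r) = (\<Prod>i<b. \<Prod>r=1..q. f (i*q+r))"
proof (induction b)
  case (Suc b)
  have "{1..Suc b*q} = {1..b*q} \<union> {b*q+1..b*q+q}" by auto
  then have "(\<Prod>r=1..Suc b*q. f r) = (\<Prod>r=1..b*q. f r) * (\<Prod>r=b*q+1..b*q+q. f r)"
    by (simp add: prod.union_disjoint)
  also have "(\<Prod>r=b*q+1..b*q+q. f r) = (\<Prod>r=1..q. f (b*q+r))"
    using prod.shift_bounds_cl_nat_ivl[of f 1 "b*q" q] by (simp add: add.commute)
  finally show ?case using Suc.IH by simp
qed simp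

lemma sin_ge_cubic: "x \<ge> 0 \<Longrightarrow> sin x \<ge> x - x^3/6" for x :: real
proof -
  assume x: "x \<ge> 0"
  have "{..<3} = {0,1,2::nat}" by auto
  then have "(\<Sum>m<3. sin_coeff m * x ^ m) = x" by (simp add: sin_coeff_def)
  then have "\<bar>sin x - x\<bar> \<le> x^3 / 6"
    using Maclaurin_sin_bound[of x 3] x by (simp add: fact_numeral)
  then show ?thesis by linarith
qed

text \<open>The constant 1.645 lies just above \<open>pi\<^sup>2 / 6\<close>; since
  \<open>lsinc\<close> is nonpositive, an exponent \<open>e\<close> below 1 only helps.\<close>

lemma exp_lsinc_ge:
  assumes x: "0 \<le> x" "x < 1" and e: "0 \<le> e" "e \<le> 1"
  shows "exp (e * lsinc x) \<ge> 1 - 1.645 * x\<^sup>2"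
proof (cases "x = 0")
  case False
  then have x0: "x > 0" using x by simp
  have s: "sin (pi * x) > 0" using x0 x by (intro sin_pi_mult_pos)
  have le1: "sin (pi * x) / (pi * x) \<le> 1" using x0 sin_x_le_x[of "pi * x"] by simp
  have lneg: "lsinc x \<le> 0" using x0 s le1 by (simp add: lsinc_def)
  have "1 - 1.645 * x\<^sup>2 \<le> 1 - pi\<^sup>2 * x\<^sup>2 / 6"
  proof -
    have "pi\<^sup>2 \<le> 6 * 1.645" using pi_sq_less by simp
    then have "pi\<^sup>2 * x\<^sup>2 \<le> 6 * 1.645 * x\<^sup>2" by (intro mult_right_mono) auto
    then show ?thesis by simp
  qed
  also have "\<dots> = (pi * x - (pi * x)^3 / 6) / (pi * x)"
    using x0 by (simp add: field_simps power2_eq_square power3_eq_cube)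
  also have "\<dots> \<le> sin (pi * x) / (pi * x)"
    using x0 sin_ge_cubic[of "pi * x"] by (intro divide_right_mono) auto
  also have "\<dots> = exp (lsinc x)" using x0 s by (simp add: lsinc_def)
  also have "\<dots> \<le> exp (e * lsinc x)"
    using lneg e mult_right_mono_neg[of e 1 "lsinc x"] by simp
  finally show ?thesis .
qed (auto simp: lsinc_def)

lemma block_rate_eq:
  fixes x U :: real
  shows "block_rate j x U
    = (j + x) * ((real j + 1) * ln (j + x) - ln x - ln ((2 * pi) ^ j * fact j)) - j * x * U"
proof -
  have "(\<Sum>i=1..j. ln (2 * pi * real i)) = ln (\<Prod>i=1..j. 2 * pi * real i)" by (subst ln_prod) auto
  also have "(\<Prod>i=1..j. 2 * pi * real i) = (2 * pi) ^ j * fact j"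
    by (simp add: prod.distrib fact_prod)
  finally have "(\<Sum>i=1..j. ln (2 * pi * real i)) = ln ((2 * pi) ^ j * fact j)" .
  moreover have "real (j + 1) = real j + 1" by simp
  ultimately show ?thesis unfolding block_rate_def by (simp only:)
qed

definition th_min :: "nat \<Rightarrow> real" where "th_min c = [24/43, 43/62, 62/81, 24/67, 24/91] ! c"

text \<open>Lower bound for a full digit at the maximal shift \<open>\<xi> (k + 1)\<close>, where the product telescopes to a
  quotient of products along the convergents \<open>k + 1\<close> and \<open>k - 1\<close>.\<close>

definition xi_low :: "nat \<Rightarrow> nat \<Rightarrow> nat \<Rightarrow> bool \<Rightarrow> real" where
  "xi_low al2 al n r = (1 + n / th_max (cls al al2)) *
     (e3 (- (rate_max 1 (cls n al) / (1 / xi_max r + th_min (cls n al))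
             + (slope_bound al2 + 1/1000) / (1 / th_max (cls al al2) + 1 / (n + xi_max r))) / 2))\<^sup>2"

context sudler_small begin

text \<open>Levels where three things are available: digits at most 3 with room to look back,
  settled slopes from level \<open>k - 1\<close> on, and sines linear to within the slack of the
  constant 6.28.\<close>

definition good :: "nat \<Rightarrow> bool" where
  "good k \<longleftrightarrow> k \<ge> K + 10 \<and> (\<forall>j\<ge>k - 1. slope_le (q j) (sp j) (slope_bound (a j) + 1/1000)) \<and> \<delta> k \<le> 1/1000"

lemma \<delta>_antimono: "i \<le> j \<Longrightarrow> \<delta> j \<le> \<delta> i"
  by (rule lift_Suc_antimono_le[of \<delta>]) (auto intro: less_imp_le[OF \<delta>_less])

lemma good_mono: "good k \<Longrightarrow> k \<le> j \<Longrightarrow> good j"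
  using \<delta>_antimono[of k j] unfolding good_def by fastforce

lemma good_exists: "\<exists>k. good k"
proof -
  obtain N where N: "\<And>k. k \<ge> N \<Longrightarrow> slope_le (q k) (sp k) (slope_bound (a k) + 1/1000)"
    using slope_le_eventually by blast
  have "eventually (\<lambda>k. \<delta> k < 1/1000) sequentially"
    using \<delta>_tendsto_0 by (rule order_tendstoD) simp
  then obtain N' where N': "\<And>k. k \<ge> N' \<Longrightarrow> \<delta> k < 1/1000" by (auto simp: eventually_sequentially)
  have "good (K + 10 + N + N' + 1)"
    unfolding good_def using N N'[of "K + 10 + N + N' + 1"] by auto
  then show ?thesis ..
qed

abbreviation kcls :: "nat \<Rightarrow> nat" where "kcls k \<equiv> cls (a k) (a (k - 1))"
abbreviation knext :: "nat \<Rightarrow> bool" where "knext k \<equiv> a (Suc (Suc k)) = 1"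

lemma a_cases: "i \<ge> K + 1 \<Longrightarrow> a i \<in> {1,2,3}"
  using a_pos[of i] a_le_3[of i] by auto

lemma \<theta>_eq': "k \<ge> 2 \<Longrightarrow> \<theta> k = 1 / (a k + \<theta> (k - 1))"
  using \<theta>_eq[of "k - 2"] by (simp add: numeral_2_eq_2 Suc_diff_Suc)

text \<open>For \<open>a k = 1\<close> one more digit of the past is expanded and the range
  [5/19, 19/24] is inserted at level \<open>k - 2\<close>; for larger \<open>a k\<close> it is
  inserted directly at level \<open>k - 1\<close>. The tables list the resulting fractions.\<close>

lemma good_\<theta>:
  assumes "good k"
  shows "th_min (kcls k) \<le> \<theta> k" "\<theta> k \<le> th_max (kcls k)" "kcls k \<in> {0,1,2,3,4}"
proof -
  have k: "k \<ge> K + 10" using assms by (simp add: good_def)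
  have th: "\<theta> k = 1 / (a k + \<theta> (k - 1))" "\<theta> (k - 1) = 1 / (a (k - 1) + \<theta> (k - 1 - 1))"
    using \<theta>_eq'[of k] \<theta>_eq'[of "k - 1"] k by simp_all
  have b: "5/19 \<le> \<theta> (k - 1 - 1)" "\<theta> (k - 1 - 1) \<le> 19/24" "5/19 \<le> \<theta> (k - 1)" "\<theta> (k - 1) \<le> 19/24"
    using \<theta>_range[of "k - 1 - 1"] \<theta>_range[of "k - 1"] k by auto
  have a1: "a k \<in> {1,2,3}" and a2: "a (k - 1) \<in> {1,2,3}"
    using k a_cases[of k] a_cases[of "k - 1"] by simp_all
  show "kcls k \<in> {0,1,2,3,4}" using a1 a2 by (auto simp: cls_def)
  have b1: "1 / (real n + 19/24) \<le> \<theta> (k - 1) \<and> \<theta> (k - 1) \<le> 1 / (real n + 5/19)" if "a (k - 1) = n" "n \<in> {1,2,3}" for n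
    using b that th(2) by (auto intro!: divide_left_mono)
  have gen: "1 / (real m + u) \<le> \<theta> k \<and> \<theta> k \<le> 1 / (real m + l)"
    if "a k = m" "l \<le> \<theta> (k - 1)" "\<theta> (k - 1) \<le> u" "0 < l" for m l u
    using that th(1) by (auto intro!: divide_left_mono mult_pos_pos add_nonneg_pos)
  have "th_min (kcls k) \<le> \<theta> k \<and> \<theta> k \<le> th_max (kcls k)"
  proof (cases "a k = 1")
    case True
    define n where "n = a (k - 1)"
    have n: "n \<in> {1,2,3}" using a2 by (simp add: n_def)
    have "1 / (1 + 1 / (real n + 5/19)) \<le> \<theta> k \<and> \<theta> k \<le> 1 / (1 + 1 / (real n + 19/24))"
      using gen[OF True, of "1 / (real n + 19/24)" "1 / (real n + 5/19)"] b1[of n] n by (simp add: n_def)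
    moreover have "a (k - Suc 0) = n" by (simp add: n_def)
    ultimately show ?thesis using n True by (auto simp: cls_def th_min_def th_max_def)
  next
    case False
    then show ?thesis using a1 gen[of 2 "5/19" "19/24"] gen[of 3 "5/19" "19/24"] b
      by (auto simp: cls_def th_min_def th_max_def)
  qed
  then show "th_min (kcls k) \<le> \<theta> k" "\<theta> k \<le> th_max (kcls k)" by auto
qed

text \<open>The table entries are \<open>1/(1 + 5/19)\<close>, \<open>1/(2 + 5/19)\<close>,
  \<open>1/(1 + 19/24)\<close> and \<open>1/(3 + 19/24)\<close>.\<close>

lemma good_\<xi>:
  assumes "good k"
  shows "xi_min (knext k) \<le> \<xi> (Suc k)" "\<xi> (Suc k) \<le> xi_max (knext k)"
proof -
  have k: "k \<ge> K + 10" using assms by (simp add: good_def)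
  have eq: "\<xi> (Suc k) = 1 / (a (Suc (Suc k)) + \<xi> (Suc (Suc k)))" by (rule \<xi>_eq)
  have b: "5/19 \<le> \<xi> (Suc (Suc k))" "\<xi> (Suc (Suc k)) \<le> 19/24" using \<xi>_range[of "Suc (Suc k)"] k by auto
  have a: "a (Suc (Suc k)) \<in> {1,2,3}" using k by (intro a_cases) auto
  show "xi_min (knext k) \<le> \<xi> (Suc k)" "\<xi> (Suc k) \<le> xi_max (knext k)"
    unfolding eq using a b by (auto simp: xi_min_def xi_max_def field_simps)
qed

lemma good_C:
  assumes "good k"
  shows "C k = 1 / (a (Suc k) + \<theta> k + \<xi> (Suc k))" "c_min (kcls k) (a (Suc k)) (knext k) \<le> C k"
    "C k * (a (Suc k) + 0.52) \<le> 1" "c_min (kcls k) (a (Suc k)) (knext k) > 0"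
proof -
  have k: "k \<ge> K + 10" using assms by (simp add: good_def)
  show eq: "C k = 1 / (a (Suc k) + \<theta> k + \<xi> (Suc k))" using C_eq[of "k - 1"] k by simp
  have b: "5/19 \<le> \<theta> k" "5/19 \<le> \<xi> (Suc k)" using \<theta>_range[of k] \<xi>_range[of "Suc k"] k by auto
  show "c_min (kcls k) (a (Suc k)) (knext k) \<le> C k"
    unfolding eq c_min_def using good_\<theta>[OF assms] good_\<xi>[OF assms] b
    by (intro divide_left_mono mult_pos_pos add_nonneg_pos) auto
  show "C k * (a (Suc k) + 0.52) \<le> 1" unfolding eq using b by (simp add: field_simps)
  show "c_min (kcls k) (a (Suc k)) (knext k) > 0"
    unfolding c_min_def using good_\<theta>[OF assms] good_\<xi>[OF assms] b by (intro divide_pos_pos add_nonneg_pos) auto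
qed

lemma good_slope:
  assumes "good k"
  shows "slope_le (q (k - 1)) (sp (k - 1)) (slope_bound (a (k - 1)) + 1/1000)"
    "slope_bound (a (k - 1)) + 1/1000 \<le> u_max (kcls k)" "0 \<le> u_max (kcls k)"
proof -
  show "slope_le (q (k - 1)) (sp (k - 1)) (slope_bound (a (k - 1)) + 1/1000)"
    using assms unfolding good_def by blast
  have "k \<ge> K + 10" using assms by (simp add: good_def)
  then have "a k \<in> {1,2,3}" "a (k - 1) \<in> {1,2,3}" using a_cases[of k] a_cases[of "k - 1"] by simp_all
  then show "slope_bound (a (k - 1)) + 1/1000 \<le> u_max (kcls k)" "0 \<le> u_max (kcls k)"
    by (auto simp: slope_bound_def u_max_def cls_def)
qed

text \<open>Here \<open>s * \<delta> k\<close> is at most 1/200, so the cubic term of the sine costs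
  less than the gap between 6.28 and \<open>2 * pi\<close>.\<close>

lemma good_sin:
  assumes "good k" "0 < s" "s \<le> 5"
  shows "6.28 * C k * s \<le> 2 * q k * sin (pi * (s * \<delta> k))"
proof -
  define x where "x = pi * (s * \<delta> k)"
  have d: "\<delta> k \<le> 1/1000" "\<delta> k > 0" using assms \<delta>_pos by (auto simp: good_def)
  have x0: "x > 0" unfolding x_def using assms d by simp
  have "s * \<delta> k \<le> 5 * (1/1000)" using assms d by (intro mult_mono) auto
  then have "x \<le> 4 * (5 * (1/1000))" unfolding x_def using pi_bounds assms d by (intro mult_mono) auto
  then have x2: "x\<^sup>2 \<le> 0.0004" using x0 power_mono[of x "0.02" 2] by (simp add: power2_eq_square)
  have "6.28 / (2 * pi) * x \<le> (1 - x\<^sup>2/6) * x"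
  proof (rule mult_right_mono)
    have "6.28 / (2 * pi) \<le> 6.28 / (2 * 3.1415)"
      using pi_bounds by (intro divide_left_mono) auto
    then show "6.28 / (2 * pi) \<le> 1 - x\<^sup>2/6" using x2 by simp
  qed (use x0 in auto)
  also have "(1 - x\<^sup>2/6) * x = x - x^3/6" by (simp add: power2_eq_square power3_eq_cube algebra_simps)
  also have "\<dots> \<le> sin x" using sin_ge_cubic[of x] x0 by simp
  finally have "2 * q k * (6.28 / (2 * pi) * x) \<le> 2 * q k * sin x" by (intro mult_left_mono) auto
  moreover have "2 * q k * (6.28 / (2 * pi) * x) = 6.28 * C k * s" by (simp add: x_def C_def)
  ultimately show ?thesis unfolding x_def[symmetric] by linarith
qed

lemma good_rate:
  assumes g: "good k" and j: "j \<in> {1,2,3}"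
  shows "block_rate j (\<theta> k) (slope_bound (a (k - 1)) + 1/1000) \<ge> - rate_max j (kcls k)"
proof -
  let ?c = "kcls k"
  note th = good_\<theta>[OF g]
  have m1: "th_max ?c \<le> 1" using th(3) by (auto simp: th_max_def)
  have k0: "0 \<le> kap j ?c" using th(3) j by (auto simp: kap_def)
  have le: "th_max ?c * ((2 * pi) ^ j * fact j) \<le> (j + th_max ?c) ^ (j + 1) * e3 (kap j ?c / 4) ^ 4"
  proof -
    have "(2 * pi) ^ j \<le> 6.2832 ^ j" using pi_bounds by (intro power_mono) auto
    then have "th_max ?c * ((2 * pi) ^ j * fact j) \<le> th_max ?c * (6.2832 ^ j * fact j)"
      using \<theta>_pos[of k] th by (intro mult_left_mono mult_right_mono) auto
    then show ?thesis using rate_max_check(2)[OF th(3) j] by linarith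
  qed
  have *: "(j + \<theta> k) * ((real j + 1) * ln (j + \<theta> k) - ln (\<theta> k) - ln ((2 * pi) ^ j * fact j))
      - j * \<theta> k * (slope_bound (a (k - 1)) + 1/1000)
    \<ge> - ((j + th_max ?c) * kap j ?c + j * th_max ?c * u_max ?c)"
    by (rule rate_lower[OF \<theta>_pos th(2) m1 j good_slope(2,3)[OF g] _ k0 le]) simp
  have "- rate_max j ?c \<le> - ((j + th_max ?c) * kap j ?c + j * th_max ?c * u_max ?c)"
    by (rule le_imp_neg_le[OF rate_max_check(1)[OF th(3) j]])
  from this * show ?thesis unfolding block_rate_eq by (rule order_trans)
qed

lemma e3_half_sq_le: "e3 (- x / 2) \<ge> 0 \<Longrightarrow> (e3 (- x / 2))\<^sup>2 \<le> exp (- x)"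
  using exp_ge_e3_power[of 2 "- x"] by simp

lemma regroup: "(x * y) ^ n * f * e = x ^ n * f * (y ^ n * e)" for x y f e :: real
  by (simp add: power_mult_distrib mult_ac)

text \<open>\<open>group_lower\<close> exponentiated, with \<open>C k\<close> replaced by
  \<open>c_min\<close>. The shift acts in two opposite ways: the sines at the block ends grow by
  factors \<open>1 + t / i\<close>, while the end point \<open>C = 0\<close> of the segment loses a
  sinc factor whose exponent is at most 1.\<close>

lemma group_low:
  fixes j :: nat
  assumes g: "good k" and j: "j \<in> {1,2,3}" "j \<le> a (Suc k)"
    and t: "0 \<le> t" "t < real (a (Suc k)) - j + \<xi> (Suc k)" "t \<le> 1"
    and e: "j * (C k * (real (a (Suc k)) - j + \<xi> (Suc k))) \<le> 1"
    and V: "V \<le> (6.28 * c_min (kcls k) (a (Suc k)) (knext k)) ^ j * fact j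
      * (e3 (- (c_min (kcls k) (a (Suc k)) (knext k) * rate_max j (kcls k)) / 2))\<^sup>2" "0 \<le> V"
  shows "(\<Prod>i=1..j. block k (real i + t))
    \<ge> V * (\<Prod>i=1..j. 1 + t / real i) * (1 - 1.645 * (t / (real (a (Suc k)) - j + \<xi> (Suc k)))\<^sup>2)"
proof -
  let ?c = "kcls k" and ?n = "a (Suc k)" and ?A = "real (a (Suc k)) - j + \<xi> (Suc k)" and ?R = "rate_max j (kcls k)"
  let ?C0 = "c_min (kcls k) (a (Suc k)) (knext k)"
  have k: "k \<ge> K + 10" using g by (simp add: good_def)
  have k1: "k \<ge> 1" using k by simp
  have n: "?n \<in> {1,2,3}" using k by (intro a_cases) auto
  note cl = good_\<theta>(3)[OF g]
  have A: "?A > 0" using j \<xi>_pos[of "Suc k"] by (simp add: add_nonneg_pos)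
  have iC: "(real i + t) * C k < 1" if "i \<in> {1..j}" for i
  proof -
    have "real i + t < ?n + \<xi> (Suc k)" using that t j by auto
    then have "(real i + t) * C k < (?n + \<xi> (Suc k)) * C k" using C_pos[of k] by (intro mult_strict_right_mono)
    then show ?thesis using C_less[OF k1] by linarith
  qed
  have pos: "block k (real i + t) > 0" if "i \<in> {1..j}" for i
    using that t iC by (intro block_pos) auto
  have spos: "2 * q k * sin (pi * ((real i + t) * \<delta> k)) > 0" if "i \<in> {1..j}" for i
    using that t iC[OF that] s\<delta>_less[of "real i + t" k] \<delta>_pos[of k] q_pos[of k]
    by (intro mult_pos_pos sin_pi_mult_pos) auto
  have "ln (\<Prod>i=1..j. block k (i + t)) = (\<Sum>i=1..j. ln (block k (i + t)))"
    using pos by (intro ln_prod) force+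
  also have "\<dots> \<ge> (\<Sum>i=1..j. ln (2 * q k * sin (pi * ((i + t) * \<delta> k))))
      + C k * block_rate j (\<theta> k) (slope_bound (a (k - 1)) + 1/1000) + j * (C k * ?A) * lsinc (t / ?A)"
    using group_lower[OF k1 _ j(2) good_slope(1)[OF g] t(1,2)] j by auto
  also have "(\<Sum>i=1..j. ln (2 * q k * sin (pi * ((i + t) * \<delta> k)))) = ln (\<Prod>i=1..j. 2 * q k * sin (pi * ((i + t) * \<delta> k)))"
    using spos by (intro ln_prod[symmetric]) force+
  finally have "ln (\<Prod>i=1..j. block k (i + t)) \<ge> ln (\<Prod>i=1..j. 2 * q k * sin (pi * ((i + t) * \<delta> k)))
      + C k * block_rate j (\<theta> k) (slope_bound (a (k - 1)) + 1/1000) + j * (C k * ?A) * lsinc (t / ?A)" .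
  moreover have "C k * block_rate j (\<theta> k) (slope_bound (a (k - 1)) + 1/1000) \<ge> C k * (- ?R)"
    using good_rate[OF g j(1)] C_pos[of k] by (intro mult_left_mono) auto
  ultimately have "ln (\<Prod>i=1..j. block k (i + t)) \<ge> ln (\<Prod>i=1..j. 2 * q k * sin (pi * ((i + t) * \<delta> k)))
      + - (C k * ?R) + j * (C k * ?A) * lsinc (t / ?A)" by linarith
  then have "exp (ln (\<Prod>i=1..j. block k (i + t))) \<ge> exp (ln (\<Prod>i=1..j. 2 * q k * sin (pi * ((i + t) * \<delta> k)))
      + - (C k * ?R) + j * (C k * ?A) * lsinc (t / ?A))" by simp
  moreover have "(\<Prod>i=1..j. block k (i + t)) > 0" "(\<Prod>i=1..j. 2 * q k * sin (pi * ((i + t) * \<delta> k))) > 0"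
    using pos spos by (auto intro!: prod_pos)
  ultimately have 1: "(\<Prod>i=1..j. block k (i + t)) \<ge> (\<Prod>i=1..j. 2 * q k * sin (pi * ((i + t) * \<delta> k)))
      * exp (- (C k * ?R)) * exp (j * (C k * ?A) * lsinc (t / ?A))"
    by (simp only: exp_add exp_ln)
  have 2: "(\<Prod>i=1..j. 2 * q k * sin (pi * ((i + t) * \<delta> k))) \<ge> (\<Prod>i=1..j. 6.28 * C k * (i + t))"
  proof (rule prod_mono)
    fix i assume i: "i \<in> {1..j}"
    have "real i + t \<le> 5" using i j t by auto
    then show "0 \<le> 6.28 * C k * (i + t) \<and> 6.28 * C k * (i + t) \<le> 2 * q k * sin (pi * ((i + t) * \<delta> k))"
      using good_sin[OF g, of "real i + t"] i t C_pos[of k] by auto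
  qed
  have 3: "(\<Prod>i=1..j. 6.28 * C k * (i + t)) = (6.28 * C k) ^ j * fact j * (\<Prod>i=1..j. 1 + t / i)"
  proof -
    have "(\<Prod>i=1..j. 6.28 * C k * (i + t)) = (\<Prod>i=1..j. (6.28 * C k) * real i * (1 + t / i))"
      by (intro prod.cong refl) (auto simp: field_simps)
    also have "\<dots> = (6.28 * C k) ^ j * (\<Prod>i=1..j. real i) * (\<Prod>i=1..j. 1 + t / i)"
      by (simp only: prod.distrib prod_constant card_atLeastAtMost power_mult_distrib) simp
    also have "(\<Prod>i=1..j. real i) = fact j" by (simp add: fact_prod)
    finally show ?thesis .
  qed
  have T: "(\<Prod>i=1..j. 1 + t / real i) \<ge> 0" using t by (intro prod_nonneg) auto
  have 4: "(6.28 * C k) ^ j * fact j * exp (- (C k * ?R)) \<ge> V"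
  proof -
    have "?R \<le> j * (j + 0.52)" using low_check(6)[OF cl j(1)] .
    also have "\<dots> \<le> j * (?n + 0.52)" using j by (intro mult_left_mono) auto
    finally have "C k * ?R \<le> C k * (j * (?n + 0.52))" using C_pos[of k] by (intro mult_left_mono) auto
    also have "\<dots> \<le> j * 1" using good_C(3)[OF g] mult_left_mono[OF good_C(3)[OF g], of "real j"] by (simp add: mult_ac)
    finally have CR: "C k * ?R \<le> real j" by simp
    have R0: "0 \<le> ?R" using cl j by (auto simp: rate_max_def)
    have "V \<le> (6.28 * ?C0) ^ j * fact j * exp (- (?C0 * ?R))"
    proof -
      have "(e3 (- (?C0 * ?R) / 2))\<^sup>2 \<le> exp (- (?C0 * ?R))"
        using low_check(5)[OF cl n _ j(2)] j by (intro e3_half_sq_le) auto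
      then have "(6.28 * ?C0) ^ j * fact j * (e3 (- (?C0 * ?R) / 2))\<^sup>2 \<le> (6.28 * ?C0) ^ j * fact j * exp (- (?C0 * ?R))"
        using good_C(4)[OF g] by (intro mult_left_mono) auto
      with V(1) show ?thesis by (rule order_trans)
    qed
    also have "\<dots> = 6.28 ^ j * fact j * (?C0 ^ j * exp (- (?C0 * ?R)))" by (rule regroup)
    also have "\<dots> \<le> 6.28 ^ j * fact j * (C k ^ j * exp (- (C k * ?R)))"
      using power_exp_mono[OF good_C(4)[OF g] good_C(2)[OF g] R0 CR] by (intro mult_left_mono) auto
    finally show ?thesis unfolding regroup .
  qed
  have 5: "exp (j * (C k * ?A) * lsinc (t / ?A)) \<ge> 1 - 1.645 * (t / ?A)\<^sup>2"
    using t A e C_pos[of k] by (intro exp_lsinc_ge) auto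
  have "V * (\<Prod>i=1..j. 1 + t / i) * (1 - 1.645 * (t / ?A)\<^sup>2)
    \<le> V * (\<Prod>i=1..j. 1 + t / i) * exp (j * (C k * ?A) * lsinc (t / ?A))"
    using V T 5 by (intro mult_left_mono) auto
  also have "\<dots> \<le> (6.28 * C k) ^ j * fact j * exp (- (C k * ?R)) * (\<Prod>i=1..j. 1 + t / i) * exp (j * (C k * ?A) * lsinc (t / ?A))"
    using 4 T by (intro mult_right_mono) auto
  also have "\<dots> = (\<Prod>i=1..j. 6.28 * C k * (i + t)) * exp (- (C k * ?R)) * exp (j * (C k * ?A) * lsinc (t / ?A))"
    unfolding 3 by (simp add: mult_ac)
  also have "\<dots> \<le> (\<Prod>i=1..j. 2 * q k * sin (pi * ((i + t) * \<delta> k))) * exp (- (C k * ?R)) * exp (j * (C k * ?A) * lsinc (t / ?A))"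
    using 2 by (intro mult_right_mono) auto
  finally show ?thesis using 1 by (rule order_trans)
qed

end

section \<open>Products of one digit: negative shifts and the telescoping full digit\<close>

definition many_low :: "nat \<Rightarrow> nat \<Rightarrow> nat \<Rightarrow> bool \<Rightarrow> real" where
  "many_low j c n r = (if j = 1 then one_low c n r else if j = 2 then two_low c n r else three_low c r)"

lemma many_low_ge_1: "c \<in> {0,1,2,3,4} \<Longrightarrow> n \<in> {1,2,3} \<Longrightarrow> j \<in> {1,2,3} \<Longrightarrow> j \<le> n \<Longrightarrow> many_low j c n r \<ge> 1"
  by (cases r) (auto simp: many_low_def one_low_def two_low_def three_low_def)

lemma first_low_1: "c \<in> {0,1,2,3,4} \<Longrightarrow> first_low c (Suc 0) r = one_low c (Suc 0) r"
  by (cases r) (auto simp: first_low_def one_low_def)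

lemma first_low_ge_1: "c \<in> {0,1,2,3,4} \<Longrightarrow> n \<in> {1,2,3} \<Longrightarrow> first_low c n r \<ge> 1"
  by (cases r) (auto simp: first_low_def)

lemma e3_nonneg: "- 1 \<le> x \<Longrightarrow> x \<le> 0 \<Longrightarrow> e3 x \<ge> 0"
proof -
  assume x: "- 1 \<le> x" "x \<le> 0"
  then have "x\<^sup>2 * (1/2 + x/6) \<ge> 0" by (intro mult_nonneg_nonneg) auto
  with x have "(1 + x) + x\<^sup>2 * (1/2 + x/6) \<ge> 0" by linarith
  then show ?thesis by (simp add: e3_def power2_eq_square power3_eq_cube algebra_simps)
qed

context sudler_cfrac begin

lemma level_shift: "(-1) ^ k * (real (q k) * \<alpha>) = \<delta> k + of_int (sp k)"
  by (simp add: \<delta>_def sp_def algebra_simps)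

text \<open>Each further multiple of \<open>q k\<close> increases the signed shift by
  \<open>\<delta> k\<close> modulo 1, that is, by one unit.\<close>

lemma prod_digit:
  assumes k: "k \<ge> 1" and t: "-1 < t" "(real b + t) * C k < 1" and \<sigma>: "(-1) ^ k * \<sigma> - \<delta> k * t \<in> \<int>"
  shows "(\<Prod>r=1..b * q k. 2 * \<bar>sin (pi * (real r * \<alpha> + \<sigma>))\<bar>) = (\<Prod>i=1..b. block k (real i + t))"
proof -
  have "(\<Prod>r=1..b * q k. 2 * \<bar>sin (pi * (real r * \<alpha> + \<sigma>))\<bar>)
    = (\<Prod>i<b. \<Prod>r=1..q k. 2 * \<bar>sin (pi * (real (i * q k + r) * \<alpha> + \<sigma>))\<bar>)"
    by (rule prod_blocks)
  also have "\<dots> = (\<Prod>i<b. block k (real (Suc i) + t))"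
  proof (intro prod.cong refl)
    fix i assume "i \<in> {..<b}"
    then have i: "real (Suc i) \<le> real b" by simp
    have "(real (Suc i) + t) * C k \<le> (real b + t) * C k" using i C_pos[of k] by (intro mult_right_mono) auto
    then have iC: "(real (Suc i) + t) * C k < 1" using t by linarith
    have "(-1) ^ k * (real i * (real (q k) * \<alpha>) + \<sigma>) - \<delta> k * (real (Suc i) + t - 1)
      = real i * ((-1) ^ k * (real (q k) * \<alpha>)) + (-1) ^ k * \<sigma> - \<delta> k * (real i + t)"
      by (simp add: algebra_simps)
    also have "\<dots> = ((-1) ^ k * \<sigma> - \<delta> k * t) + of_int (int i * sp k)"
      unfolding level_shift by (simp add: algebra_simps)
    also have "\<dots> \<in> \<int>" using \<sigma> by (intro Ints_add) auto
    finally have "(\<Prod>r=1..q k. 2 * \<bar>sin (pi * (real r * \<alpha> + (real i * (real (q k) * \<alpha>) + \<sigma>)))\<bar>)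
      = block k (real (Suc i) + t)"
      using t iC by (intro prod_block[OF k]) auto
    moreover have "real (i * q k + r) * \<alpha> + \<sigma> = real r * \<alpha> + (real i * (real (q k) * \<alpha>) + \<sigma>)" for r
      by (simp add: algebra_simps)
    ultimately show "(\<Prod>r=1..q k. 2 * \<bar>sin (pi * (real (i * q k + r) * \<alpha> + \<sigma>))\<bar>) = block k (real (Suc i) + t)"
      by (simp only:)
  qed
  also have "\<dots> = (\<Prod>i=1..b. block k (real i + t))" by (simp only: One_nat_def prod.atLeast1_atMost_eq)
  finally show ?thesis .
qed

lemma ln_prod_block_concave:
  assumes k: "k \<ge> 1" and s: "-1 < s" "(real m + s) * C k < 1" and s': "-1 < s'" "(real m + s') * C k < 1"
    and l: "0 \<le> l" "l \<le> 1"
  shows "ln (\<Prod>i=1..m. block k (real i + (l * s + (1 - l) * s')))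
    \<ge> l * ln (\<Prod>i=1..m. block k (real i + s)) + (1 - l) * ln (\<Prod>i=1..m. block k (real i + s'))"
    and "(\<Prod>i=1..m. block k (real i + s)) > 0"
proof -
  have dom: "0 < real i + u \<and> (real i + u) * C k < 1" if "i \<in> {1..m}" "-1 < u" "(real m + u) * C k < 1" for i u
  proof -
    have "(real i + u) * C k \<le> (real m + u) * C k" using that C_pos[of k] by (intro mult_right_mono) auto
    then show ?thesis using that by auto
  qed
  have pos: "block k (real i + u) > 0" if "i \<in> {1..m}" "-1 < u" "(real m + u) * C k < 1" for i u
    using dom[OF that] by (intro block_pos) auto
  have ln: "ln (\<Prod>i=1..m. block k (real i + u)) = (\<Sum>i=1..m. ln (block k (real i + u)))"
    if "-1 < u" "(real m + u) * C k < 1" for u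
    using pos that by (intro ln_prod) force+
  show "(\<Prod>i=1..m. block k (real i + s)) > 0" using pos s by (intro prod_pos) auto
  define u where "u = l * s + (1 - l) * s'"
  have u: "-1 < u" "(real m + u) * C k < 1"
  proof -
    have "u \<ge> min s s'" "u \<le> max s s'" unfolding u_def
      using l convex_bound_le[of s "max s s'" s' l "1 - l"] convex_bound_le[of "- s" "- min s s'" "- s'" l "1 - l"] by auto
    then have "-1 < u" and le: "u \<le> max s s'" using s s' by auto
    then show "-1 < u" by simp
    have "(real m + u) * C k \<le> (real m + max s s') * C k" using le C_pos[of k] by (intro mult_right_mono) auto
    then show "(real m + u) * C k < 1" using s s' by (auto simp: max_def split: if_splits)
  qed
  have "l * (\<Sum>i=1..m. ln (block k (real i + s))) + (1 - l) * (\<Sum>i=1..m. ln (block k (real i + s')))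
    = (\<Sum>i=1..m. l * ln (block k (real i + s)) + (1 - l) * ln (block k (real i + s')))"
    by (simp add: sum_distrib_left sum.distrib)
  also have "\<dots> \<le> (\<Sum>i=1..m. ln (block k (real i + u)))"
  proof (rule sum_mono)
    fix i assume i: "i \<in> {1..m}"
    have "real i + u = l * (real i + s) + (1 - l) * (real i + s')" by (simp add: u_def algebra_simps)
    then show "l * ln (block k (real i + s)) + (1 - l) * ln (block k (real i + s')) \<le> ln (block k (real i + u))"
      using ln_block_concave[OF k _ _ _ _ l, of "real i + s" "real i + s'"] dom[OF i s] dom[OF i s'] by auto
  qed
  finally show "ln (\<Prod>i=1..m. block k (real i + (l * s + (1 - l) * s')))
    \<ge> l * ln (\<Prod>i=1..m. block k (real i + s)) + (1 - l) * ln (\<Prod>i=1..m. block k (real i + s'))"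
    using ln u s s' by (simp add: u_def)
qed

text \<open>With shift \<open>v - 1\<close>, the first block loses at most the factor
  \<open>v\<close> by \<open>block_scale\<close>. The other \<open>m\<close> blocks sit at shifts
  between 0 and 1, where the logarithm of their product is concave; \<open>X\<close> bounds the
  whole at both ends.\<close>

lemma prod_block_negative:
  assumes k: "k \<ge> 1" and m: "Suc m \<le> a (Suc k)" and v: "0 < v" "v \<le> 1" and X: "0 < X"
    "X \<le> block k 1 * (\<Prod>i=1..m. block k (real i))" "X \<le> (\<Prod>i=1..Suc m. block k (real i))"
  shows "(\<Prod>i=1..Suc m. block k (real i + (v - 1))) \<ge> v * X"
proof -
  have mC: "(real m + u) * C k < 1" if "u \<le> 1" for u
  proof -
    have "(real m + u) * C k \<le> (a (Suc k) + \<xi> (Suc k)) * C k"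
      using that m C_pos[of k] \<xi>_pos[of "Suc k"] by (intro mult_right_mono) auto
    then show ?thesis using C_less[OF k] by simp
  qed
  have B1: "block k 1 > 0" using C_less_1[OF k] by (intro block_pos) auto
  have split: "(\<Prod>i=1..Suc m. f (real i)) = f 1 * (\<Prod>i=1..m. f (real i + 1))" for f :: "real \<Rightarrow> real"
    unfolding One_nat_def prod.atLeast1_atMost_eq by (subst prod.lessThan_Suc_shift) (simp add: add.commute)
  note c = ln_prod_block_concave[OF k, of 1 m 0 v]
  have P: "(\<Prod>i=1..m. block k (real i + 1)) > 0" "(\<Prod>i=1..m. block k (real i)) > 0" "(\<Prod>i=1..m. block k (real i + v)) > 0"
    using mC[of 1] mC[of 0] mC[of v] v ln_prod_block_concave(2)[OF k, of 0 m 0 0] ln_prod_block_concave(2)[OF k, of v m v 0]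
      ln_prod_block_concave(2)[OF k, of 1 m 1 0] by auto
  have "ln X = v * ln X + (1 - v) * ln X" by (simp add: algebra_simps)
  also have "\<dots> \<le> v * ln (block k 1 * (\<Prod>i=1..m. block k (real i + 1))) + (1 - v) * ln (block k 1 * (\<Prod>i=1..m. block k (real i)))"
    using X v P B1 split[of "block k"] by (intro add_mono mult_left_mono ln_mono) auto
  also have "\<dots> = ln (block k 1) + (v * ln (\<Prod>i=1..m. block k (real i + 1)) + (1 - v) * ln (\<Prod>i=1..m. block k (real i)))"
    using P B1 by (simp add: ln_mult_pos algebra_simps)
  also have "\<dots> \<le> ln (block k 1) + ln (\<Prod>i=1..m. block k (real i + v))"
    using c mC[of 1] mC[of 0] v by simp
  also have "\<dots> = ln (block k 1 * (\<Prod>i=1..m. block k (real i + v)))" using P B1 by (simp add: ln_mult_pos)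
  finally have le: "X \<le> block k 1 * (\<Prod>i=1..m. block k (real i + v))" using X P B1 by (simp add: ln_le_cancel_iff)
  have "v * X \<le> (v * block k 1) * (\<Prod>i=1..m. block k (real i + v))" using le v by (simp add: mult.assoc)
  also have "\<dots> \<le> block k v * (\<Prod>i=1..m. block k (real i + v))"
    using block_scale[OF k, of v 1] v C_less_1[OF k] P by (intro mult_right_mono) auto
  also have "\<dots> = (\<Prod>i=1..Suc m. block k (real i + (v - 1)))"
    using split[of "\<lambda>x. block k (x + (v - 1))"] by (simp add: add.assoc)
  finally show ?thesis .
qed

lemma convergent_log_upper:
  assumes "k \<ge> 1" "slope_le (q k) (sp k) U"
  shows "block_log (q k) (sp k) (C k) (C k / 2) \<le> ln (q k) + U * C k"
proof -
  have "block_log (q k) (sp k) (C k) (C k / 2) \<le> block_log (q k) (sp k) (C k) 0"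
    using C_less_1[OF assms(1)] C_pos[of k] by (intro block_log_antimono_abs[OF coprime_sp q_pos]) auto
  also have "\<dots> \<le> ln (q k) + U * C k"
    using assms C_less_1[OF assms(1)] C_pos[of k] by (auto simp: slope_le_def)
  finally show ?thesis .
qed

lemma prod_convergent:
  "k \<ge> 1 \<Longrightarrow> (\<Prod>r=1..<q k. 2 * \<bar>sin (pi * (real r * \<alpha>))\<bar>) = exp (block_log (q k) (sp k) (C k) (C k / 2))"
  using prod_block_lower[of k 1 0] C_less_1[of k] by simp

lemma prod_reflect:
  fixes N M :: nat
  assumes "M < N"
  shows "(\<Prod>r=1..M. 2 * \<bar>sin (pi * (real r * \<alpha> - real N * \<alpha>))\<bar>) = (\<Prod>r=N-M..<N. 2 * \<bar>sin (pi * (real r * \<alpha>))\<bar>)"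
proof (rule prod.reindex_bij_witness[of _ "\<lambda>r. N - r" "\<lambda>r. N - r"])
  fix r assume r: "r \<in> {1..M}"
  then have "real (N - r) = real N - real r" using assms by (auto simp: of_nat_diff)
  then have "pi * (real (N - r) * \<alpha>) = - (pi * (real r * \<alpha> - real N * \<alpha>))" by (simp add: algebra_simps)
  then show "2 * \<bar>sin (pi * (real (N - r) * \<alpha>))\<bar> = 2 * \<bar>sin (pi * (real r * \<alpha> - real N * \<alpha>))\<bar>"
    by (simp only: sin_minus abs_minus_cancel)
qed (use assms in auto)

lemma shift_convergent: "(-1) ^ k * (- (real (q (Suc k)) * \<alpha>)) - \<delta> k * \<xi> (Suc k) \<in> \<int>"
proof -
  have "\<delta> k * \<xi> (Suc k) = \<delta> (Suc k)" using \<delta>_pos[of k] by (simp add: \<xi>_def)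
  then have "(-1) ^ k * (- (real (q (Suc k)) * \<alpha>)) - \<delta> k * \<xi> (Suc k) = of_int (sp (Suc k))"
    using level_shift[of "Suc k"] by simp
  then show ?thesis by (metis Ints_of_int)
qed

text \<open>The shift \<open>\<xi> (Suc k)\<close> is that of \<open>- q (Suc k) * \<alpha>\<close>.
  Reflection turns the digit into the factors from \<open>q (k - 1)\<close> up to
  \<open>q (Suc k) - 1\<close>, a quotient of two convergent products.\<close>

lemma prod_full_digit:
  assumes k: "k \<ge> 2"
  shows "(\<Prod>i=1..a (Suc k). block k (real i + \<xi> (Suc k)))
    = exp (block_log (q (Suc k)) (sp (Suc k)) (C (Suc k)) (C (Suc k) / 2)
        - block_log (q (k - 1)) (sp (k - 1)) (C (k - 1)) (C (k - 1) / 2))"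
proof -
  let ?g = "\<lambda>r. 2 * \<bar>sin (pi * (real r * \<alpha>))\<bar>"
  obtain k' where k': "k = Suc k'" using k by (cases k) auto
  have rec: "q (Suc k) = a (Suc k) * q k + q (k - 1)" unfolding k' using q_rec[of k'] by simp
  have "(\<Prod>i=1..a (Suc k). block k (real i + \<xi> (Suc k)))
    = (\<Prod>r=1..a (Suc k) * q k. 2 * \<bar>sin (pi * (real r * \<alpha> + - (real (q (Suc k)) * \<alpha>)))\<bar>)"
  proof (rule prod_digit[symmetric])
    show "(a (Suc k) + \<xi> (Suc k)) * C k < 1" using k by (intro C_less) auto
    show "-1 < \<xi> (Suc k)" using \<xi>_pos[of "Suc k"] by linarith
  qed (use k shift_convergent in auto)
  also have "\<dots> = (\<Prod>r=q (k - 1)..<q (Suc k). ?g r)"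
    using prod_reflect[of "a (Suc k) * q k" "q (Suc k)"] rec q_pos[of "k - 1"] by simp
  finally have "(\<Prod>r=1..<q (k - 1). ?g r) * (\<Prod>i=1..a (Suc k). block k (real i + \<xi> (Suc k))) = (\<Prod>r=1..<q (Suc k). ?g r)"
    using prod.atLeastLessThan_concat[of 1 "q (k - 1)" "q (Suc k)" ?g] q_pos[of "k - 1"] rec by simp
  then show ?thesis
    using prod_convergent[of "Suc k"] prod_convergent[of "k - 1"] k by (simp add: exp_diff field_simps)
qed

end

context sudler_small begin

lemma good_ge: "good k \<Longrightarrow> k \<ge> K + 10" by (simp add: good_def)

lemma good_digits:
  assumes "good k"
  shows "a (k - 1) \<in> {1,2,3}" "a k \<in> {1,2,3}" "a (Suc k) \<in> {1,2,3}"
  using good_ge[OF assms] a_cases by auto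

lemma good_group:
  fixes j :: nat
  assumes g: "good k" and j: "j \<in> {1,2,3}" "j \<le> a (Suc k)"
    and t: "0 \<le> t" "t < real (a (Suc k)) - j + \<xi> (Suc k)" "t \<le> 1"
  shows "(\<Prod>i=1..j. block k (real i + t))
    \<ge> many_low j (kcls k) (a (Suc k)) (knext k) * (\<Prod>i=1..j. 1 + t / real i)
       * (1 - 1.645 * (t / (real (a (Suc k)) - j + \<xi> (Suc k)))\<^sup>2)"
proof (rule group_low[OF g j t])
  let ?n = "a (Suc k)"
  note n = good_digits(3)[OF g] and c = good_\<theta>(3)[OF g]
  have x: "0 < \<xi> (Suc k)" "\<xi> (Suc k) < 1" using \<xi>_pos \<xi>_less_1[of "Suc k"] by auto
  have "real j * (real ?n - j + \<xi> (Suc k)) \<le> ?n + \<xi> (Suc k)" using n j x by auto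
  then have "real j * (real ?n - j + \<xi> (Suc k)) * C k \<le> (?n + \<xi> (Suc k)) * C k"
    using C_pos[of k] by (intro mult_right_mono) auto
  also have "\<dots> \<le> 1" using C_less[of k] good_ge[OF g] by simp
  finally show "j * (C k * (real ?n - j + \<xi> (Suc k))) \<le> 1" by (simp add: mult_ac)
  show "0 \<le> many_low j (kcls k) ?n (knext k)" using many_low_ge_1[OF c n j, of "knext k"] by linarith
  consider "j = 1" | "j = 2" "?n \<in> {2,3}" | "j = 3" "?n = 3" using j n by auto
  then show "many_low j (kcls k) ?n (knext k) \<le> (6.28 * c_min (kcls k) ?n (knext k)) ^ j * fact j
      * (e3 (- (c_min (kcls k) ?n (knext k) * rate_max j (kcls k)) / 2))\<^sup>2"
  proof cases
    case 1 then show ?thesis using low_check(1)[OF c n, of "knext k"] by (simp add: many_low_def)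
  next
    case 2 then show ?thesis using low_check(3)[OF c 2(2), of "knext k"] by (simp add: many_low_def)
  next
    case 3 then show ?thesis using low_check(4)[OF c, of "knext k"] by (simp add: many_low_def fact_numeral)
  qed
qed

lemma good_first:
  assumes g: "good k"
  shows "block k 1 \<ge> first_low (kcls k) (a (Suc k)) (knext k)"
proof (cases "a (Suc k) = 1")
  case True
  then show ?thesis using good_group[OF g, of 1 0] first_low_1[OF good_\<theta>(3)[OF g]] \<xi>_pos[of "Suc k"]
    by (simp add: many_low_def)
next
  case False
  let ?c = "kcls k" and ?R = "rate_max 0 (kcls k)" and ?n = "a (Suc k)"
  let ?C0 = "c_min (kcls k) (a (Suc k)) (knext k)"
  have n: "?n \<in> {2,3}" "?n \<in> {1,2,3}" using False good_digits(3)[OF g] by auto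
  have a2: "2 \<le> a (Suc k)" using n by auto
  have k1: "k \<ge> 1" using good_ge[OF g] by simp
  note c = good_\<theta>(3)[OF g]
  have m1: "th_max ?c \<le> 1" "0 \<le> kap 0 ?c" "0 \<le> ?R" using c by (auto simp: th_max_def kap_def rate_max_def)
  have "(2 * pi)\<^sup>2 \<le> 6.2832\<^sup>2" using pi_bounds by (intro power_mono) auto
  then have "th_max ?c * (2 * pi)\<^sup>2 \<le> th_max ?c * 6.2832\<^sup>2"
    using \<theta>_pos[of k] good_\<theta>(2)[OF g] by (intro mult_left_mono) auto
  then have le: "th_max ?c * (2 * pi)\<^sup>2 \<le> (real 2 + th_max ?c) ^ (2 + 1) * e3 (kap 0 ?c / 4) ^ 4"
    using rate_max_check(4)[OF c] by simp
  have "(real 2 + \<theta> k) * ((real 2 + 1) * ln (real 2 + \<theta> k) - ln (\<theta> k) - ln ((2 * pi)\<^sup>2)) - real 2 * \<theta> k * (slope_bound (a (k - 1)) + 1/1000)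
    \<ge> - ((real 2 + th_max ?c) * kap 0 ?c + real 2 * th_max ?c * u_max ?c)"
    by (rule rate_lower[OF \<theta>_pos good_\<theta>(2)[OF g] m1(1) _ good_slope(2,3)[OF g] _ m1(2) le]) auto
  then have "(2 + \<theta> k) * (3 * ln (2 + \<theta> k) - ln (\<theta> k) - 2 * ln (2 * pi)) - 2 * \<theta> k * (slope_bound (a (k - 1)) + 1/1000) \<ge> - (2 * ?R)"
    using rate_max_check(3)[OF c] ln_realpow[of "2 * pi" 2] by simp
  then have "C k / 2 * ((2 + \<theta> k) * (3 * ln (2 + \<theta> k) - ln (\<theta> k) - 2 * ln (2 * pi)) - 2 * \<theta> k * (slope_bound (a (k - 1)) + 1/1000)) \<ge> C k / 2 * (- (2 * ?R))"
    using C_pos[of k] by (intro mult_left_mono) auto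
  then have L: "ln (block k 1) \<ge> ln (2 * q k * sin (pi * \<delta> k)) + - (C k * ?R)"
    using block_1_lower[OF k1 a2 good_slope(1)[OF g]] by linarith
  have s: "2 * q k * sin (pi * \<delta> k) \<ge> 6.28 * C k" using good_sin[OF g, of 1] by simp
  moreover have "0 < 6.28 * C k" using C_pos[of k] by simp
  ultimately have s0: "2 * q k * sin (pi * \<delta> k) > 0" by (rule less_le_trans[rotated])
  have B: "block k 1 > 0" using C_less_1[OF k1] by (intro block_pos) auto
  have CR: "C k * ?R \<le> real 1"
  proof -
    have "C k * ?R \<le> C k * (?n + 0.52)" using low_check(7)[OF c] n C_pos[of k] by (intro mult_left_mono) auto
    then show ?thesis using good_C(3)[OF g] by simp
  qed
  have "first_low ?c ?n (knext k) \<le> 6.28 * ?C0 * (e3 (- (?C0 * ?R) / 2))\<^sup>2" by (rule low_check(2)[OF c n(1)])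
  also have "\<dots> \<le> 6.28 * ?C0 * exp (- (?C0 * ?R))"
    using low_check(5)[OF c n(2), of 0 "knext k"] good_C(4)[OF g] by (intro mult_left_mono e3_half_sq_le) auto
  also have "\<dots> \<le> 6.28 * C k * exp (- (C k * ?R))"
    using power_exp_mono[OF good_C(4)[OF g] good_C(2)[OF g] m1(3) CR] by simp
  also have "\<dots> \<le> 2 * q k * sin (pi * \<delta> k) * exp (- (C k * ?R))" using s by (intro mult_right_mono) auto
  also have "\<dots> = exp (ln (2 * q k * sin (pi * \<delta> k)) + - (C k * ?R))" using s0 by (simp only: exp_add exp_ln)
  also have "\<dots> \<le> exp (ln (block k 1))" using L by simp
  also have "\<dots> = block k 1" using B by simp
  finally show ?thesis .
qed

lemma convergent_log_lower:
  assumes g: "good k"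
  shows "block_log (q k) (sp k) (C k) (C k / 2) \<ge> ln (q k) - C k * rate_max 1 (kcls k)"
proof -
  have k1: "k \<ge> 1" using good_ge[OF g] by simp
  have a1: "1 \<le> a (Suc k)" using a_pos by simp
  have C1: "1 * C k < 1" using C_less_1[OF k1] by simp
  have s: "sin (pi * \<delta> k) > 0" using \<delta>_pos[of k] s\<delta>_less[OF C1] by (intro sin_pi_mult_pos) auto
  have x: "0 < real (a (Suc k)) - real 1 + \<xi> (Suc k)" using a1 \<xi>_pos[of "Suc k"] by simp
  have "ln (block k 1) \<ge> ln (2 * q k * sin (pi * \<delta> k)) + C k * block_rate 1 (\<theta> k) (slope_bound (a (k - 1)) + 1/1000)"
    using group_lower[OF k1 order_refl a1 good_slope(1)[OF g] order_refl x] by (simp add: lsinc_def)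
  moreover have "ln (block k 1) = ln (2 * sin (pi * \<delta> k)) + block_log (q k) (sp k) (C k) (C k / 2)"
    using ln_block[OF _ C1] by simp
  moreover have "ln (2 * q k * sin (pi * \<delta> k)) = ln (q k) + ln (2 * sin (pi * \<delta> k))"
  proof -
    have "2 * q k * sin (pi * \<delta> k) = q k * (2 * sin (pi * \<delta> k))" by simp
    then show ?thesis using q_pos[of k] s by (simp only: ln_mult_pos)
  qed
  moreover have "C k * block_rate 1 (\<theta> k) (slope_bound (a (k - 1)) + 1/1000) \<ge> C k * (- rate_max 1 (kcls k))"
    using good_rate[OF g, of 1] C_pos[of k] by (intro mult_left_mono) auto
  ultimately show ?thesis by simp
qed

text \<open>\<open>Y1\<close> and \<open>Y2\<close> bound from below
  \<open>1 / C (Suc k) = 1 / \<xi> (Suc k) + \<theta> (Suc k)\<close> and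
  \<open>1 / C (k - 1) = 1 / \<theta> k + \<xi> k\<close>. The upper convergent product is bounded
  below by its rate, the lower one above by its slope, and the quotient of denominators is
  \<open>1 + a (Suc k) / \<theta> k\<close>.\<close>

lemma good_full:
  assumes g: "good k"
  shows "(\<Prod>i=1..a (Suc k). block k (real i + \<xi> (Suc k))) \<ge> xi_low (a (k - 1)) (a k) (a (Suc k)) (knext k)"
proof -
  let ?n = "a (Suc k)" and ?c = "kcls k" and ?c' = "cls (a (Suc k)) (a k)" and ?r = "knext k"
  define Y1 where "Y1 = 1 / xi_max ?r + th_min ?c'"
  define Y2 where "Y2 = 1 / th_max ?c + 1 / (?n + xi_max ?r)"
  define R where "R = rate_max 1 ?c'"
  define U where "U = slope_bound (a (k - 1)) + 1/1000"
  have k: "k \<ge> K + 10" using good_ge[OF g] .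
  have gS: "good (Suc k)" by (rule good_mono[OF g]) simp
  note th = good_\<theta>[OF g] and xi = good_\<xi>[OF g]
  have th': "th_min ?c' \<le> \<theta> (Suc k)" "\<theta> (Suc k) \<le> th_max ?c'" "?c' \<in> {0,1,2,3,4}" using good_\<theta>[OF gS] by simp_all
  note dg = good_digits[OF g]
  have xp: "\<xi> (Suc k) > 0" "\<theta> k > 0" using \<xi>_pos \<theta>_pos by auto
  have U0: "0 \<le> U" "U \<le> 0.707" using dg by (auto simp: U_def slope_bound_def)
  have R0: "0 \<le> R" "R \<le> 1.52" using low_check(6)[OF th'(3), of 1] th'(3) by (auto simp: R_def rate_max_def)
  have X1: "xi_max ?r > 0" "1 / xi_max ?r \<ge> 1.26" by (auto simp: xi_max_def)
  have T1: "th_max ?c > 0" "1 / th_max ?c \<ge> 1.26" using th(3) by (auto simp: th_max_def)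
  have T2: "th_min ?c' \<ge> 0.26" using th'(3) by (auto simp: th_min_def)
  have Y: "Y1 \<ge> 1.52" "Y2 \<ge> 1.26" using X1 T1 T2 by (auto simp: Y1_def Y2_def add_increasing2)
  have C1: "C (Suc k) \<le> 1 / Y1"
  proof -
    have "1 / xi_max ?r \<le> 1 / \<xi> (Suc k)" using xi xp by (intro divide_left_mono) auto
    then have "Y1 \<le> 1 / \<xi> (Suc k) + \<theta> (Suc k)" using th' by (simp add: Y1_def)
    also have "1 / \<xi> (Suc k) = a (Suc (Suc k)) + \<xi> (Suc (Suc k))" using \<xi>_eq[of k] by simp
    finally have "Y1 \<le> a (Suc (Suc k)) + \<theta> (Suc k) + \<xi> (Suc (Suc k))" by simp
    then show ?thesis unfolding C_eq using Y by (intro divide_left_mono) auto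
  qed
  have C2: "C (k - 1) \<le> 1 / Y2"
  proof -
    have e: "C (k - 1) = 1 / (a k + \<theta> (k - 1) + \<xi> k)" "\<xi> k = 1 / (?n + \<xi> (Suc k))"
    proof -
      have e: "Suc (k - 2) = k - 1" "Suc (k - 1) = k" "Suc (Suc (k - 2)) = k" using k by auto
      show "C (k - 1) = 1 / (a k + \<theta> (k - 1) + \<xi> k)" using C_eq[of "k - 2"] unfolding e .
      show "\<xi> k = 1 / (?n + \<xi> (Suc k))" using \<xi>_eq[of "k - 1"] unfolding e .
    qed
    have "1 / \<theta> k = a k + \<theta> (k - 1)" using \<theta>_eq'[of k] k by simp
    moreover have "1 / th_max ?c \<le> 1 / \<theta> k" using th xp by (intro divide_left_mono) auto
    moreover have "1 / (?n + xi_max ?r) \<le> \<xi> k" unfolding e(2) using xi xp by (intro divide_left_mono) auto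
    ultimately have "Y2 \<le> a k + \<theta> (k - 1) + \<xi> k" unfolding Y2_def by linarith
    then show ?thesis unfolding e(1) using Y by (intro divide_left_mono) auto
  qed
  have E: "exp (- (R / Y1 + U / Y2)) \<ge> (e3 (- (R / Y1 + U / Y2) / 2))\<^sup>2"
  proof (rule e3_half_sq_le, rule e3_nonneg)
    have "R / Y1 \<le> 1" using R0 Y by simp
    moreover have "U / Y2 \<le> 1" using U0 Y by simp
    moreover have "0 \<le> R / Y1" "0 \<le> U / Y2" using R0 U0 Y by auto
    ultimately show "- 1 \<le> - (R / Y1 + U / Y2) / 2" "- (R / Y1 + U / Y2) / 2 \<le> 0" by auto
  qed
  have qq: "real (q (Suc k)) / q (k - 1) \<ge> 1 + ?n / th_max ?c"
  proof -
    have "real (q (Suc k)) / q (k - 1) = 1 + ?n / \<theta> k"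
      using q_rec[of "k - 1"] q_pos[of "k - 1"] k by (simp add: \<theta>_def field_simps)
    moreover have "?n / th_max ?c \<le> ?n / \<theta> k" using th xp by (intro divide_left_mono) auto
    ultimately show ?thesis by simp
  qed
  have "xi_low (a (k - 1)) (a k) ?n ?r = (1 + ?n / th_max ?c) * (e3 (- (R / Y1 + U / Y2) / 2))\<^sup>2"
    by (simp add: xi_low_def Y1_def Y2_def R_def U_def)
  also have "\<dots> \<le> (real (q (Suc k)) / q (k - 1)) * exp (- (R / Y1 + U / Y2))"
    using qq E by (intro mult_mono) auto
  also have "\<dots> \<le> (real (q (Suc k)) / q (k - 1)) * exp (- (C (Suc k) * R + U * C (k - 1)))"
  proof (intro mult_left_mono)
    have "C (Suc k) * R \<le> 1 / Y1 * R" "U * C (k - 1) \<le> U * (1 / Y2)"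
      using C1 C2 R0 U0 by (auto intro!: mult_left_mono mult_right_mono simp del: times_divide_eq_left times_divide_eq_right)
    then show "exp (- (R / Y1 + U / Y2)) \<le> exp (- (C (Suc k) * R + U * C (k - 1)))" by simp
  qed simp
  also have "\<dots> = exp ((ln (q (Suc k)) - C (Suc k) * R) - (ln (q (k - 1)) + U * C (k - 1)))"
    using q_pos[of "Suc k"] q_pos[of "k - 1"] by (simp add: exp_diff exp_add exp_minus field_simps)
  also have "\<dots> \<le> (\<Prod>i=1..?n. block k (real i + \<xi> (Suc k)))"
  proof -
    have "ln (q (Suc k)) - C (Suc k) * R \<le> block_log (q (Suc k)) (sp (Suc k)) (C (Suc k)) (C (Suc k) / 2)"
      using convergent_log_lower[OF gS] by (simp add: R_def)
    moreover have "block_log (q (k - 1)) (sp (k - 1)) (C (k - 1)) (C (k - 1) / 2) \<le> ln (q (k - 1)) + U * C (k - 1)"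
      using k good_slope(1)[OF g] unfolding U_def by (intro convergent_log_upper) auto
    ultimately show ?thesis using prod_full_digit[of k] k by simp
  qed
  finally show ?thesis .
qed

end

text \<open>The worst case is \<open>v = h\<close>, \<open>R = 1\<close>: a smaller \<open>v\<close>
  is made up by \<open>R\<close>, and for a larger one \<open>v * (1 - z * v)\<close> increases on
  [0, 1] because \<open>z \<le> 1/2\<close>.\<close>

lemma scaled_quadratic_ge:
  fixes R v h z :: real
  assumes "R * v \<ge> h" "R \<ge> 1" "0 < v" "v \<le> 1" "0 \<le> z" "z \<le> 1/2" "0 \<le> h" "h \<le> 1"
  shows "R * v * (1 - z * v) \<ge> h * (1 - z * h)"
proof (cases "v \<le> h")
  case True
  have "z * v \<le> 1/2 * 1" using assms by (intro mult_mono) auto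
  then have "h * (1 - z * v) \<le> R * v * (1 - z * v)" using assms by (intro mult_right_mono) auto
  moreover have "h * (1 - z * h) \<le> h * (1 - z * v)" using True assms by (intro mult_left_mono diff_left_mono) auto
  ultimately show ?thesis by linarith
next
  case False
  have zv: "z * v \<le> 1/2 * 1" "z * (v + h) \<le> 1/2 * 2" using assms by (intro mult_mono; simp)+
  have "v * (1 - z * v) - h * (1 - z * h) = (v - h) * (1 - z * (v + h))" by (simp add: algebra_simps)
  moreover have "(v - h) * (1 - z * (v + h)) \<ge> 0" using False zv by (intro mult_nonneg_nonneg) auto
  moreover have "1 * v * (1 - z * v) \<le> R * v * (1 - z * v)" using assms zv by (intro mult_right_mono) auto
  ultimately show ?thesis by linarith
qed

lemma sq_ratio_le:
  fixes t b :: real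
  assumes "0 \<le> t" "1 + t \<le> b"
  shows "(1 + t) * (t / b)\<^sup>2 \<le> t * (t / (1 + t))" "(t / b)\<^sup>2 \<le> (t / (1 + t))\<^sup>2"
proof -
  have "t / b \<le> t / (1 + t)" using assms by (intro divide_left_mono) auto
  then show le: "(t / b)\<^sup>2 \<le> (t / (1 + t))\<^sup>2" using assms by (intro power_mono) auto
  have "(1 + t) * (t / b)\<^sup>2 \<le> (1 + t) * (t / (1 + t))\<^sup>2" using le assms by (intro mult_left_mono) auto
  also have "\<dots> = t * (t / (1 + t))" using assms by (simp add: power2_eq_square)
  finally show "(1 + t) * (t / b)\<^sup>2 \<le> t * (t / (1 + t))" .
qed

text \<open>The sine gain \<open>1 + t\<close> beats the sinc loss since
  \<open>t / (1 + t) \<le> 19/43\<close>.\<close>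

lemma one_shift_ge:
  fixes t b :: real
  assumes "0 \<le> t" "t \<le> 19/24" "1 + t \<le> b"
  shows "(1 + t) * (1 - 1.645 * (t / b)\<^sup>2) \<ge> 1 + 0.27 * t"
proof -
  have "t / (1 + t) \<le> 0.443" using assms by (simp add: divide_le_eq)
  then have "t * (t / (1 + t)) \<le> t * 0.443" using assms by (intro mult_left_mono) auto
  then have "1.645 * ((1 + t) * (t / b)\<^sup>2) \<le> 0.73 * t" using sq_ratio_le(1)[of t b] assms by simp
  moreover have e: "(1 + t) * (1 - c * (t / b)\<^sup>2) = 1 + t - c * ((1 + t) * (t / b)\<^sup>2)" for c
    by (simp add: algebra_simps)
  ultimately show ?thesis unfolding e by simp
qed

text \<open>In the second bound \<open>1 + t\<close> is paired with \<open>1 + \<xi> - t\<close>: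
  their product exceeds \<open>1 + \<xi>\<close> by \<open>t * (\<xi> - t)\<close>. What remains is
  at least 0.94, and the cubic in \<open>t\<close> in the proof is that inequality with denominators
  cleared.\<close>

lemma two_shift_ge:
  fixes t \<xi> :: real
  assumes "0 \<le> t" "t \<le> \<xi>" "\<xi> \<le> 19/24"
  shows "(1 + t) * (1 + t / 2) * (1 - 1.645 * (t / (1 + \<xi>))\<^sup>2) \<ge> 1"
    and "(1 + t) * (1 + t / 2) * (1 - 1.645 * (t / (1 + \<xi>))\<^sup>2) * (1 + \<xi> - t) \<ge> 0.94 * (1 + \<xi>)"
proof -
  let ?N = "1 - 1.645 * (t / (1 + \<xi>))\<^sup>2"
  have b: "(1 + t) * ?N \<ge> 1" using one_shift_ge[of t "1 + \<xi>"] assms by simp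
  then have "(1 + t / 2) * 1 \<le> (1 + t / 2) * ((1 + t) * ?N)" using assms by (intro mult_left_mono) auto
  moreover have "1 \<le> (1 + t / 2) * 1" using assms by simp
  ultimately have "1 \<le> (1 + t / 2) * ((1 + t) * ?N)" by (rule order_trans[rotated])
  then show "(1 + t) * (1 + t / 2) * ?N \<ge> 1" by (simp only: mult_ac)
  have p: "0.06 + 0.62 * t - 0.585 * t\<^sup>2 - 0.3225 * t^3 \<ge> 0"
  proof -
    have t1: "t\<^sup>2 \<le> 0.792 * t" using assms mult_right_mono[of t "0.792" t] by (simp add: power2_eq_square)
    have "t^3 = t\<^sup>2 * t" by (simp add: power2_eq_square power3_eq_cube)
    also have "\<dots> \<le> 0.792 * t * 0.792" using t1 assms by (intro mult_mono) auto
    finally have "t^3 \<le> 0.628 * t" using assms by simp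
    then show ?thesis using t1 assms by simp
  qed
  have m: "(1 + t / 2) * ?N \<ge> 0.94"
  proof -
    have s: "(1 + t)\<^sup>2 > 0" using assms by simp
    then have e: "((1 + t)\<^sup>2 - c * u) / (1 + t)\<^sup>2 = 1 - c * (u / (1 + t)\<^sup>2)" for c u
      by (simp add: diff_divide_distrib)
    have "0.94 * (1 + t)\<^sup>2 \<le> (1 + t / 2) * ((1 + t)\<^sup>2 - 1.645 * t\<^sup>2)"
      using p by (simp add: field_simps power2_eq_square power3_eq_cube)
    then have "0.94 \<le> (1 + t / 2) * ((1 + t)\<^sup>2 - 1.645 * t\<^sup>2) / (1 + t)\<^sup>2"
      using s by (simp only: pos_le_divide_eq)
    also have "\<dots> = (1 + t / 2) * (1 - 1.645 * (t / (1 + t))\<^sup>2)"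
      by (simp only: power_divide e times_divide_eq_right[symmetric])
    finally have "(1 + t / 2) * (1 - 1.645 * (t / (1 + t))\<^sup>2) \<ge> 0.94" .
    moreover have "(1 + t / 2) * (1 - 1.645 * (t / (1 + t))\<^sup>2) \<le> (1 + t / 2) * ?N"
      using sq_ratio_le(2)[of t "1 + \<xi>"] assms by (intro mult_left_mono) auto
    ultimately show ?thesis by (rule order_trans)
  qed
  have "(1 + t) * (1 + \<xi> - t) - (1 + \<xi>) = t * (\<xi> - t)" by (simp add: algebra_simps)
  then have "(1 + t) * (1 + \<xi> - t) \<ge> 1 + \<xi>" using assms mult_nonneg_nonneg[of t "\<xi> - t"] by linarith
  then have "0.94 * (1 + \<xi>) \<le> ((1 + t / 2) * ?N) * ((1 + t) * (1 + \<xi> - t))"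
    using m assms by (intro mult_mono) auto
  then show "(1 + t) * (1 + t / 2) * ?N * (1 + \<xi> - t) \<ge> 0.94 * (1 + \<xi>)" by (simp only: mult_ac)
qed

text \<open>Compares the sinc loss with \<open>1 - \<xi> k * t\<close>, the factor against which the
  invariant secures 0.95 when the shift is positive.\<close>

lemma one_shift_ratio:
  fixes t \<xi> x :: real and n :: nat
  assumes t: "0 \<le> t" "t \<le> \<xi>" "\<xi> \<le> 19/24" and n: "n \<in> {2,3}" and x: "x * (real n + \<xi>) = 1"
  shows "1 - 1.645 * (t / (real n - 1 + \<xi>))\<^sup>2 \<ge> (if n = 2 then 0.945 else 1) * (1 - x * t)"
proof -
  define k :: real where "k = (if n = 2 then 0.945 else 1)"
  define B where "B = real n - 1 + \<xi>"
  have B: "B \<ge> 1" using n t by (auto simp: B_def)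
  have A: "real n + \<xi> = B + 1" by (simp add: B_def)
  have f: "B\<^sup>2 * ((B + 1) * (1 - k) + k * t) \<ge> 1.645 * (B + 1) * t\<^sup>2"
  proof -
    \<comment> \<open>After one factor \<open>t\<close> of \<open>t\<^sup>2\<close> is replaced by
      \<open>\<xi>\<close>, the inequality is affine in \<open>t\<close>; \<open>D\<close> is its
      slope, and only the ends 0 and \<open>\<xi>\<close> need checking.\<close>
    define D where "D = B\<^sup>2 * k - 1.645 * (B + 1) * \<xi>"
    have e: "B\<^sup>2 * ((B + 1) * (1 - k)) + \<xi> * D \<ge> 0"
    proof (cases "n = 2")
      case True
      then have "B\<^sup>2 * ((B + 1) * (1 - k)) + \<xi> * D = 0.11 + 1.22 * \<xi> - 1.18 * \<xi>\<^sup>2 - 0.645 * \<xi>^3"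
        by (simp add: B_def D_def k_def field_simps power2_eq_square power3_eq_cube)
      moreover have t1: "\<xi>\<^sup>2 \<le> 0.792 * \<xi>" using t mult_right_mono[of \<xi> "0.792" \<xi>] by (simp add: power2_eq_square)
      moreover have "\<xi>^3 \<le> 0.628 * \<xi>"
      proof -
        have "\<xi>^3 = \<xi>\<^sup>2 * \<xi>" by (simp add: power2_eq_square power3_eq_cube)
        also have "\<dots> \<le> 0.792 * \<xi> * 0.792" using t1 t by (intro mult_mono) auto
        finally show ?thesis using t by simp
      qed
      ultimately show ?thesis using t by simp
    next
      case False
      then have n3: "n = 3" "k = 1" using n by (auto simp: k_def)
      have "\<xi>\<^sup>2 \<le> 0.792 * \<xi>" using t mult_right_mono[of \<xi> "0.792" \<xi>] by (simp add: power2_eq_square)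
      then have "D \<ge> 0" using t by (simp add: D_def B_def n3 power2_eq_square algebra_simps)
      then show ?thesis using t by (simp add: n3)
    qed
    have "t * D \<ge> min 0 (\<xi> * D)"
      using t by (cases "D \<ge> 0") (auto simp: mult_right_mono_neg min_le_iff_disj)
    moreover have "B\<^sup>2 * ((B + 1) * (1 - k)) \<ge> 0" using B by (auto simp: k_def)
    ultimately have nn: "B\<^sup>2 * ((B + 1) * (1 - k)) + t * D \<ge> 0" using e by (auto simp: min_def split: if_splits)
    have "1.645 * (B + 1) * t\<^sup>2 = 1.645 * (B + 1) * t * t" by (simp only: power2_eq_square mult_ac)
    also have "\<dots> \<le> 1.645 * (B + 1) * t * \<xi>" using t B by (intro mult_left_mono) auto
    also have "\<dots> \<le> (B\<^sup>2 * ((B + 1) * (1 - k)) + t * D) + 1.645 * (B + 1) * t * \<xi>" using nn by simp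
    also have "\<dots> = B\<^sup>2 * ((B + 1) * (1 - k) + k * t)" by (simp add: D_def algebra_simps)
    finally show ?thesis .
  qed
  have x': "x = 1 / (B + 1)" using x B unfolding A by (simp add: field_simps)
  have "1 - 1.645 * (t / B)\<^sup>2 - k * (1 - x * t)
    = (B\<^sup>2 * ((B + 1) * (1 - k) + k * t) - 1.645 * (B + 1) * t\<^sup>2) / ((B + 1) * B\<^sup>2)"
    unfolding x' using B by (simp add: field_simps power2_eq_square)
  also have "\<dots> \<ge> 0" using f B by (intro divide_nonneg_nonneg) auto
  finally show ?thesis by (simp add: k_def[symmetric] B_def[symmetric])
qed

lemma affine_interp_ge:
  fixes m u v z \<rho> :: real
  assumes "0 \<le> z" "z \<le> \<rho>" "0 < \<rho>" "m \<le> u" "m \<le> (1 - \<rho>) * u + \<rho> * v"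
  shows "m \<le> (1 - z) * u + z * v"
proof -
  define s where "s = z / \<rho>"
  have s: "0 \<le> s" "s \<le> 1" "s * \<rho> = z" using assms by (auto simp: s_def)
  have "m = (1 - s) * m + s * m" by (simp add: algebra_simps)
  also have "\<dots> \<le> (1 - s) * u + s * ((1 - \<rho>) * u + \<rho> * v)" using assms s by (intro add_mono mult_left_mono) auto
  also have "\<dots> = (1 - s * \<rho>) * u + s * \<rho> * v" by (simp add: algebra_simps)
  finally show ?thesis unfolding s(3) .
qed

text \<open>The constants were found by a numerical search; they make the invariant \<open>level_inv\<close> below
  stable.\<close>

definition target :: "nat \<Rightarrow> nat \<Rightarrow> real" where
  "target al n = (if n = 3 then 0.95 else if n = 2 then 0.82 else if al = 1 then 0.75 else 0.6)"

text \<open>Upper bounds for \<open>\<xi> k\<close>, for \<open>\<xi> (k - 1) * \<xi> (k - 2)\<close>, and for the product of the three.\<close>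

definition x_max :: "nat \<Rightarrow> bool \<Rightarrow> real" where "x_max n r = 1 / (n + xi_min r)"

definition xx_max :: "nat \<Rightarrow> nat \<Rightarrow> nat \<Rightarrow> bool \<Rightarrow> real" where
  "xx_max al2 al n r = 1 / (1 + al2 * (al + 1 / (n + xi_max r)))"

definition xxx_max :: "nat \<Rightarrow> nat \<Rightarrow> nat \<Rightarrow> bool \<Rightarrow> real" where
  "xxx_max al2 al n r = x_max n r / (1 + al2 * al + al2 * x_max n r)"

text \<open>For \<open>a k = a (k + 1) = 1\<close>: lower bounds for \<open>block k (1 + t)\<close> when \<open>t / \<xi> (k + 1)\<close> lies in
  \<open>[0, 1/2]\<close>, \<open>[1/2, 3/4]\<close>, \<open>[3/4, 1]\<close>.\<close>

definition mu_low :: "nat \<Rightarrow> nat \<Rightarrow> bool \<Rightarrow> real" where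
  "mu_low i al2 r = (if r then fst else snd)
     ([(1.51, 1.74), (1.31, 1.5), (1.15, 1.32), (1.39, 1.64), (1.19, 1.41), (1.03, 1.22),
       (1.28, 1.55), (1.08, 1.32), (0.92, 1.13)] ! (3 * i + al2 - 1))"

section \<open>Finite verification over all digit patterns\<close>

lemmas step_tables = target_def x_max_def xx_max_def xxx_max_def cls_def xi_min_def xi_max_def
  first_low_def one_low_def two_low_def three_low_def

text \<open>The worst cases of the conclusions of \<open>step_negative\<close> for one block:
  \<open>target al n\<close> stands for the least possible \<open>R * (1 + t)\<close>. The next
  checks do the same for other numbers of blocks and for positive shifts.\<close>

lemma first_check:
  fixes r :: bool
  assumes "al2 \<in> {1,2,3}" "al \<in> {1,2,3}" "n \<in> {1,2,3}"
  defines "w \<equiv> first_low (cls al al2) n r * target al n"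
  shows "w \<ge> 1" (is ?A)
    "w * (1 - xxx_max al2 al n r * target al n) \<ge> 0.95" (is ?B)
    "n \<noteq> 1 \<Longrightarrow> w * (1 - x_max n r * target al n) \<ge> target al2 al"
proof -
  have "?A \<and> ?B"
    unfolding w_def by (insert assms(1-3); cases r; elim insertE emptyE) (simp_all add: step_tables)
  then show ?A ?B by blast+
  have "n \<noteq> 1 \<longrightarrow> target al2 al \<le> w * (1 - x_max n r * target al n)"
    unfolding w_def by (insert assms(1-3); cases r; elim insertE emptyE) (simp_all add: step_tables)
  then show "n \<noteq> 1 \<Longrightarrow> w * (1 - x_max n r * target al n) \<ge> target al2 al" by blast
qed

lemma one_check:
  fixes r :: bool
  assumes "al2 \<in> {1,2,3}" "al \<in> {1,2,3}" "n \<in> {2,3}"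
  defines "v \<equiv> one_low (cls al al2) n r"
  shows "v * (1 - xxx_max al2 al n r) \<ge> 0.95" (is ?A)
    "xxx_max al2 al n r \<le> 0.181" (is ?B)
    "0.95 * (if n = 2 then 0.945 else 1) * v * (1 - x_max n r) \<ge> target al2 al" (is ?C)
proof -
  have "?A \<and> ?B \<and> ?C"
    unfolding v_def by (insert assms(1-3); cases r; elim insertE emptyE) (simp_all add: step_tables)
  then show ?A ?B ?C by blast+
qed

lemma two_check_full:
  fixes r :: bool
  assumes "al2 \<in> {1,2,3}" "al \<in> {1,2,3}"
  defines "w \<equiv> (first_low (cls al al2) 2 r)\<^sup>2" and "W \<equiv> two_low (cls al al2) 2 r"
  shows "w * target al 2 \<ge> 1" (is ?A)
    "W * target al 2 \<ge> 1" (is ?B)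
    "w * target al 2 * (1 - xx_max al2 al 2 r) \<ge> 0.95" (is ?C)
    "W * target al 2 * (1 - xx_max al2 al 2 r) \<ge> 0.95" (is ?D)
proof -
  have "?A \<and> ?B \<and> ?C \<and> ?D"
    unfolding w_def W_def by (insert assms(1-2); cases r; elim insertE emptyE) (simp_all add: step_tables power_divide)
  then show ?A ?B ?C ?D by blast+
qed

lemma two_check:
  fixes r :: bool
  assumes "al2 \<in> {1,2,3}" "al \<in> {1,2,3}"
  defines "w \<equiv> (first_low (cls al al2) 3 r)\<^sup>2" and "W \<equiv> two_low (cls al al2) 3 r"
  shows "w \<le> W" (is ?A)
    "w * 0.95 \<ge> 1" (is ?B)
    "w * 0.95 * (1 - 1.5 * x_max 3 r) \<ge> target al2 al" (is ?C)
    "W * 0.95 * 0.75 * (1 - 1.5 * x_max 3 r) \<ge> target al2 al" (is ?D)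
    "W * 0.95 * (1 - 2 * x_max 3 r) \<ge> target al2 al" (is ?E)
    "w * 0.95 * (1 - 2 * xxx_max al2 al 3 r) \<ge> 0.95" (is ?F)
    "W * 0.94 * (1 + xi_min r) / (3 + xi_min r) \<ge> target al2 al" (is ?G)
    "W * (1 - xx_max al2 al 3 r) \<ge> 0.95" (is ?H)
proof -
  have "?A \<and> ?B \<and> ?C \<and> ?D \<and> ?E \<and> ?F \<and> ?G \<and> ?H"
    unfolding w_def W_def by (insert assms(1-2); cases r; elim insertE emptyE) (simp_all add: step_tables power_divide)
  then show ?A ?B ?C ?D ?E ?F ?G ?H by blast+
qed

lemma three_check:
  fixes r :: bool
  assumes "al2 \<in> {1,2,3}" "al \<in> {1,2,3}"
  defines "w \<equiv> first_low (cls al al2) 3 r * two_low (cls al al2) 3 r" and "W \<equiv> three_low (cls al al2) r"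
  shows "w * 0.95 \<ge> 1" (is ?A)
    "W * 0.95 \<ge> 1" (is ?B)
    "w * 0.95 * (1 - xx_max al2 al 3 r) \<ge> 0.95" (is ?C)
    "W * 0.95 * (1 - xx_max al2 al 3 r) \<ge> 0.95" (is ?D)
proof -
  have "?A \<and> ?B \<and> ?C \<and> ?D"
    unfolding w_def W_def by (insert assms(1-2); cases r; elim insertE emptyE) (simp_all add: step_tables)
  then show ?A ?B ?C ?D by blast+
qed

lemmas xi_tables = step_tables xi_low_def th_max_def th_min_def rate_max_def slope_bound_def e3_def power_divide

text \<open>The pattern \<open>n = al = 1\<close> is excluded because \<open>xi_low\<close> can fall
  below 1 there; \<open>mu_check\<close> handles it.\<close>

lemma xi_check:
  assumes "al2 \<in> {1,2,3}" "al \<in> {1,2,3}" "n \<in> {1,2,3}" "\<not> (n = 1 \<and> al = 1)"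
  shows "xi_low al2 al n r \<ge> 1" (is ?A)
    "xi_low al2 al n r * (1 - n * x_max n r * xx_max al2 al n r) \<ge> 1" (is ?B)
    "many_low n (cls al al2) n r \<ge> 1" (is ?C)
    "many_low n (cls al al2) n r * (1 - n * x_max n r * xx_max al2 al n r) \<ge> 1" (is ?D)
proof -
  have "?C \<and> ?D"
    by (insert assms; cases r; elim insertE emptyE) (simp_all add: step_tables many_low_def)
  then show ?C ?D by blast+
  show ?A
    by (insert assms; cases r; elim insertE emptyE) (simp_all add: xi_tables)
  show ?B
    by (insert assms; cases r; elim insertE emptyE) (simp_all add: xi_tables)
qed

text \<open>With \<open>V\<close> and \<open>W\<close> the values at shifts 0 and
  \<open>\<xi> (Suc k)\<close>, the last three claims say that \<open>mu_low\<close> is at most the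
  geometric interpolation at the fractions 1/2, 3/4 and 1 of the way.\<close>

lemma mu_check:
  fixes r :: bool
  assumes "al2 \<in> {1,2,3}"
  defines "V \<equiv> one_low (cls 1 al2) 1 r" and "W \<equiv> xi_low al2 1 1 r"
  shows "W > 0" (is ?A)
    "i \<in> {0,1,2} \<Longrightarrow> mu_low i al2 r \<le> V"
    "(mu_low 0 al2 r)\<^sup>2 \<le> V * W" (is ?C)
    "mu_low 1 al2 r ^ 4 \<le> V * W ^ 3" (is ?D)
    "mu_low 2 al2 r \<le> W" (is ?E)
proof -
  have "?A \<and> (\<forall>i\<in>{0,1,2}. mu_low i al2 r \<le> V) \<and> ?C \<and> ?D \<and> ?E"
    unfolding V_def W_def by (insert assms(1); cases r; elim insertE emptyE) (simp_all add: xi_tables mu_low_def)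
  then show ?A "i \<in> {0,1,2} \<Longrightarrow> mu_low i al2 r \<le> V" ?C ?D ?E by blast+
qed

text \<open>The inequality wanted is
  \<open>1 + \<xi> - t \<le> m * (1 + \<xi> - c * (1 + t))\<close>. It is affine in
  \<open>t\<close>, and \<open>m * c \<le> 1\<close> makes the left end \<open>t = z * \<xi>\<close>
  the worst; the result is affine in \<open>\<xi>\<close>, so two values of \<open>\<xi>\<close>
  suffice.\<close>

lemma mu_check_linear:
  fixes r :: bool
  assumes "al2 \<in> {1,2,3}" "i \<in> {0,1,2}" "\<xi> = xi_min r \<or> \<xi> = xi_max r"
  defines "m \<equiv> mu_low i al2 r" and "c \<equiv> xx_max al2 1 1 r" and "z \<equiv> [0, 1/2, 3/4] ! i"
  shows "m * (1 - c) - 1 + \<xi> * (m - 1 + z * (1 - m * c)) \<ge> 0" (is ?A)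
    "m * c \<le> 1" (is ?B)
    "m > 0" (is ?C)
proof -
  have "?A \<and> ?B \<and> ?C"
    unfolding m_def c_def z_def by (insert assms(1-3); cases r; elim insertE emptyE disjE) (simp_all add: step_tables mu_low_def)
  then show ?A ?B ?C by blast+
qed

section \<open>Splitting off a digit\<close>

text \<open>The concave function \<open>s * (1 - x * s)\<close> lies above its chord over [3/2, 2];
  \<open>l\<close> is the weight of the left end.\<close>

lemma two_point_concave:
  fixes s x a b \<tau> Q :: real
  assumes s: "3/2 \<le> s" "s \<le> 2" and x: "0 \<le> x" and Q: "0 \<le> Q"
    and a: "Q * (3/2 * (1 - 3/2 * x)) \<ge> \<tau>" and b: "Q * (2 * (1 - 2 * x)) \<ge> \<tau>"
  shows "Q * (s * (1 - x * s)) \<ge> \<tau>"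
proof -
  define l where "l = 4 - 2 * s"
  have l: "0 \<le> l" "l \<le> 1" using s by (auto simp: l_def)
  have "x * ((s - 3/2) * (2 - s)) \<ge> 0" using s x by (intro mult_nonneg_nonneg) auto
  moreover have "l * (3/2 * (1 - 3/2 * x)) + (1 - l) * (2 * (1 - 2 * x)) + x * ((s - 3/2) * (2 - s)) = s * (1 - x * s)"
    by (simp add: l_def field_simps)
  ultimately have "s * (1 - x * s) \<ge> l * (3/2 * (1 - 3/2 * x)) + (1 - l) * (2 * (1 - 2 * x))" by linarith
  then have "Q * (s * (1 - x * s)) \<ge> Q * (l * (3/2 * (1 - 3/2 * x)) + (1 - l) * (2 * (1 - 2 * x)))"
    using Q by (intro mult_left_mono)
  also have "Q * (l * (3/2 * (1 - 3/2 * x)) + (1 - l) * (2 * (1 - 2 * x)))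
    = l * (Q * (3/2 * (1 - 3/2 * x))) + (1 - l) * (Q * (2 * (1 - 2 * x)))" by (simp add: algebra_simps)
  also have "\<dots> \<ge> l * \<tau> + (1 - l) * \<tau>" using a b l by (intro add_mono mult_left_mono) auto
  also have "l * \<tau> + (1 - l) * \<tau> = \<tau>" by (simp add: algebra_simps)
  finally show ?thesis .
qed

lemma target_bounds: "0 < target al n" "target al n \<le> 0.95"
  by (auto simp: target_def)

context sudler_small begin

abbreviation \<xi>\<xi> :: "nat \<Rightarrow> real" where "\<xi>\<xi> k \<equiv> \<xi> (k - 1) * \<xi> (k - 2)"

lemma \<xi>_eq': "k \<ge> 1 \<Longrightarrow> \<xi> k = 1 / (a (Suc k) + \<xi> (Suc k))"
  using \<xi>_eq[of "k - 1"] by simp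

lemma good_x:
  assumes g: "good k"
  shows "\<xi> k * (a (Suc k) + \<xi> (Suc k)) = 1" "\<xi> k \<le> x_max (a (Suc k)) (knext k)" "0 < \<xi> k"
    and "\<xi>\<xi> k = 1 / (1 + a (k - 1) * (a k + \<xi> k))"
    and "\<xi>\<xi> k \<le> xx_max (a (k - 1)) (a k) (a (Suc k)) (knext k)" "0 < \<xi>\<xi> k" "\<xi>\<xi> k \<le> 1/2"
    and "\<xi>\<xi> k * \<xi> k \<le> xxx_max (a (k - 1)) (a k) (a (Suc k)) (knext k)"
proof -
  let ?n = "a (Suc k)" and ?r = "knext k" and ?al = "real (a k)" and ?al2 = "real (a (k - 1))"
  have k: "k \<ge> K + 10" by (rule good_ge[OF g])
  have xp: "0 < \<xi> (Suc k)" by (rule \<xi>_pos)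
  have Ap: "0 < ?n + \<xi> (Suc k)" using xp by simp
  have e: "\<xi> k = 1 / (?n + \<xi> (Suc k))" using k by (intro \<xi>_eq') auto
  show "\<xi> k * (?n + \<xi> (Suc k)) = 1" unfolding e using Ap by simp
  have mp: "0 < xi_min ?r" "0 < xi_max ?r" by (auto simp: xi_min_def xi_max_def)
  show le: "\<xi> k \<le> x_max ?n ?r" unfolding e x_max_def using good_\<xi>[OF g] Ap mp by (intro divide_left_mono) auto
  have ge: "1 / (?n + xi_max ?r) \<le> \<xi> k" unfolding e using good_\<xi>[OF g] Ap mp by (intro divide_left_mono) auto
  show x0: "0 < \<xi> k" by (rule \<xi>_pos)
  have al: "?al \<ge> 1" "?al2 \<ge> 1" using a_pos[of k] a_pos[of "k - 1"] k by auto
  have e1: "\<xi> (k - 1) = 1 / (?al + \<xi> k)" using \<xi>_eq'[of "k - 1"] k by simp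
  have e2: "\<xi> (k - 2) = 1 / (?al2 + \<xi> (k - 1))"
  proof -
    have "Suc (k - 2) = k - 1" using k by simp
    then show ?thesis using \<xi>_eq'[of "k - 2"] k by simp
  qed
  show eq: "\<xi>\<xi> k = 1 / (1 + ?al2 * (?al + \<xi> k))" unfolding e2 unfolding e1 using al x0 by (simp add: field_simps)
  have d: "1 + ?al2 * (?al + \<xi> k) \<ge> 1 + 1 * 1" using al x0 by (intro add_left_mono mult_mono) auto
  show "\<xi>\<xi> k \<le> xx_max (a (k - 1)) (a k) ?n ?r"
    unfolding eq xx_max_def using d ge al mp by (intro divide_left_mono add_left_mono mult_left_mono mult_pos_pos) (auto intro!: add_pos_nonneg)
  show "0 < \<xi>\<xi> k" using \<xi>_pos by simp
  show "\<xi>\<xi> k \<le> 1/2" unfolding eq using d by (intro divide_left_mono) auto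
  have X0: "0 < x_max ?n ?r" using le x0 by linarith
  have "\<xi>\<xi> k * \<xi> k = \<xi> k / (1 + ?al2 * ?al + ?al2 * \<xi> k)" unfolding eq by (simp add: algebra_simps)
  \<comment> \<open>The function \<open>x / (1 + al2 * al + al2 * x)\<close> increases with
    \<open>x\<close>.\<close>
  also have "\<dots> \<le> x_max ?n ?r / (1 + ?al2 * ?al + ?al2 * x_max ?n ?r)"
  proof -
    have "1 + ?al2 * ?al > 0" by (simp add: add_pos_nonneg)
    then have "\<xi> k * (1 + ?al2 * ?al) \<le> x_max ?n ?r * (1 + ?al2 * ?al)" using le by (intro mult_right_mono) auto
    moreover have "0 < 1 + ?al2 * ?al + ?al2 * \<xi> k" "0 < 1 + ?al2 * ?al + ?al2 * x_max ?n ?r"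
      using x0 X0 by (auto intro!: add_pos_nonneg)
    ultimately show ?thesis by (simp add: divide_le_eq pos_le_divide_eq field_simps)
  qed
  finally show "\<xi>\<xi> k * \<xi> k \<le> xxx_max (a (k - 1)) (a k) ?n ?r" by (simp add: xxx_max_def)
qed

lemma good_group_0:
  assumes "good k" "j \<in> {1,2,3}" "j \<le> a (Suc k)"
  shows "(\<Prod>i=1..j. block k (real i)) \<ge> many_low j (kcls k) (a (Suc k)) (knext k)"
  using good_group[OF assms, of 0] assms(3) \<xi>_pos[of "Suc k"] by simp

lemma digit_range:
  assumes "good k" "m \<le> a (Suc k)" "t \<le> \<xi> (Suc k)"
  shows "\<xi> k * (real m + t) \<le> 1" "\<xi>\<xi> k * \<xi> k * (real m + t) \<le> \<xi>\<xi> k"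
proof -
  have "\<xi> k * (real m + t) \<le> \<xi> k * (a (Suc k) + \<xi> (Suc k))"
    using assms good_x(3)[OF assms(1)] by (intro mult_left_mono) auto
  then show 1: "\<xi> k * (real m + t) \<le> 1" using good_x(1)[OF assms(1)] by simp
  have "\<xi>\<xi> k * (\<xi> k * (real m + t)) \<le> \<xi>\<xi> k * 1" using 1 good_x(6)[OF assms(1)] by (intro mult_left_mono) auto
  then show "\<xi>\<xi> k * \<xi> k * (real m + t) \<le> \<xi>\<xi> k" by (simp only: mult.assoc mult_1_right)
qed

text \<open>The conclusions are the clauses of \<open>level_inv\<close> one level down, for the new
  shift \<open>- \<xi> k * (m + t)\<close> and the new product \<open>R * G\<close>. The bound on
  \<open>R * (1 + t)\<close> pays for the factor \<open>1 + t\<close> lost in the first block. The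
  target is claimed only for a digit that is not full, since a full digit leaves too few factors for
  a block at the next level.\<close>

lemma step_negative:
  fixes m :: nat and t R :: real
  assumes g: "good k" and t: "\<xi> (Suc k) - 1 \<le> t" "t \<le> 0" and R: "1 \<le> R" "target (a k) (a (Suc k)) \<le> R * (1 + t)"
    and m: "1 \<le> m" "m \<le> a (Suc k)"
  defines "G \<equiv> (\<Prod>i=1..m. block k (real i + t))"
  shows "1 \<le> R * G" "0.95 \<le> R * G * (1 - \<xi>\<xi> k * \<xi> k * (real m + t))"
    and "m < a (Suc k) \<Longrightarrow> target (a (k - 1)) (a k) \<le> R * G * (1 - \<xi> k * (real m + t))"
proof -
  let ?n = "a (Suc k)" and ?r = "knext k" and ?c = "kcls k"
  define h where "h = target (a k) ?n"
  define w where "w = first_low ?c ?n ?r"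
  define v where "v = 1 + t"
  define x where "x = \<xi> k"
  define c where "c = \<xi>\<xi> k"
  note dg = good_digits[OF g] and cl = good_\<theta>(3)[OF g]
  have k1: "k \<ge> 1" using good_ge[OF g] by simp
  have v: "0 < v" "v \<le> 1" using t \<xi>_pos[of "Suc k"] by (auto simp: v_def)
  have tv: "t = v - 1" by (simp add: v_def)
  have Rv: "h \<le> R * v" using R by (simp add: h_def v_def)
  have h: "0 < h" "h \<le> 1" using target_bounds[of "a k" ?n] by (auto simp: h_def)
  have w1: "1 \<le> w" "w \<le> block k 1" using first_low_ge_1[OF cl dg(3)] good_first[OF g] by (auto simp: w_def)
  have B: "0 < block k 1" using w1 by simp
  note gx = good_x[OF g, folded x_def c_def]
  \<comment> \<open>Common ending of the cases: \<open>v * X \<le> G\<close> and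
    \<open>R * v \<ge> h\<close> together give \<open>R * G \<ge> X * h\<close>.\<close>
  have fin: "\<tau> \<le> R * G * Z" if "v * X \<le> G" "0 \<le> X" "0 \<le> Z0" "Z0 \<le> Z" "\<tau> \<le> X * h * Z0" for X Z Z0 \<tau>
  proof -
    have "X * h * Z0 \<le> X * (R * v) * Z" using that Rv h by (intro mult_mono) auto
    also have "\<dots> = R * (v * X) * Z" by simp
    also have "\<dots> \<le> R * G * Z" using that R by (intro mult_right_mono mult_left_mono) auto
    finally show ?thesis using that by linarith
  qed
  have fin1: "1 \<le> R * G" if "v * X \<le> G" "0 \<le> X" "1 \<le> X * h" for X
    using fin[of X 1 1 1] that by simp
  have mt: "real m + t \<ge> 0" using m t \<xi>_pos[of "Suc k"] by auto
  have t\<xi>: "t \<le> \<xi> (Suc k)" using t \<xi>_pos[of "Suc k"] by simp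
  have cm: "c * x * (real m + t) \<le> c" "x * (real m + t) \<le> 1"
    using digit_range[OF g m(2) t\<xi>] by (auto simp: c_def x_def)
  have full: "1 - xx_max (a (k - 1)) (a k) ?n ?r \<le> 1 - c * x * (real m + t)"
    using gx(5) cm by linarith
  have G0: "(\<Prod>i=1..j. block k (real i)) \<ge> many_low j ?c ?n ?r" if "j \<in> {1,2,3}" "j \<le> ?n" for j
    using good_group_0[OF g] that by auto
  consider "m = 1" | "m = 2" "?n = 2" | "m = 2" "?n = 3" | "m = 3" "?n = 3" using m dg(3) by fastforce
  then have "1 \<le> R * G \<and> 0.95 \<le> R * G * (1 - c * x * (real m + t))
    \<and> (m < ?n \<longrightarrow> target (a (k - 1)) (a k) \<le> R * G * (1 - x * (real m + t)))"
  proof cases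
    case 1
    have G: "v * w \<le> G"
      using prod_block_negative[OF k1, of 0 v w] v w1 a_pos[of "Suc k"] 1 by (simp add: G_def tv)
    have mv: "real m + t = v" using 1 by (simp add: tv)
    \<comment> \<open>For a single block the new shift is proportional to \<open>v\<close> itself,
      so a small \<open>v\<close> also makes the next shift harmless; using this dependence is
      sharper than \<open>fin\<close>.\<close>
    have q: "w * (h * (1 - z * h)) \<le> R * G * (1 - z * v)" if "0 \<le> z" "z \<le> 1/2" for z
    proof -
      have "h * (1 - z * h) \<le> R * v * (1 - z * v)" using that Rv R v h by (intro scaled_quadratic_ge) auto
      then have "w * (h * (1 - z * h)) \<le> w * (R * v * (1 - z * v))" using w1 by (intro mult_left_mono) auto
      also have "\<dots> = R * (v * w) * (1 - z * v)" by simp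
      also have "\<dots> \<le> R * G * (1 - z * v)"
      proof (intro mult_right_mono mult_left_mono G)
        have "z * v \<le> 1/2 * 1" using that v by (intro mult_mono) auto
        then show "0 \<le> 1 - z * v" by simp
      qed (use R in auto)
      finally show ?thesis .
    qed
    note fc = first_check[OF dg(1,2,3), of ?r, folded h_def w_def]
    have x1: "x \<le> 1" using \<xi>_less_1[OF k1] by (simp add: x_def)
    have cx: "0 \<le> c * x" "c * x \<le> 1/2 * 1" using gx x1 by (auto intro!: mult_mono mult_nonneg_nonneg simp del: mult_1_right)
    have "0.95 \<le> w * h * (1 - xxx_max (a (k - 1)) (a k) ?n ?r * h)" by (rule fc(2))
    also have "\<dots> \<le> w * h * (1 - c * x * h)" using gx(8) w1 h by (intro mult_left_mono diff_left_mono mult_right_mono) auto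
    also have "\<dots> \<le> R * G * (1 - c * x * v)" using q[of "c * x"] cx by (simp add: mult.assoc)
    finally have 2: "0.95 \<le> R * G * (1 - c * x * v)" .
    have 3: "target (a (k - 1)) (a k) \<le> R * G * (1 - x * v)" if "m < ?n"
    proof -
      have n: "?n \<noteq> 1" "?n \<in> {2,3}" using that 1 dg(3) by auto
      have "x_max ?n ?r \<le> 1/2" using n by (auto simp: x_max_def xi_min_def)
      then have x2: "x \<le> 1/2" using gx(2) by linarith
      have "target (a (k - 1)) (a k) \<le> w * h * (1 - x_max ?n ?r * h)" by (rule fc(3)[OF n(1)])
      also have "\<dots> \<le> w * h * (1 - x * h)" using gx(2) w1 h by (intro mult_left_mono diff_left_mono mult_right_mono) auto
      also have "\<dots> \<le> R * G * (1 - x * v)" using q[of x] x2 gx(3) by (simp add: mult.assoc)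
      finally show ?thesis .
    qed
    show ?thesis unfolding mv using fin1[OF G] fc(1) w1 2 3 by auto
  next
    case 2
    define W where "W = two_low ?c ?n ?r"
    have W: "W \<le> (\<Prod>i=1..2. block k (real i))" using G0[of 2] 2 by (simp add: W_def many_low_def)
    \<comment> \<open>The two entries bound the product at the ends \<open>v = 0\<close> and
      \<open>v = 1\<close> of the interpolation.\<close>
    define X where "X = min (w\<^sup>2) W"
    have W1: "1 \<le> W" using many_low_ge_1[OF cl dg(3), of 2 ?r] 2 by (simp add: W_def many_low_def)
    have ww: "w\<^sup>2 \<le> block k 1 * block k 1" unfolding power2_eq_square using w1 by (intro mult_mono) auto
    have X1: "0 < X" "X \<le> w\<^sup>2" "X \<le> W" using W1 w1 by (auto simp: X_def)
    have "v * X \<le> (\<Prod>i=1..Suc 1. block k (real i + (v - 1)))"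
    proof (rule prod_block_negative[OF k1 _ v X1(1)])
      show "X \<le> block k 1 * (\<Prod>i=1..1. block k (real i))" using X1 ww by simp
      show "X \<le> (\<Prod>i=1..Suc 1. block k (real i))" using X1 W by (simp add: numeral_2_eq_2)
    qed (use 2 in simp)
    then have G: "v * X \<le> G" using 2 by (simp add: G_def tv numeral_2_eq_2)
    note tc = two_check_full[OF dg(1,2), of ?r]
    have nn: "?n = 2" using 2 by simp
    have Xh: "1 \<le> X * h" "0.95 \<le> X * h * (1 - xx_max (a (k - 1)) (a k) ?n ?r)"
      using tc by (auto simp: X_def min_def h_def w_def W_def nn)
    have "xx_max (a (k - 1)) (a k) ?n ?r \<le> 1" using dg by (auto simp: xx_max_def xi_max_def)
    then show ?thesis using fin1[OF G _ Xh(1)] fin[OF G _ _ full Xh(2)] X1 2 by auto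
  next
    case 3
    define W where "W = two_low ?c ?n ?r"
    have nn: "?n = 3" and m2: "m = 2" using 3 by auto
    have W: "W \<le> (\<Prod>i=1..2. block k (real i))" using G0[of 2] 3 by (simp add: W_def many_low_def)
    then have W12: "W \<le> block k 1 * block k 2" by (simp add: numeral_2_eq_2)
    note tc = two_check[OF dg(1,2), of ?r]
    have h95: "h = 0.95" by (simp add: h_def target_def nn)
    have ww: "w\<^sup>2 \<le> block k 1 * block k 1" unfolding power2_eq_square using w1 by (intro mult_mono) auto
    have wW: "w\<^sup>2 \<le> W" using tc(1) by (simp add: w_def W_def nn)
    have w2: "0 < w\<^sup>2" using w1 by simp
    have "v * w\<^sup>2 \<le> (\<Prod>i=1..Suc 1. block k (real i + (v - 1)))"
    proof (rule prod_block_negative[OF k1 _ v w2])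
      show "w\<^sup>2 \<le> block k 1 * (\<Prod>i=1..1. block k (real i))" using ww by simp
      show "w\<^sup>2 \<le> (\<Prod>i=1..Suc 1. block k (real i))" using wW W by (simp add: numeral_2_eq_2)
    qed (use 3 in simp)
    then have G: "v * w\<^sup>2 \<le> G" using m2 by (simp add: G_def tv numeral_2_eq_2)
    have mv: "real m + t = 1 + v" using m2 by (simp add: tv)
    have X3: "x_max ?n ?r \<le> 0.4" using nn by (auto simp: x_max_def xi_min_def)
    have g1: "1 \<le> R * G" using fin1[OF G] w2 tc(2) by (simp add: h95 w_def nn)
    have g2: "0.95 \<le> R * G * (1 - c * x * (real m + t))"
    proof (rule fin[OF G, of "1 - 2 * xxx_max (a (k - 1)) (a k) ?n ?r"])
      have cx0: "0 \<le> c * x" "0 \<le> xxx_max (a (k - 1)) (a k) ?n ?r"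
        using gx(8) mult_pos_pos[OF gx(6,3)] by linarith+
      have "c * x * (real m + t) \<le> xxx_max (a (k - 1)) (a k) ?n ?r * 2"
        unfolding mv using gx(8) cx0 v by (intro mult_mono) auto
      then show "1 - 2 * xxx_max (a (k - 1)) (a k) ?n ?r \<le> 1 - c * x * (real m + t)" by simp
      show "0.95 \<le> w\<^sup>2 * h * (1 - 2 * xxx_max (a (k - 1)) (a k) ?n ?r)" using tc(6) by (simp add: h95 w_def nn)
      show "0 \<le> 1 - 2 * xxx_max (a (k - 1)) (a k) ?n ?r"
      proof (rule less_imp_le, rule zero_less_mult_pos)
        show "0 < w\<^sup>2 * 0.95" using w2 by simp
        show "0 < w\<^sup>2 * 0.95 * (1 - 2 * xxx_max (a (k - 1)) (a k) ?n ?r)"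
          unfolding w_def nn by (rule less_le_trans[OF _ tc(6)]) simp
      qed
    qed (use w2 in simp)
    have g3: "target (a (k - 1)) (a k) \<le> R * G * (1 - x * (real m + t))"
    \<comment> \<open>For small \<open>v\<close> the bound \<open>v * w\<^sup>2\<close> suffices,
      the new shift being limited by \<open>m + t \<le> 3/2\<close>. For larger \<open>v\<close>
      both blocks are scaled separately from shift 0, and a concave quadratic in
      \<open>1 + v\<close> over [3/2, 2] remains.\<close>
    proof (cases "v \<le> 1/2")
      case True
      show ?thesis
      proof (rule fin[OF G, of "1 - 1.5 * x_max ?n ?r"])
        have "x * (real m + t) \<le> x_max ?n ?r * 1.5"
          unfolding mv using gx(2,3) v True by (intro mult_mono) auto
        then show "1 - 1.5 * x_max ?n ?r \<le> 1 - x * (real m + t)" by simp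
        show "target (a (k - 1)) (a k) \<le> w\<^sup>2 * h * (1 - 1.5 * x_max ?n ?r)" using tc(3) by (simp add: h95 w_def nn)
        show "0 \<le> 1 - 1.5 * x_max ?n ?r" using X3 by simp
      qed (use w2 in simp)
    next
      case False
      have C2: "2 * C k < 1"
      proof -
        have "2 * C k \<le> (?n + \<xi> (Suc k)) * C k" using nn \<xi>_pos[of "Suc k"] C_pos[of k] by (intro mult_right_mono) auto
        then show ?thesis using C_less[OF k1] by simp
      qed
      have b1: "v * block k 1 \<le> block k v" using block_scale[OF k1, of v 1] v C_less_1[OF k1] by simp
      have b2: "(1 + v) / 2 * block k 2 \<le> block k (1 + v)" using block_scale[OF k1, of "1 + v" 2] v C2 by simp
      have B2: "0 < block k 2" using C2 by (intro block_pos) auto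
      have "v * ((1 + v) / 2 * W) \<le> v * ((1 + v) / 2 * (block k 1 * block k 2))"
        using W12 v by (intro mult_left_mono) auto
      also have "\<dots> = (v * block k 1) * ((1 + v) / 2 * block k 2)" by simp
      also have "\<dots> \<le> block k v * block k (1 + v)" using b1 b2 B B2 v order_trans[OF _ b1, of 0] by (intro mult_mono) auto
      also have "\<dots> = G" using m2 by (simp add: G_def tv numeral_2_eq_2 add.commute)
      finally have G': "v * ((1 + v) / 2 * W) \<le> G" .
      have W0: "0 < W" using wW w2 by linarith
      show ?thesis
      proof (rule fin[OF G' _ _ order_refl])
        show "0 \<le> 1 - x * (real m + t)" using cm by simp
        have Q: "0 \<le> W * h / 2" using W0 h by simp
        have "target (a (k - 1)) (a k) \<le> W * h / 2 * ((1 + v) * (1 - x * (1 + v)))"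
        proof (rule two_point_concave[OF _ _ _ Q])
          have "target (a (k - 1)) (a k) \<le> W * h * 0.75 * (1 - 1.5 * x_max ?n ?r)" using tc(4) by (simp add: h95 W_def nn)
          also have "\<dots> \<le> W * h * 0.75 * (1 - 1.5 * x)" using gx(2) W0 h by (intro mult_left_mono) auto
          also have "\<dots> = W * h / 2 * (3/2 * (1 - 3/2 * x))" by (simp add: field_simps)
          finally show "target (a (k - 1)) (a k) \<le> W * h / 2 * (3/2 * (1 - 3/2 * x))" .
          have "target (a (k - 1)) (a k) \<le> W * h * (1 - 2 * x_max ?n ?r)" using tc(5) by (simp add: h95 W_def nn)
          also have "\<dots> \<le> W * h * (1 - 2 * x)" using gx(2) W0 h by (intro mult_left_mono) auto
          also have "\<dots> = W * h / 2 * (2 * (1 - 2 * x))" by (simp add: field_simps)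
          finally show "target (a (k - 1)) (a k) \<le> W * h / 2 * (2 * (1 - 2 * x))" .
        qed (use v False gx(3) in auto)
        then show "target (a (k - 1)) (a k) \<le> (1 + v) / 2 * W * h * (1 - x * (real m + t))"
          unfolding mv by (simp add: mult_ac)
      qed (use W0 v in auto)
    qed
    show ?thesis using g1 g2 g3 by auto
  next
    case 4
    have nn: "?n = 3" and m3: "m = 3" using 4 by auto
    define W2 where "W2 = two_low ?c ?n ?r"
    define W where "W = three_low ?c ?r"
    have W2: "W2 \<le> (\<Prod>i=1..2. block k (real i))" "1 \<le> W2"
      using G0[of 2] nn many_low_ge_1[OF cl dg(3), of 2 ?r] by (simp_all add: W2_def many_low_def)
    have W: "W \<le> (\<Prod>i=1..3. block k (real i))" "1 \<le> W"
      using G0[of 3] nn many_low_ge_1[OF cl dg(3), of 3 ?r] by (simp_all add: W_def many_low_def)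
    define X where "X = min (w * W2) W"
    have X1: "0 < X" "X \<le> w * W2" "X \<le> W" using W W2 w1 by (auto simp: X_def)
    have "v * X \<le> (\<Prod>i=1..Suc 2. block k (real i + (v - 1)))"
    proof (rule prod_block_negative[OF k1 _ v X1(1)])
      have "w * W2 \<le> block k 1 * (\<Prod>i=1..2. block k (real i))" using w1 W2 by (intro mult_mono) auto
      then show "X \<le> block k 1 * (\<Prod>i=1..2. block k (real i))" using X1 by simp
      have "Suc 2 = 3" by simp
      then show "X \<le> (\<Prod>i=1..Suc 2. block k (real i))" using X1 W by (simp only:)
    qed (use 4 in simp)
    moreover have "Suc 2 = 3" by simp
    ultimately have G: "v * X \<le> G" unfolding G_def tv m3 by (simp only:)
    note tc = three_check[OF dg(1,2), of ?r]
    have Xh: "1 \<le> X * h" "0.95 \<le> X * h * (1 - xx_max (a (k - 1)) (a k) ?n ?r)"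
      using tc by (auto simp: X_def min_def h_def w_def W_def W2_def nn target_def)
    have "xx_max (a (k - 1)) (a k) ?n ?r \<le> 1" using dg by (auto simp: xx_max_def xi_max_def)
    then show ?thesis using fin1[OF G _ Xh(1)] fin[OF G _ _ full Xh(2)] X1 4 by auto
  qed
  then show "1 \<le> R * G" "0.95 \<le> R * G * (1 - \<xi>\<xi> k * \<xi> k * (real m + t))"
    "m < a (Suc k) \<Longrightarrow> target (a (k - 1)) (a k) \<le> R * G * (1 - \<xi> k * (real m + t))"
    unfolding c_def x_def by blast+
qed

end

lemma affine_between:
  fixes u v x l h :: real
  assumes "l \<le> x" "x \<le> h" "0 \<le> u + l * v" "0 \<le> u + h * v"
  shows "0 \<le> u + x * v"
proof (cases "v \<ge> 0")
  case True
  then show ?thesis using assms mult_right_mono[of l x v] by linarith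
next
  case False
  then show ?thesis using assms mult_right_mono_neg[of x h v] by linarith
qed

context sudler_small begin

text \<open>For a full digit the sinc bound degenerates as \<open>t\<close> approaches
  \<open>\<xi> (Suc k)\<close>. Instead the logarithm of the digit product is interpolated between
  shift 0 and that end, where the product telescopes.\<close>

lemma full_interp:
  assumes g: "good k" and t: "0 < t" "t \<le> \<xi> (Suc k)" "t \<le> \<rho> * \<xi> (Suc k)"
    and V: "0 < V" "V \<le> (\<Prod>i=1..a (Suc k). block k (real i))"
    and W: "0 < W" "W \<le> (\<Prod>i=1..a (Suc k). block k (real i + \<xi> (Suc k)))"
    and \<mu>: "0 < \<mu>" "\<mu> \<le> V" "ln \<mu> \<le> (1 - \<rho>) * ln V + \<rho> * ln W"
  shows "\<mu> \<le> (\<Prod>i=1..a (Suc k). block k (real i + t))"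
proof -
  let ?x = "\<xi> (Suc k)" and ?n = "a (Suc k)"
  have x: "0 < ?x" by (rule \<xi>_pos)
  define z where "z = t / ?x"
  have "0 < z" "z \<le> \<rho>" using t x by (auto simp: z_def divide_le_eq)
  then have z: "0 \<le> z" "z \<le> \<rho>" "0 < \<rho>" by auto
  have z': "z \<le> 1" "t = z * ?x + (1 - z) * 0" using t x by (auto simp: z_def)
  have k: "k \<ge> 1" using good_ge[OF g] by simp
  have d: "(real ?n + ?x) * C k < 1" "(real ?n + t) * C k < 1" "(real ?n + 0) * C k < 1" "-1 < ?x" "-1 < t"
  proof -
    show 1: "(real ?n + ?x) * C k < 1" by (rule C_less[OF k])
    have "(real ?n + t) * C k \<le> (real ?n + ?x) * C k" "(real ?n + 0) * C k \<le> (real ?n + ?x) * C k"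
      using t x C_pos[of k] by (intro mult_right_mono; simp)+
    with 1 show "(real ?n + t) * C k < 1" "(real ?n + 0) * C k < 1" by linarith+
  qed (use x t in auto)
  have "ln \<mu> \<le> (1 - z) * ln V + z * ln W"
    using \<mu> V z z' by (intro affine_interp_ge[of z \<rho>]) auto
  also have "\<dots> \<le> (1 - z) * ln (\<Prod>i=1..?n. block k (real i)) + z * ln (\<Prod>i=1..?n. block k (real i + ?x))"
    using V W z z' by (intro add_mono mult_left_mono ln_mono) auto
  also have "\<dots> \<le> ln (\<Prod>i=1..?n. block k (real i + t))"
    using ln_prod_block_concave(1)[OF k d(4,1) _ d(3) z(1) z'(1)] z'(2) by simp
  finally show ?thesis
    using \<mu> ln_prod_block_concave(2)[OF k d(5,2,5,2), of 0] by (simp add: ln_le_cancel_iff)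
qed

text \<open>Same conclusions as \<open>step_negative\<close>, but the shift now leads away from the
  zero of the sine. What has to be covered is the sinc loss and the larger shift
  \<open>m + t\<close> passed on.\<close>

lemma step_positive:
  fixes m :: nat and t R :: real
  assumes g: "good k" and t: "0 < t" "t \<le> \<xi> (Suc k)" and R: "1 \<le> R" "0.95 \<le> R * (1 - \<xi> k * t)"
    and m: "1 \<le> m" "m \<le> a (Suc k)"
  defines "G \<equiv> (\<Prod>i=1..m. block k (real i + t))"
  shows "1 \<le> R * G" "0.95 \<le> R * G * (1 - \<xi>\<xi> k * \<xi> k * (real m + t))"
    and "m < a (Suc k) \<Longrightarrow> target (a (k - 1)) (a k) \<le> R * G * (1 - \<xi> k * (real m + t))"
proof -
  let ?n = "a (Suc k)" and ?r = "knext k" and ?c = "kcls k" and ?\<xi> = "\<xi> (Suc k)"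
  define x where "x = \<xi> k"
  define c where "c = \<xi>\<xi> k"
  note dg = good_digits[OF g] and cl = good_\<theta>(3)[OF g]
  have k1: "k \<ge> 1" using good_ge[OF g] by simp
  note gx = good_x[OF g, folded x_def c_def]
  have xr: "?\<xi> \<le> 19/24" "0 < ?\<xi>" using \<xi>_range[of "Suc k"] good_ge[OF g] \<xi>_pos by auto
  have Rt: "0.95 \<le> R * (1 - x * t)" using R by (simp add: x_def)
  have cm: "c * x * (real m + t) \<le> c" "x * (real m + t) \<le> 1"
    using digit_range[OF g m(2) t(2)] by (auto simp: c_def x_def)
  have R1: "G * Z \<le> R * G * Z" if "0 \<le> G" "0 \<le> Z" for Z
    using R that mult_right_mono[of 1 R "G * Z"] by (simp add: mult.assoc)
  have RG: "1 \<le> R * G" if "1 \<le> G" using R that mult_mono[of 1 R 1 G] by simp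
  consider "m = 1" "?n \<in> {2,3}" | "m = 2" "?n = 3" | "m = ?n" using m dg(3) by fastforce
  then have "1 \<le> R * G \<and> 0.95 \<le> R * G * (1 - c * x * (real m + t))
    \<and> (m < ?n \<longrightarrow> target (a (k - 1)) (a k) \<le> R * G * (1 - x * (real m + t)))"
  proof cases
    case 1
    define N where "N = 1 - 1.645 * (t / (real ?n - 1 + ?\<xi>))\<^sup>2"
    define v where "v = one_low ?c ?n ?r"
    have n2: "real ?n \<ge> 2" using 1 by auto
    have "many_low 1 ?c ?n ?r * (\<Prod>i=1..1. 1 + t / real i) * (1 - 1.645 * (t / (real ?n - real 1 + ?\<xi>))\<^sup>2)
      \<le> (\<Prod>i=1..1. block k (real i + t))"
      using n2 t xr by (intro good_group[OF g]) (use 1 in auto)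
    then have G: "v * ((1 + t) * N) \<le> G" using 1 by (simp add: G_def v_def N_def many_low_def mult.assoc)
    have v1: "1 \<le> v" using many_low_ge_1[OF cl dg(3), of 1 ?r] m by (simp add: v_def many_low_def)
    have os: "1 + 0.27 * t \<le> (1 + t) * N" unfolding N_def using t xr n2 by (intro one_shift_ge) auto
    have N1: "1 \<le> (1 + t) * N" using os t by simp
    have "1 * 1 \<le> v * ((1 + t) * N)" using v1 N1 by (intro mult_mono) auto
    then have G1: "1 \<le> G" using G by simp
    note oc = one_check[OF dg(1,2) 1(2), of ?r, folded v_def]
    have mt: "real m + t = 1 + t" using 1 by simp
    have g2: "0.95 \<le> R * G * (1 - c * x * (real m + t))"
    proof -
      define y where "y = c * x"
      have y: "0 \<le> y" "y \<le> 0.181" "y \<le> xxx_max (a (k - 1)) (a k) ?n ?r" 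
        using mult_pos_pos[OF gx(6,3)] gx(8) order_trans[OF gx(8) oc(2)] by (simp_all add: y_def)
      have yt: "y * t \<le> 0.181 * (19/24)" using y t xr by (intro mult_mono) auto
      have Z: "0 \<le> 1 - y * (1 + t)" using y yt by (simp add: ring_distribs)
      \<comment> \<open>Reduction to shift 0: the surplus \<open>0.27 * t\<close> outweighs the
        additional shift because \<open>y \<le> 0.181\<close>.\<close>
      have "1 - y \<le> (1 + 0.27 * t) * (1 - y * (1 + t))"
      proof -
        have "0 \<le> 0.27 - 0.27 * y - 0.27 * s - y" if "s \<le> 0.181 * (19/24)" for s using y that by simp
        from this[OF yt] have "0 \<le> t * (0.27 - 0.27 * y - 0.27 * (y * t) - y)"
          by (rule mult_nonneg_nonneg[OF less_imp_le[OF t(1)]])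
        then show ?thesis by (simp add: algebra_simps)
      qed
      also have "\<dots> \<le> (1 + t) * N * (1 - y * (1 + t))" using os Z by (intro mult_right_mono) auto
      finally have "v * (1 - y) \<le> v * ((1 + t) * N * (1 - y * (1 + t)))" using v1 by (intro mult_left_mono) auto
      also have "\<dots> = v * ((1 + t) * N) * (1 - y * (1 + t))" by simp
      also have "\<dots> \<le> G * (1 - y * (1 + t))" using G Z by (intro mult_right_mono)
      also have "\<dots> \<le> R * G * (1 - y * (1 + t))" using G1 Z by (intro R1) auto
      finally have "v * (1 - y) \<le> R * G * (1 - y * (1 + t))" .
      moreover have "v * (1 - xxx_max (a (k - 1)) (a k) ?n ?r) \<le> v * (1 - y)" using y v1 by (intro mult_left_mono) auto
      ultimately show ?thesis unfolding mt y_def using oc(1) by linarith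
    qed
    have g3: "target (a (k - 1)) (a k) \<le> R * G * (1 - x * (real m + t))"
    proof -
      define \<kappa> :: real where "\<kappa> = (if ?n = 2 then 0.945 else 1)"
      have kp: "0 < \<kappa>" by (simp add: \<kappa>_def)
      have Nk: "\<kappa> * (1 - x * t) \<le> N" unfolding N_def \<kappa>_def
        using t xr gx(1) 1 by (intro one_shift_ratio) auto
      have Z: "0 \<le> 1 - x * (1 + t)" using cm(2) mt by simp
      have "1 - x \<le> (1 + t) * (1 - x * (1 + t))"
      proof -
        have "x * (2 + t) \<le> x * (?n + ?\<xi>)" using n2 t gx(3) by (intro mult_left_mono) auto
        then have "0 \<le> t * (1 - x * (2 + t))" using t gx(1) by (intro mult_nonneg_nonneg) auto
        then show ?thesis by (simp add: algebra_simps)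
      qed
      moreover have "1 - x_max ?n ?r \<le> 1 - x" using gx(2) by simp
      ultimately have zz: "1 - x_max ?n ?r \<le> (1 + t) * (1 - x * (1 + t))" by linarith
      have "target (a (k - 1)) (a k) \<le> 0.95 * (if ?n = 2 then 0.945 else 1) * v * (1 - x_max ?n ?r)" by (rule oc(3))
      also have "\<dots> = 0.95 * (\<kappa> * v * (1 - x_max ?n ?r))" by (simp add: \<kappa>_def)
      also have "\<dots> \<le> (R * (1 - x * t)) * (\<kappa> * v * ((1 + t) * (1 - x * (1 + t))))"
      proof (rule mult_mono[OF Rt])
        show "\<kappa> * v * (1 - x_max ?n ?r) \<le> \<kappa> * v * ((1 + t) * (1 - x * (1 + t)))"
          using zz kp v1 by (intro mult_left_mono) auto
        have "x_max ?n ?r \<le> 1" using n2 by (auto simp: x_max_def xi_min_def)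
        then show "0 \<le> \<kappa> * v * (1 - x_max ?n ?r)" using kp v1 by auto
      qed (rule order_trans[OF _ Rt], simp)
      also have "\<dots> = R * (v * ((1 + t) * (\<kappa> * (1 - x * t)))) * (1 - x * (1 + t))" by (simp only: mult_ac)
      also have "\<dots> \<le> R * (v * ((1 + t) * N)) * (1 - x * (1 + t))"
        using Nk R v1 t Z by (intro mult_right_mono mult_left_mono) auto
      also have "\<dots> \<le> R * G * (1 - x * (1 + t))" using G R Z by (intro mult_right_mono mult_left_mono) auto
      finally show ?thesis unfolding mt .
    qed
    have "1 \<le> R * G" using RG G1 by simp
    with g2 g3 show ?thesis by blast
  next
    case 2
    define N where "N = 1 - 1.645 * (t / (1 + ?\<xi>))\<^sup>2"
    define W where "W = two_low ?c 3 ?r"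
    have n3: "?n = 3" "m = 2" using 2 by auto
    have "many_low 2 ?c ?n ?r * (\<Prod>i=1..2. 1 + t / real i) * (1 - 1.645 * (t / (real ?n - real 2 + ?\<xi>))\<^sup>2)
      \<le> (\<Prod>i=1..2. block k (real i + t))"
      using t xr by (intro good_group[OF g]) (use n3 in auto)
    moreover have "(\<Prod>i=1..2. 1 + t / real i) = (1 + t) * (1 + t / 2)" by (simp add: numeral_2_eq_2)
    moreover have "real ?n - real 2 + ?\<xi> = 1 + ?\<xi>" using n3 by simp
    ultimately have G: "W * ((1 + t) * (1 + t / 2) * N) \<le> G"
      unfolding N_def W_def G_def n3 by (simp only: many_low_def mult.assoc) simp
    note ts = two_shift_ge[OF less_imp_le[OF t(1)] t(2) xr(1), folded N_def]
    have W1: "1 \<le> W" using many_low_ge_1[OF cl dg(3), of 2 ?r] n3 by (simp add: W_def many_low_def)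
    note tc = two_check[OF dg(1,2), of ?r, folded W_def]
    have "W * 1 \<le> W * ((1 + t) * (1 + t / 2) * N)" using ts(1) W1 by (intro mult_left_mono) auto
    then have GW: "W \<le> G" using G by linarith
    have Zc: "1 - xx_max (a (k - 1)) (a k) 3 ?r \<le> 1 - c * x * (real m + t)" using gx(5) cm n3 by simp
    have x1: "0 \<le> 1 - xx_max (a (k - 1)) (a k) 3 ?r" using dg by (auto simp: xx_max_def xi_max_def)
    have "0.95 \<le> W * (1 - xx_max (a (k - 1)) (a k) 3 ?r)" by (rule tc(8))
    also have "\<dots> \<le> G * (1 - c * x * (real m + t))" using GW Zc W1 x1 by (intro mult_mono) auto
    also have "\<dots> \<le> R * G * (1 - c * x * (real m + t))" using GW W1 Zc x1 by (intro R1) auto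
    finally have g2: "0.95 \<le> R * G * (1 - c * x * (real m + t))" .
    have x3: "x * (3 + ?\<xi>) = 1" using gx(1) n3 by simp
    have Z: "1 - x * (real m + t) = x * (1 + ?\<xi> - t)"
    proof -
      have "x * (1 + ?\<xi> - t) = x * (3 + ?\<xi>) - x * (2 + t)" by (simp add: algebra_simps)
      then show ?thesis using x3 n3 by simp
    qed
    have g3: "target (a (k - 1)) (a k) \<le> R * G * (1 - x * (real m + t))"
    proof -
      have "(1 + xi_min ?r) / (3 + xi_min ?r) = 1 - 2 * x_max 3 ?r" by (auto simp: x_max_def xi_min_def)
      also have "\<dots> \<le> 1 - 2 * x" using gx(2) n3 by simp
      also have "\<dots> = x * (1 + ?\<xi>)" using x3 by (simp add: algebra_simps)
      finally have f: "(1 + xi_min ?r) / (3 + xi_min ?r) \<le> x * (1 + ?\<xi>)" .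
      have "target (a (k - 1)) (a k) \<le> W * 0.94 * ((1 + xi_min ?r) / (3 + xi_min ?r))" using tc(7) by simp
      also have "\<dots> \<le> W * 0.94 * (x * (1 + ?\<xi>))" using f W1 by (intro mult_left_mono) auto
      also have "\<dots> = W * x * (0.94 * (1 + ?\<xi>))" by (simp only: mult_ac)
      also have "\<dots> \<le> W * x * ((1 + t) * (1 + t / 2) * N * (1 + ?\<xi> - t))"
        using ts(2) W1 gx(3) by (intro mult_left_mono) auto
      also have "\<dots> = W * ((1 + t) * (1 + t / 2) * N) * (x * (1 + ?\<xi> - t))" by (simp only: mult_ac)
      also have "\<dots> \<le> G * (x * (1 + ?\<xi> - t))" using G t gx(3) by (intro mult_right_mono) auto
      also have "\<dots> \<le> R * G * (x * (1 + ?\<xi> - t))" using GW W1 t gx(3) by (intro R1) auto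
      finally show ?thesis unfolding Z .
    qed
    have "1 \<le> R * G" using RG GW W1 by simp
    with g2 g3 show ?thesis by blast
  next
    case 3
    define V where "V = many_low ?n ?c ?n ?r"
    define W where "W = xi_low (a (k - 1)) (a k) ?n ?r"
    have V: "1 \<le> V" "V \<le> (\<Prod>i=1..?n. block k (real i))"
      using many_low_ge_1[OF cl dg(3) dg(3)] good_group_0[OF g dg(3)] by (auto simp: V_def)
    have W: "W \<le> (\<Prod>i=1..?n. block k (real i + ?\<xi>))" using good_full[OF g] by (simp add: W_def)
    have V0: "0 < V" using V by simp
    have interp: "\<mu> \<le> G" if "t \<le> \<rho> * ?\<xi>" "0 < W" "0 < \<mu>" "\<mu> \<le> V" "ln \<mu> \<le> (1 - \<rho>) * ln V + \<rho> * ln W" for \<mu> \<rho>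
      unfolding G_def 3 by (rule full_interp[OF g t that(1) V0 V(2) that(2) W that(3,4,5)])
    have Zc: "0 \<le> 1 - c * x * (real m + t)" using cm gx by linarith
    have key: "0.95 \<le> R * G * (1 - c * x * (real m + t))"
      if "\<mu> \<le> G" "1 - x * t \<le> \<mu> * (1 - c * x * (real m + t))" for \<mu>
    proof -
      have "R * (1 - x * t) \<le> R * (\<mu> * (1 - c * x * (real m + t)))" using that R by (intro mult_left_mono) auto
      also have "\<dots> \<le> R * (G * (1 - c * x * (real m + t)))" using that R Zc by (intro mult_left_mono mult_right_mono) auto
      finally have "0.95 \<le> R * (G * (1 - c * x * (real m + t)))" by (rule order_trans[OF Rt])
      then show ?thesis by (simp only: mult.assoc)
    qed
    have "1 \<le> R * G \<and> 0.95 \<le> R * G * (1 - c * x * (real m + t))"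
    proof (cases "?n = 1 \<and> a k = 1")
      case False
      note xc = xi_check[OF dg(1,2,3) False, of ?r, folded V_def W_def]
      define \<mu> where "\<mu> = min V W"
      define s where "s = ?n * x_max ?n ?r * xx_max (a (k - 1)) (a k) ?n ?r"
      have mu: "1 \<le> \<mu>" "1 \<le> \<mu> * (1 - s)" using xc by (auto simp: \<mu>_def s_def min_def)
      have mG: "\<mu> \<le> G"
        using mu(1) t xc(1) by (intro interp[of 1]) (auto simp: \<mu>_def min_def)
      have "real m * x * c \<le> s" unfolding s_def 3 using gx by (intro mult_mono) auto
      then have "\<mu> * (1 - s) \<le> \<mu> * (1 - m * x * c)" using mu by (intro mult_left_mono) auto
      then have mu2: "1 \<le> \<mu> * (1 - m * x * c)" using mu by linarith
      have "x * t \<le> x * (real m + t)" using gx(3) by (intro mult_left_mono) auto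
      then have xt: "0 \<le> 1 - x * t" using cm(2) by linarith
      have nx: "real m * x \<le> 1" using gx(1) 3 mult_pos_pos[OF gx(3) xr(2)] by (simp add: algebra_simps)
      \<comment> \<open>Separates the hypothesis factor \<open>1 - x * t\<close> from one
        independent of \<open>t\<close>; this needs \<open>c \<le> 1/2\<close> and
        \<open>m * x \<le> 1\<close>.\<close>
      have le: "(1 - x * t) * (1 - m * x * c) \<le> 1 - c * x * (real m + t)"
      proof -
        have "c * (1 + real m * x) \<le> 1/2 * 2" using gx nx by (intro mult_mono) auto
        then have "0 \<le> x * t * (1 - c * (1 + real m * x))" using gx t by (intro mult_nonneg_nonneg) auto
        then show ?thesis by (simp add: algebra_simps)
      qed
      have "1 - x * t \<le> (1 - x * t) * (\<mu> * (1 - m * x * c))" using mult_left_mono[OF mu2 xt] by simp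
      also have "\<dots> = \<mu> * ((1 - x * t) * (1 - m * x * c))" by simp
      also have "\<dots> \<le> \<mu> * (1 - c * x * (real m + t))" using le mu by (intro mult_left_mono) auto
      finally have "0.95 \<le> R * G * (1 - c * x * (real m + t))" by (rule key[OF mG])
      moreover have "1 \<le> R * G" using RG mG mu by simp
      ultimately show ?thesis by blast
    next
      case True
      \<comment> \<open>Since \<open>xi_low\<close> may be below 1 here, one constant bound does not
        serve all \<open>t\<close>. The range is cut at 1/2 and 3/4 of \<open>\<xi> (Suc k)\<close>;
        on later pieces a weaker bound suffices because \<open>1 - x * t\<close> is smaller.\<close>
      let ?al2 = "a (k - 1)"
      have VW: "V = one_low (cls 1 ?al2) 1 ?r" "W = xi_low ?al2 1 1 ?r"
        using True by (simp_all add: V_def W_def many_low_def)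
      note mc = mu_check[OF dg(1), where r = ?r, folded VW]
      define c0 where "c0 = xx_max ?al2 1 1 ?r"
      have c0: "c \<le> c0" using gx(5) True by (simp add: c0_def)
      have m1: "m = 1" using 3 True by simp
      have xA: "x * (1 + ?\<xi>) = 1" using gx(1) True by simp
      have lin: "1 - x * t \<le> mu_low i ?al2 ?r * (1 - c * x * (real m + t))"
        if i: "i \<in> {0,1,2}" "([0, 1/2, 3/4] ! i) * ?\<xi> \<le> t" for i
      proof -
        define u where "u = mu_low i ?al2 ?r"
        define z :: real where "z = [0, 1/2, 3/4] ! i"
        note ml = mu_check_linear[OF dg(1) i(1), where r = ?r, folded u_def z_def c0_def]
        have "0 \<le> (u * (1 - c0) - 1) + ?\<xi> * (u - 1 + z * (1 - u * c0))"
          by (rule affine_between[OF good_\<xi>[OF g]]) (use ml(1) in auto)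
        moreover have "z * ?\<xi> * (1 - u * c0) \<le> t * (1 - u * c0)"
          using i(2) ml(2)[OF disjI1[OF refl]] by (intro mult_right_mono) (auto simp: z_def)
        ultimately have "0 \<le> u * (1 + ?\<xi> - c0 * (1 + t)) - (1 + ?\<xi> - t)" by (simp add: algebra_simps)
        moreover have "u * (c * (1 + t)) \<le> u * (c0 * (1 + t))"
          using c0 t ml(3)[OF disjI1[OF refl]] by (intro mult_left_mono mult_right_mono) auto
        ultimately have "0 \<le> u * (1 + ?\<xi> - c * (1 + t)) - (1 + ?\<xi> - t)" by (simp add: algebra_simps)
        then have "0 \<le> x * (u * (1 + ?\<xi> - c * (1 + t)) - (1 + ?\<xi> - t))" using gx(3) by simp
        also have "\<dots> = u * (x * (1 + ?\<xi>) - c * x * (1 + t)) - (x * (1 + ?\<xi>) - x * t)" by (simp add: algebra_simps)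
        finally show ?thesis unfolding xA u_def m1 by simp
      qed
      have mu0: "0 < mu_low i ?al2 ?r" if "i \<in> {0,1,2}" for i
        using mu_check_linear(3)[OF dg(1) that disjI1[OF refl], where r = ?r] .
      have "\<exists>i\<in>{0,1,2}. ([0, 1/2, 3/4] ! i) * ?\<xi> \<le> t \<and> mu_low i ?al2 ?r \<le> G"
      proof -
        consider "t \<le> 1/2 * ?\<xi>" | "1/2 * ?\<xi> \<le> t" "t \<le> 3/4 * ?\<xi>" | "3/4 * ?\<xi> \<le> t" by linarith
        then show ?thesis
        proof cases
          case 1
          have "2 * ln (mu_low 0 ?al2 ?r) = ln ((mu_low 0 ?al2 ?r)\<^sup>2)" using mu0[of 0] by (simp add: ln_realpow)
          also have "\<dots> \<le> ln (V * W)" using mc(3) mu0[of 0] by (intro ln_mono) auto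
          also have "\<dots> = ln V + ln W" using V0 mc(1) by (simp add: ln_mult_pos)
          finally have "mu_low 0 ?al2 ?r \<le> G"
            using mc(1) mc(2)[of 0] mu0[of 0] 1 by (intro interp[of "1/2"]) auto
          then show ?thesis using t by (intro bexI[of _ 0]) auto
        next
          case 2
          have "4 * ln (mu_low 1 ?al2 ?r) = ln (mu_low 1 ?al2 ?r ^ 4)" using mu0[of 1] by (simp add: ln_realpow)
          also have "\<dots> \<le> ln (V * W ^ 3)" using mc(4) mu0[of 1] by (intro ln_mono) auto
          also have "\<dots> = ln V + 3 * ln W" using V0 mc(1) by (simp add: ln_mult_pos ln_realpow)
          finally have "mu_low 1 ?al2 ?r \<le> G"
            using mc(1) mc(2)[of 1] mu0[of 1] 2 by (intro interp[of "3/4"]) auto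
          then show ?thesis using 2 by (intro bexI[of _ 1]) auto
        next
          case 3
          have "mu_low 2 ?al2 ?r \<le> G"
            using mc(1,5) mc(2)[of 2] mu0[of 2] t by (intro interp[of 1]) auto
          then show ?thesis using 3 by (intro bexI[of _ 2]) auto
        qed
      qed
      then obtain i where i: "i \<in> {0,1,2}" "([0, 1/2, 3/4] ! i) * ?\<xi> \<le> t" "mu_low i ?al2 ?r \<le> G" by blast
      have g2: "0.95 \<le> R * G * (1 - c * x * (real m + t))" by (rule key[OF i(3) lin[OF i(1,2)]])
      have G0: "0 \<le> G" using i(3) mu0[OF i(1)] by linarith
      \<comment> \<open>As \<open>c * x\<close> exceeds 1/20, the factor next to
        \<open>R * G\<close> in \<open>g2\<close> is at most 0.95, so \<open>g2\<close> itself
        yields \<open>1 \<le> R * G\<close>.\<close>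
      have "1/7 \<le> c"
      proof -
        have "x \<le> 1" using \<xi>_less_1[OF k1] by (simp add: x_def)
        then have "real ?al2 * (1 + x) \<le> 3 * 2" using dg(1) gx(3) by (intro mult_mono) auto
        then show ?thesis unfolding gx(4) using True gx(3) by (simp add: field_simps add_pos_nonneg)
      qed
      moreover have "24/43 \<le> x"
      proof -
        have "x * (1 + ?\<xi>) \<le> x * (43/24)" using xr gx(3) by (intro mult_left_mono) auto
        then show ?thesis using xA by linarith
      qed
      ultimately have "1/7 * (24/43) \<le> c * x" by (intro mult_mono) auto
      moreover have "c * x * 1 \<le> c * x * (real m + t)" using gx m1 t by (intro mult_left_mono) auto
      ultimately have "1 - c * x * (real m + t) \<le> 0.95" by simp
      then have "R * G * (1 - c * x * (real m + t)) \<le> R * G * 0.95" using R G0 by (intro mult_left_mono) auto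
      then have "1 \<le> R * G" using g2 by simp
      with g2 show ?thesis by blast
    qed
    then show ?thesis using 3 by auto
  qed
  then show "1 \<le> R * G" "0.95 \<le> R * G * (1 - \<xi>\<xi> k * \<xi> k * (real m + t))"
    "m < a (Suc k) \<Longrightarrow> target (a (k - 1)) (a k) \<le> R * G * (1 - \<xi> k * (real m + t))"
    unfolding c_def x_def by blast+
qed

end

section \<open>The descent over Ostrowski digits\<close>

context sudler_cfrac begin

abbreviation shifted_prod :: "nat \<Rightarrow> real \<Rightarrow> real" where
  "shifted_prod M \<sigma> \<equiv> (\<Prod>r=1..M. 2 * \<bar>sin (pi * (real r * \<alpha> + \<sigma>))\<bar>)"

lemma shifted_prod_split:
  "shifted_prod (m + M) \<sigma> = shifted_prod m \<sigma> * shifted_prod M (real m * \<alpha> + \<sigma>)"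
proof -
  have "{1..m + M} = {1..m} \<union> {m + 1..m + M}" by auto
  then have "shifted_prod (m + M) \<sigma> = shifted_prod m \<sigma> * (\<Prod>r=m + 1..m + M. 2 * \<bar>sin (pi * (real r * \<alpha> + \<sigma>))\<bar>)"
    by (simp add: prod.union_disjoint)
  also have "(\<Prod>r=m + 1..m + M. 2 * \<bar>sin (pi * (real r * \<alpha> + \<sigma>))\<bar>)
    = (\<Prod>r=1..M. 2 * \<bar>sin (pi * (real (r + m) * \<alpha> + \<sigma>))\<bar>)"
    using prod.shift_bounds_cl_nat_ivl[of "\<lambda>r. 2 * \<bar>sin (pi * (real r * \<alpha> + \<sigma>))\<bar>" 1 m M]
    by (simp only: add.commute)
  also have "\<dots> = shifted_prod M (real m * \<alpha> + \<sigma>)" by (simp add: algebra_simps)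
  finally show ?thesis .
qed

lemma shifted_prod_nonneg: "0 \<le> shifted_prod M \<sigma>"
  by (intro prod_nonneg) auto

lemma shifted_prod_le: "shifted_prod M \<sigma> \<le> 2 ^ M"
proof -
  have "shifted_prod M \<sigma> \<le> (\<Prod>r=1..M. 2)" by (intro prod_mono) auto
  then show ?thesis by simp
qed

text \<open>The product is completed to \<open>q k - 1\<close> factors, each missing factor being at
  most 2; the complete one is smallest at the extreme shift \<open>S\<close>. The bound is crude but
  independent of \<open>M\<close> and \<open>s\<close>.\<close>

lemma shifted_prod_ge:
  assumes k: "k \<ge> 1" and s: "0 \<le> s" "s \<le> S" "1 \<le> S" "S * C k < 1" and M: "M < q k"
    and \<sigma>: "(-1) ^ k * \<sigma> - \<delta> k * (s - 1) \<in> \<int>"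
  shows "shifted_prod M \<sigma> \<ge> exp (block_log (q k) (sp k) (C k) (C k * (S - 1/2))) / 2 ^ q k"
proof -
  have "s * C k \<le> S * C k" using s C_pos[of k] by (intro mult_right_mono) auto
  then have sC: "s * C k < 1" using s by linarith
  have "\<bar>C k * (s - 1/2)\<bar> \<le> \<bar>C k * (S - 1/2)\<bar>"
    unfolding abs_mult using s by (intro mult_left_mono) auto
  then have "exp (block_log (q k) (sp k) (C k) (C k * (S - 1/2))) \<le> exp (block_log (q k) (sp k) (C k) (C k * (s - 1/2)))"
    using block_log_antimono_abs[OF coprime_sp q_pos level_admissible[OF k _ s(4)]] s by simp
  also have "\<dots> = shifted_prod (q k - 1) \<sigma>"
  proof -
    have "{1..<q k} = {1..q k - 1}" using q_pos[of k] by auto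
    then show ?thesis using prod_block_lower[OF k s(1) sC \<sigma>] by simp
  qed
  also have "\<dots> = shifted_prod M \<sigma> * shifted_prod (q k - 1 - M) (real M * \<alpha> + \<sigma>)"
    using shifted_prod_split[where m = M and M = "q k - 1 - M" and \<sigma> = \<sigma>] M by simp
  also have "\<dots> \<le> shifted_prod M \<sigma> * 2 ^ (q k - 1 - M)"
    by (intro mult_left_mono shifted_prod_le shifted_prod_nonneg)
  also have "\<dots> \<le> shifted_prod M \<sigma> * 2 ^ q k"
    by (intro mult_left_mono power_increasing shifted_prod_nonneg) auto
  finally show ?thesis by (simp add: divide_le_eq)
qed

end

context sudler_small begin

text \<open>\<open>M\<close> is the number of remaining factors, \<open>t\<close> the accumulated shift in units of \<open>\<delta> k\<close> and
  \<open>R\<close> the product of the blocks that have already been split off. A shift towards a zero of the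
  sine must have been paid for by a large \<open>R\<close>.\<close>

definition level_inv :: "nat \<Rightarrow> real \<Rightarrow> nat \<Rightarrow> real \<Rightarrow> bool" where
  "level_inv k t M R \<longleftrightarrow> -1 \<le> t \<and> t \<le> \<xi> (Suc k) \<and> 1 \<le> R
     \<and> (t < 0 \<longrightarrow> (q k \<le> M \<longrightarrow> target (a k) (a (Suc k)) \<le> R * (1 + t) \<and> \<xi> (Suc k) - 1 \<le> t)
          \<and> 0.95 \<le> R * (1 + \<xi> k * \<xi> (k - 1) * t))
     \<and> (0 < t \<longrightarrow> 0.95 \<le> R * (1 - \<xi> k * t))"

text \<open>The clauses of \<open>level_inv\<close> are shaped to survive a zero digit, when the
  shift merely becomes \<open>- \<xi> k * t\<close>. The clause for positive \<open>t\<close> then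
  yields the target clause, as no target exceeds 0.95, and the clause with
  \<open>\<xi> k * \<xi> (k - 1)\<close> turns into the one for positive shifts.\<close>

lemma level_inv_step:
  assumes g: "good k" and I: "level_inv k t M R" and M: "M < q (Suc k)"
    and \<sigma>: "(-1) ^ k * \<sigma> - \<delta> k * t \<in> \<int>"
  obtains t' R' \<sigma>' where "level_inv (k - 1) t' (M mod q k) R'" "(-1) ^ (k - 1) * \<sigma>' - \<delta> (k - 1) * t' \<in> \<int>"
    "R * shifted_prod M \<sigma> = R' * shifted_prod (M mod q k) \<sigma>'"
proof
  define b where "b = M div q k"
  define G where "G = (\<Prod>i=1..b. block k (real i + t))"
  define t' where "t' = - (\<xi> k * (real b + t))"
  let ?\<sigma>' = "real (b * q k) * \<alpha> + \<sigma>" and ?n = "a (Suc k)" and ?\<xi> = "\<xi> (Suc k)"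
  have k1: "k \<ge> 1" and k2: "k \<ge> 2" using good_ge[OF g] by auto
  have Mb: "M = b * q k + M mod q k" unfolding b_def by (rule div_mult_mod_eq[symmetric])
  have rec: "q (Suc k) = ?n * q k + q (k - 1)" using q_rec[of "k - 1"] k1 by simp
  have "q (Suc k) \<le> Suc ?n * q k" unfolding rec using q_mono_Suc[of "k - 1"] k1 by simp
  then have "M < Suc ?n * q k" using M by linarith
  then have bn: "b \<le> ?n" unfolding b_def using less_mult_imp_div_less[of M "Suc ?n" "q k"] by simp
  \<comment> \<open>The Ostrowski rule: a full digit leaves fewer than \<open>q (k - 1)\<close>
    factors, so the next digit is 0.\<close>
  have bn': "b < ?n" if "q (k - 1) \<le> M mod q k"
  proof (rule ccontr)
    assume "\<not> b < ?n"
    then have "b = ?n" using bn by simp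
    then show False using Mb M rec that by simp
  qed
  have t: "-1 \<le> t" "t \<le> ?\<xi>" and R: "1 \<le> R" using I by (auto simp: level_inv_def)
  have \<xi>p: "0 < ?\<xi>" "?\<xi> < 1" "0 < \<xi> k" "0 < \<xi> (k - 1)" using \<xi>_pos \<xi>_less_1[of "Suc k"] by auto
  note dr = digit_range[OF g _ t(2)]
  have tneg: "?\<xi> - 1 \<le> t \<and> target (a k) ?n \<le> R * (1 + t)" if "b \<ge> 1" "t \<le> 0"
  proof (cases "t = 0")
    case True
    then show ?thesis using \<xi>p R target_bounds(2)[of "a k" ?n] by simp
  next
    case False
    have "q k \<le> M" using that(1) Mb by (metis b_def div_less not_less not_one_le_zero)
    then show ?thesis using I False that by (simp add: level_inv_def)
  qed
  have t1: "-1 < t" if "b \<ge> 1" using tneg[OF that] \<xi>p by (cases "t \<le> 0") auto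
  have bC: "(real b + t) * C k < 1"
  proof -
    have "(real b + t) * C k \<le> (?n + ?\<xi>) * C k" using bn t C_pos[of k] by (intro mult_right_mono) auto
    then show ?thesis using C_less[OF k1] by linarith
  qed
  have G: "shifted_prod (b * q k) \<sigma> = G"
  proof (cases "b = 0")
    case False
    then show ?thesis unfolding G_def using t1 bC by (intro prod_digit[OF k1 _ _ \<sigma>]) auto
  qed (simp add: G_def)
  show "R * shifted_prod M \<sigma> = (R * G) * shifted_prod (M mod q k) ?\<sigma>'"
    using shifted_prod_split[where m = "b * q k" and M = "M mod q k" and \<sigma> = \<sigma>] G Mb by simp
  show "(-1) ^ (k - 1) * ?\<sigma>' - \<delta> (k - 1) * t' \<in> \<int>"
  proof -
    have "\<delta> (k - 1) * t' = - (\<delta> k * (real b + t))" using \<delta>_pos[of "k - 1"] by (simp add: t'_def \<xi>_def)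
    moreover have "(-1) ^ (k - 1) * ?\<sigma>' = - (real b * ((-1) ^ k * (real (q k) * \<alpha>)) + (-1) ^ k * \<sigma>)"
      using k1 by (cases k) (auto simp: algebra_simps)
    ultimately have "(-1) ^ (k - 1) * ?\<sigma>' - \<delta> (k - 1) * t' = - (((-1) ^ k * \<sigma> - \<delta> k * t) + of_int (int b * sp k))"
      unfolding level_shift by (simp add: algebra_simps)
    also have "\<dots> \<in> \<int>" using \<sigma> by (intro Ints_minus Ints_add) auto
    finally show ?thesis .
  qed
  have Sk: "Suc (k - 1) = k" "k - 1 - 1 = k - 2" using k2 by auto
  show "level_inv (k - 1) t' (M mod q k) (R * G)"
  proof (cases "b = 0")
    case True
    have G1: "G = 1" using True by (simp add: G_def)
    have t': "t' = - (\<xi> k * t)" using True by (simp add: t'_def)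
    have sgn: "t' < 0 \<longleftrightarrow> 0 < t" "0 < t' \<longleftrightarrow> t < 0" unfolding t' using \<xi>p by (auto simp: zero_less_mult_iff mult_less_0_iff)
    have "\<xi> k * (real 0 + t) \<le> 1" by (rule dr(1)) simp
    moreover have "\<xi> k * (-1) \<le> \<xi> k * t" using t \<xi>p by (intro mult_left_mono) auto
    moreover have "0.95 \<le> R * (1 + t') \<and> \<xi> k - 1 \<le> t' \<and> 0.95 \<le> R * (1 + \<xi>\<xi> k * t')" if "0 < t"
    proof -
      have h: "0.95 \<le> R * (1 - \<xi> k * t)" using I that by (simp add: level_inv_def)
      have "\<xi> k * (real 1 + t) \<le> 1" using a_pos[of "Suc k"] by (intro dr(1)) auto
      moreover have "1 - \<xi> k * t \<le> 1 + \<xi>\<xi> k * t'"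
        using mult_right_mono[of "\<xi>\<xi> k" 1 "\<xi> k * t"] good_x(7)[OF g] \<xi>p that by (simp add: t')
      then have "R * (1 - \<xi> k * t) \<le> R * (1 + \<xi>\<xi> k * t')" using R by (intro mult_left_mono) auto
      ultimately show ?thesis using h by (simp add: t' algebra_simps)
    qed
    moreover have "0.95 \<le> R * (1 - \<xi> (k - 1) * t')" if "t < 0"
      using I that by (simp add: level_inv_def t' algebra_simps)
    ultimately show ?thesis
      unfolding level_inv_def Sk G1 sgn using R target_bounds(2)[of "a (k - 1)" "a k"] by (auto simp: t')
  next
    case False
    then have b1: "1 \<le> b" by simp
    have bt: "0 < real b + t" using t1[OF b1] b1 by simp
    have t'neg: "t' < 0" using bt \<xi>p by (simp add: t'_def)
    have "1 \<le> R * G \<and> 0.95 \<le> R * G * (1 - \<xi>\<xi> k * \<xi> k * (real b + t))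
      \<and> (b < ?n \<longrightarrow> target (a (k - 1)) (a k) \<le> R * G * (1 - \<xi> k * (real b + t)))"
    proof (cases "t \<le> 0")
      case True
      then show ?thesis using step_negative[OF g _ True R _ b1 bn] tneg[OF b1 True] by (simp add: G_def)
    next
      case False
      then have "0 < t" "0.95 \<le> R * (1 - \<xi> k * t)" using I by (auto simp: level_inv_def)
      then show ?thesis using step_positive[OF g _ t(2) R _ b1 bn] by (simp add: G_def)
    qed
    moreover have "-1 \<le> t'" using dr(1)[OF bn] by (simp add: t'_def)
    moreover have "\<xi> k - 1 \<le> t'" if "b < ?n"
    proof -
      have "\<xi> k * (real (Suc b) + t) \<le> 1" using that by (intro dr(1)) auto
      then show ?thesis by (simp add: t'_def algebra_simps)
    qed
    ultimately show ?thesis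
      unfolding level_inv_def Sk using t'neg \<xi>p bn'[unfolded Sk] by (auto simp: t'_def algebra_simps)
  qed
qed

text \<open>At a fixed level any positive constant will do. If \<open>M \<ge> q k\<close>, the
  product is regarded at level \<open>Suc k\<close>, where the shift is
  \<open>- t / \<xi> (Suc k)\<close>; the clause \<open>\<xi> (Suc k) - 1 \<le> t\<close> keeps it
  within range.\<close>

lemma shifted_prod_base:
  assumes k: "k \<ge> 1"
  obtains c where "c > 0" "\<And>t M R \<sigma>. level_inv k t M R \<Longrightarrow> M < q (Suc k) \<Longrightarrow> (-1) ^ k * \<sigma> - \<delta> k * t \<in> \<int>
    \<Longrightarrow> c \<le> R * shifted_prod M \<sigma>"
proof
  let ?\<xi> = "\<xi> (Suc k)"
  define c1 where "c1 = exp (block_log (q k) (sp k) (C k) (C k * (1 + ?\<xi> - 1/2))) / 2 ^ q k"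
  define c2 where "c2 = exp (block_log (q (Suc k)) (sp (Suc k)) (C (Suc k)) (C (Suc k) * (1 / ?\<xi> - 1/2))) / 2 ^ q (Suc k)"
  have \<xi>p: "0 < ?\<xi>" "?\<xi> < 1" using \<xi>_pos \<xi>_less_1[of "Suc k"] by auto
  show "0 < min c1 c2" by (simp add: c1_def c2_def)
  fix t M R \<sigma>
  assume I: "level_inv k t M R" and M: "M < q (Suc k)" and \<sigma>: "(-1) ^ k * \<sigma> - \<delta> k * t \<in> \<int>"
  have t: "-1 \<le> t" "t \<le> ?\<xi>" "1 \<le> R" using I by (auto simp: level_inv_def)
  have "min c1 c2 \<le> shifted_prod M \<sigma>"
  proof (cases "M < q k")
    case True
    have "1 + ?\<xi> \<le> a (Suc k) + ?\<xi>" using a_pos[of "Suc k"] by simp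
    then have "(1 + ?\<xi>) * C k \<le> (a (Suc k) + ?\<xi>) * C k" using C_pos[of k] by (intro mult_right_mono) auto
    then have "(1 + ?\<xi>) * C k < 1" using C_less[OF k] by linarith
    then have "c1 \<le> shifted_prod M \<sigma>" unfolding c1_def
      using t \<xi>p True \<sigma> by (intro shifted_prod_ge[OF k, of "1 + t"]) auto
    then show ?thesis by simp
  next
    case False
    have tl: "?\<xi> - 1 \<le> t" using I False \<xi>p by (cases "t < 0") (auto simp: level_inv_def)
    have e: "1 / ?\<xi> = a (Suc (Suc k)) + \<xi> (Suc (Suc k))" using \<xi>_eq[of k] by simp
    have "c2 \<le> shifted_prod M \<sigma>" unfolding c2_def
    proof (rule shifted_prod_ge[where s = "1 - t / ?\<xi>"])
      show "1 / ?\<xi> * C (Suc k) < 1" unfolding e by (rule C_less) simp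
      have "1 - t / ?\<xi> = (?\<xi> - t) / ?\<xi>" using \<xi>p by (simp add: diff_divide_distrib)
      also have "\<dots> \<le> 1 / ?\<xi>" using tl \<xi>p by (intro divide_right_mono) auto
      finally show "1 - t / ?\<xi> \<le> 1 / ?\<xi>" .
      show "0 \<le> 1 - t / ?\<xi>" "1 \<le> 1 / ?\<xi>" using t \<xi>p by auto
      have "\<delta> (Suc k) * (1 - t / ?\<xi> - 1) = - (\<delta> k * t)"
        using \<delta>_pos[of k] \<delta>_pos[of "Suc k"] by (simp add: \<xi>_def)
      then have "(-1) ^ Suc k * \<sigma> - \<delta> (Suc k) * (1 - t / ?\<xi> - 1) = - ((-1) ^ k * \<sigma> - \<delta> k * t)" by simp
      then show "(-1) ^ Suc k * \<sigma> - \<delta> (Suc k) * (1 - t / ?\<xi> - 1) \<in> \<int>" using \<sigma> Ints_minus by metis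
    qed (use M in auto)
    then show ?thesis by simp
  qed
  also have "\<dots> \<le> R * shifted_prod M \<sigma>" using t shifted_prod_nonneg mult_right_mono[of 1 R "shifted_prod M \<sigma>"] by simp
  finally show "min c1 c2 \<le> R * shifted_prod M \<sigma>" .
qed

lemma shifted_prod_lower:
  obtains c k0 where "c > 0" "good k0" "\<And>k t M R \<sigma>. k \<ge> k0 \<Longrightarrow> level_inv k t M R \<Longrightarrow> M < q (Suc k)
    \<Longrightarrow> (-1) ^ k * \<sigma> - \<delta> k * t \<in> \<int> \<Longrightarrow> c \<le> R * shifted_prod M \<sigma>"
proof -
  obtain k0 where k0: "good k0" using good_exists by blast
  have "k0 \<ge> 1" using good_ge[OF k0] by simp
  then obtain c where c: "c > 0" "\<And>t M R \<sigma>. level_inv k0 t M R \<Longrightarrow> M < q (Suc k0) \<Longrightarrow> (-1) ^ k0 * \<sigma> - \<delta> k0 * t \<in> \<int>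
    \<Longrightarrow> c \<le> R * shifted_prod M \<sigma>" by (rule shifted_prod_base) blast
  have "c \<le> R * shifted_prod M \<sigma>"
    if "k \<ge> k0" "level_inv k t M R" "M < q (Suc k)" "(-1) ^ k * \<sigma> - \<delta> k * t \<in> \<int>" for k t M R \<sigma>
    using that
  proof (induction k arbitrary: t M R \<sigma> rule: dec_induct)
    case base
    then show ?case by (intro c(2)) auto
  next
    case (step k)
    have "good (Suc k)" using step.hyps by (intro good_mono[OF k0]) auto
    then obtain t' R' \<sigma>' where s: "level_inv k t' (M mod q (Suc k)) R'" "(-1) ^ k * \<sigma>' - \<delta> k * t' \<in> \<int>"
      "R * shifted_prod M \<sigma> = R' * shifted_prod (M mod q (Suc k)) \<sigma>'"
      using level_inv_step[OF _ step.prems] by (metis diff_Suc_1)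
    have "M mod q (Suc k) < q (Suc k)" using q_pos[of "Suc k"] by simp
    then show ?case unfolding s(3) using s by (intro step.IH) auto
  qed
  then show ?thesis using that c(1) k0 by blast
qed

lemma sudler_eq: "sudler \<alpha> N = shifted_prod N 0"
  by (simp add: sudler_def mult.assoc)

lemma q_unbounded: "\<exists>k\<ge>k0. N < q (Suc k)"
proof -
  have "mono q" by (intro mono_iff_le_Suc[THEN iffD2] allI q_mono_Suc)
  then have "q (2 * N) \<le> q (Suc (2 * N + k0))" by (rule monoD) simp
  then have "N < q (Suc (2 * N + k0))" using q_ge[of N] by linarith
  then show ?thesis by (intro exI[of _ "2 * N + k0"]) auto
qed

lemma sudler_lower: "\<exists>c>0. \<forall>N. c \<le> sudler \<alpha> N"
proof -
  obtain c k0 where c: "c > 0" "\<And>k t M R \<sigma>. k \<ge> k0 \<Longrightarrow> level_inv k t M R \<Longrightarrow> M < q (Suc k)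
    \<Longrightarrow> (-1) ^ k * \<sigma> - \<delta> k * t \<in> \<int> \<Longrightarrow> c \<le> R * shifted_prod M \<sigma>"
    by (rule shifted_prod_lower) blast
  have "c \<le> sudler \<alpha> N" for N
  proof -
    obtain k where k: "k \<ge> k0" "N < q (Suc k)" using q_unbounded by blast
    have "level_inv k 0 N 1" using \<xi>_pos[of "Suc k"] by (simp add: level_inv_def)
    then have "c \<le> 1 * shifted_prod N 0" using k by (intro c(2)) auto
    then show ?thesis by (simp only: sudler_eq mult_1)
  qed
  with c(1) show ?thesis by blast
qed

text \<open>The product over \<open>N < r < q (k + 1)\<close> is the reflection of a shifted product, so that its
  lower bound becomes an upper bound for the product over \<open>r \<le> N\<close>.\<close>

lemma sudler_upper: "\<exists>c N0. \<forall>N\<ge>N0. sudler \<alpha> N \<le> c * real N"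
proof -
  obtain c k0 where c: "c > 0" "good k0" "\<And>k t M R \<sigma>. k \<ge> k0 \<Longrightarrow> level_inv k t M R \<Longrightarrow> M < q (Suc k)
    \<Longrightarrow> (-1) ^ k * \<sigma> - \<delta> k * t \<in> \<int> \<Longrightarrow> c \<le> R * shifted_prod M \<sigma>"
    by (rule shifted_prod_lower) blast
  have "sudler \<alpha> N \<le> 8 * exp 1 / c * real N" if N: "N \<ge> q k0" for N
  proof -
    \<comment> \<open>Minimality gives \<open>q k \<le> N\<close>, so that
      \<open>q (Suc k) \<le> 4 * N\<close> in the end.\<close>
    define k where "k = (LEAST k. k \<ge> k0 \<and> N < q (Suc k))"
    have k: "k \<ge> k0" "N < q (Suc k)" unfolding k_def using LeastI_ex[of "\<lambda>k. k \<ge> k0 \<and> N < q (Suc k)"] q_unbounded by blast+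
    have qk: "q k \<le> N"
    proof (cases "k = k0")
      case False
      then have "k - 1 < k" "k - 1 \<ge> k0" "Suc (k - 1) = k" using k by auto
      then have "\<not> (k - 1 \<ge> k0 \<and> N < q (Suc (k - 1)))" unfolding k_def by (intro not_less_Least) auto
      then have "\<not> N < q (Suc (k - 1))" using \<open>k - 1 \<ge> k0\<close> by blast
      then show ?thesis using \<open>Suc (k - 1) = k\<close> by simp
    qed (use N in simp)
    have g: "good k" by (rule good_mono[OF c(2) k(1)])
    have g': "good (Suc (Suc k))" by (rule good_mono[OF g]) simp
    let ?Q = "q (Suc k)" and ?\<xi> = "\<xi> (Suc k)"
    define M where "M = ?Q - 1 - N"
    have MQ: "M < ?Q" "?Q - M = Suc N" using k by (auto simp: M_def)
    \<comment> \<open>The value \<open>R = 2\<close> is artificial: since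
      \<open>\<xi> k * \<xi> (Suc k) \<le> 1/2\<close>, it makes the maximal shift an allowed start,
      at the price of a factor 2.\<close>
    have I: "level_inv k ?\<xi> M 2"
    proof -
      have x: "\<xi> k * (real 1 + ?\<xi>) \<le> 1" using a_pos[of "Suc k"] by (intro digit_range(1)[OF g]) auto
      have "\<xi> k * ?\<xi> \<le> \<xi> k * 1" using \<xi>_pos[of k] \<xi>_less_1[of "Suc k"] by (intro mult_left_mono) auto
      then have "\<xi> k * ?\<xi> \<le> 1/2" using x by (simp add: ring_distribs)
      then show ?thesis using \<xi>_pos[of "Suc k"] unfolding level_inv_def by simp
    qed
    have "c \<le> 2 * shifted_prod M (- (real ?Q * \<alpha>))"
      by (rule c(3)[OF k(1) I MQ(1) shift_convergent])
    also have "shifted_prod M (- (real ?Q * \<alpha>)) = (\<Prod>r=Suc N..<?Q. 2 * \<bar>sin (pi * (real r * \<alpha>))\<bar>)"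
      using prod_reflect[OF MQ(1)] MQ(2) by simp
    finally have low: "c / 2 \<le> (\<Prod>r=Suc N..<?Q. 2 * \<bar>sin (pi * (real r * \<alpha>))\<bar>)" by simp
    have S0: "0 \<le> sudler \<alpha> N" unfolding sudler_eq by (rule shifted_prod_nonneg)
    have "sudler \<alpha> N * (c / 2) \<le> sudler \<alpha> N * (\<Prod>r=Suc N..<?Q. 2 * \<bar>sin (pi * (real r * \<alpha>))\<bar>)"
      by (rule mult_left_mono[OF low S0])
    also have "\<dots> = (\<Prod>r=1..<?Q. 2 * \<bar>sin (pi * (real r * \<alpha>))\<bar>)"
    proof -
      have "{1..N} = {1..<Suc N}" by auto
      then show ?thesis using prod.atLeastLessThan_concat[of 1 "Suc N" ?Q "\<lambda>r. 2 * \<bar>sin (pi * (real r * \<alpha>))\<bar>"] k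
        by (simp add: sudler_eq)
    qed
    also have "\<dots> = exp (block_log ?Q (sp (Suc k)) (C (Suc k)) (C (Suc k) / 2))" by (rule prod_convergent) simp
    also have "\<dots> \<le> exp (ln ?Q + 1)"
    proof -
      let ?U = "slope_bound (a (Suc k)) + 1/1000"
      have "slope_le ?Q (sp (Suc k)) ?U" using good_slope(1)[OF g'] by simp
      then have "block_log ?Q (sp (Suc k)) (C (Suc k)) (C (Suc k) / 2) \<le> ln ?Q + ?U * C (Suc k)"
        by (intro convergent_log_upper) auto
      moreover have "?U * C (Suc k) \<le> 1 * 1"
        using C_less_1[of "Suc k"] C_pos[of "Suc k"] by (intro mult_mono) (auto simp: slope_bound_def)
      ultimately show ?thesis by simp
    qed
    also have "\<dots> = exp 1 * ?Q" using q_pos[of "Suc k"] by (simp add: exp_add)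
    also have "\<dots> \<le> exp 1 * (4 * real N)"
    proof (rule mult_left_mono)
      have "?Q = a (Suc k) * q k + q (k - 1)" using q_rec[of "k - 1"] good_ge[OF g] by simp
      also have "\<dots> \<le> 3 * q k + q k"
        using good_digits(3)[OF g] q_mono_Suc[of "k - 1"] good_ge[OF g] by (intro add_mono mult_right_mono) auto
      finally have "?Q \<le> 4 * N" using qk by linarith
      then show "real ?Q \<le> 4 * real N" by linarith
    qed simp
    finally show ?thesis using c(1) by (simp add: field_simps)
  qed
  then show ?thesis by blast
qed

end

theorem theorem1:
  fixes \<alpha> :: real and a :: "nat \<Rightarrow> nat"
  assumes "\<alpha> \<notin> \<rat>"
    and "has_cfrac_expansion \<alpha> 0 a"
    and "limsup (\<lambda>i. ereal (real (a i))) \<le> 3"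
  shows "liminf (\<lambda>N. ereal (sudler \<alpha> N)) > 0
       \<and> limsup (\<lambda>N. ereal (sudler \<alpha> N / real N)) < \<infinity>"
proof -
  \<comment> \<open>Being eventually below 4 is enough, as partial quotients are integers.\<close>
  have "limsup (\<lambda>i. ereal (real (a i))) < ereal 4"
    by (rule le_less_trans[OF assms(3)]) simp
  then have "eventually (\<lambda>i. ereal (real (a i)) < ereal 4) sequentially" by (rule Limsup_lessD)
  then obtain K where "\<And>i. i \<ge> K \<Longrightarrow> a i < 4" by (auto simp: eventually_sequentially)
  then interpret sudler_small \<alpha> a K using assms(1,2) by unfold_locales force+
  obtain c where c: "c > 0" "\<And>N. c \<le> sudler \<alpha> N" using sudler_lower by blast
  have "ereal c \<le> liminf (\<lambda>N. ereal (sudler \<alpha> N))"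
    using c by (intro Liminf_bounded) auto
  then have "liminf (\<lambda>N. ereal (sudler \<alpha> N)) > 0" using c(1) by (metis ereal_less(2) less_le_trans)
  moreover obtain d N0 where d: "\<And>N. N \<ge> N0 \<Longrightarrow> sudler \<alpha> N \<le> d * real N" using sudler_upper by blast
  have "sudler \<alpha> N / real N \<le> d" if "N \<ge> Suc N0" for N
    using d[of N] that by (simp add: divide_le_eq)
  then have "eventually (\<lambda>N. ereal (sudler \<alpha> N / real N) \<le> ereal d) sequentially"
    by (auto simp: eventually_sequentially)
  then have "limsup (\<lambda>N. ereal (sudler \<alpha> N / real N)) \<le> ereal d" by (rule Limsup_bounded)
  then have "limsup (\<lambda>N. ereal (sudler \<alpha> N / real N)) < \<infinity>" using le_less_trans by fastforce
  ultimately show ?thesis by blast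
qed

end
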